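(* Let $m,n\in\mathbb{N}_0$ with $m+n>1$ and let $\Theta=\{\theta_{ij}\in\mathbb{R}:1\le i<j\le m+n\}$. Let $J_n$ be the closed ideal of $B_\Theta^{m,n}$ generated by $1-(s_1s_2\cdots s_{m+n})(s_1s_2\cdots s_{m+n})^*$. Let $\pi$ be a unital representation of $B_\Theta^{m,n}$ on a Hilbert space. Then $\pi(J_n)$ is a stable $C^*$-algebra.
   Context: $\mathbb{N}_0=\mathbb{N}\cup\{0\}$; all Hilbert spaces and algebras are complex and separable. $B_\Theta^{m,n}$ is the universal (unital) $C^*$-algebra generated by $s_1,\dots,s_{m+n}$ subject to $s_is_j=e^{2\pi \mathrm{i}\theta_{ij}}s_js_i$ for $1\le i<j\le m+n$, $s_i^*s_i=1$ for $1\le i\le m+n$, and $s_is_i^*=1$ for $1\le i\le m$. A $C^*$-algebra $A$ is stable if $A\cong\mathcal{K}\otimes A$, where $\mathcal{K}$ is the algebra of compact operators on a separable infinite-dimensional Hilbert space. *)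

theory Defs
  imports "HOL-Analysis.Analysis"
begin

section \<open>Complex Hilbert spaces\<close>

text \<open>The real Banach space structure is the underlying one; the inner product is linear
  in its second argument.\<close>

class complex_hilbert_space = banach +
  fixes scaleC :: "complex \<Rightarrow> 'a \<Rightarrow> 'a" (infixr \<open>*\<^sub>C\<close> 75)
    and cinner :: "'a \<Rightarrow> 'a \<Rightarrow> complex"
  assumes scaleC_add_right: "c *\<^sub>C (x + y) = c *\<^sub>C x + c *\<^sub>C y"
    and scaleC_add_left: "(c + d) *\<^sub>C x = c *\<^sub>C x + d *\<^sub>C x"
    and scaleC_scaleC: "c *\<^sub>C (d *\<^sub>C x) = (c * d) *\<^sub>C x"
    and scaleC_of_real: "of_real r *\<^sub>C x = r *\<^sub>R x"
    and cinner_commute: "cinner x y = cnj (cinner y x)"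
    and cinner_add_right: "cinner x (y + z) = cinner x y + cinner x z"
    and cinner_scaleC_right: "cinner x (c *\<^sub>C y) = c * cinner x y"
    and cinner_self: "cinner x x = of_real ((norm x)\<^sup>2)"

lemma cinner_add_left:
  fixes x y z :: "'a::complex_hilbert_space"
  shows "cinner (x + y) z = cinner x z + cinner y z"
  by (metis cinner_add_right cinner_commute complex_cnj_add)

lemma cinner_scaleC_left:
  fixes x y z :: "'a::complex_hilbert_space"
  shows "cinner (c *\<^sub>C x) y = cnj c * cinner x y"
  by (metis cinner_commute cinner_scaleC_right complex_cnj_mult)

lemma cinner_minus_right:
  fixes x y z :: "'a::complex_hilbert_space"
  shows "cinner x (- y) = - cinner x y"
proof -
  have "- y = of_real (- 1) *\<^sub>C y" by (simp only: scaleC_of_real) simp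
  then show ?thesis by (simp only: cinner_scaleC_right) simp
qed

lemma cinner_minus_left:
  fixes x y z :: "'a::complex_hilbert_space"
  shows "cinner (- x) y = - cinner x y"
  by (metis cinner_commute cinner_minus_right complex_cnj_minus)

lemma norm_scaleC:
  fixes x y z :: "'a::complex_hilbert_space"
  shows "norm (c *\<^sub>C x) = cmod c * norm x"
proof -
  have "of_real ((norm (c *\<^sub>C x))\<^sup>2) = cnj c * c * of_real ((norm x)\<^sup>2)"
    by (simp only: cinner_self [symmetric] cinner_scaleC_left cinner_scaleC_right mult_ac)
  also have "\<dots> = of_real ((cmod c * norm x)\<^sup>2)"
    using complex_norm_square[of c] by (simp add: power_mult_distrib mult_ac)
  finally have "(norm (c *\<^sub>C x))\<^sup>2 = (cmod c * norm x)\<^sup>2"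
    using of_real_eq_iff by blast
  then show ?thesis by simp
qed

lemma Re_cinner_bound:
  fixes x y z :: "'a::complex_hilbert_space"
  shows "2 * \<bar>Re (cinner x y)\<bar> \<le> (norm x)\<^sup>2 + (norm y)\<^sup>2"
proof -
  have sym: "Re (cinner y x) = Re (cinner x y)" by (subst cinner_commute) simp
  have sq: "(norm z)\<^sup>2 = Re (cinner z z)" for z :: 'a by (simp add: cinner_self)
  have "(norm (x + y))\<^sup>2 = (norm x)\<^sup>2 + (norm y)\<^sup>2 + 2 * Re (cinner x y)"
    unfolding sq by (simp add: cinner_add_left cinner_add_right sym)
  moreover have "(norm (x + - y))\<^sup>2 = (norm x)\<^sup>2 + (norm y)\<^sup>2 - 2 * Re (cinner x y)"
    unfolding sq
    by (simp only: cinner_add_left cinner_add_right cinner_minus_left cinner_minus_right)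
       (simp add: sym)
  moreover have "(norm (x + y))\<^sup>2 \<ge> 0" "(norm (x + - y))\<^sup>2 \<ge> 0" by simp_all
  ultimately show ?thesis by linarith
qed

lemma cinner_bound:
  fixes x y z :: "'a::complex_hilbert_space"
  shows "cmod (cinner x y) \<le> (norm x)\<^sup>2 + (norm y)\<^sup>2"
proof -
  have "Im (cinner x y) = - Re (cinner x (\<i> *\<^sub>C y))" by (simp add: cinner_scaleC_right)
  then have "2 * \<bar>Im (cinner x y)\<bar> \<le> (norm x)\<^sup>2 + (norm y)\<^sup>2"
    using Re_cinner_bound[of x "\<i> *\<^sub>C y"] by (simp add: norm_scaleC)
  then show ?thesis using Re_cinner_bound[of x y] cmod_le[of "cinner x y"] by linarith
qed

instantiation complex :: complex_hilbert_space
begin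
definition scaleC_complex :: "complex \<Rightarrow> complex \<Rightarrow> complex"
  where "scaleC_complex c x = c * x"
definition cinner_complex :: "complex \<Rightarrow> complex \<Rightarrow> complex"
  where "cinner_complex x y = cnj x * y"
instance
proof
  fix x :: complex
  show "cinner x x = of_real ((norm x)\<^sup>2)"
    by (simp add: cinner_complex_def complex_norm_square mult.commute del: of_real_power)
qed (simp_all add: scaleC_complex_def cinner_complex_def algebra_simps scaleR_conv_of_real)
end

section \<open>Square-summable sequences in a Hilbert space\<close>

typedef (overloaded) 'h l2 = "{f :: nat \<Rightarrow> 'h::complex_hilbert_space. summable (\<lambda>n. (norm (f n))\<^sup>2)}"
  morphisms l2_nth Abs_l2
  by (rule exI[of _ "\<lambda>_. 0"]) simp

setup_lifting type_definition_l2

lemma l2_bounded_partial: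
  fixes f :: "nat \<Rightarrow> 'h::complex_hilbert_space"
  assumes "\<And>N. L2_set (\<lambda>n. norm (f n)) {..<N} \<le> C"
  shows "summable (\<lambda>n. (norm (f n))\<^sup>2)" "sqrt (\<Sum>n. (norm (f n))\<^sup>2) \<le> C"
proof -
  have C: "0 \<le> C" using assms[of 0] by simp
  have b: "(\<Sum>n<N. (norm (f n))\<^sup>2) \<le> C\<^sup>2" for N
    using assms[of N] C unfolding L2_set_def by (simp add: real_sqrt_le_iff sqrt_le_D)
  show s: "summable (\<lambda>n. (norm (f n))\<^sup>2)"
  proof (rule bounded_imp_summable)
    show "(\<Sum>n\<le>N. (norm (f n))\<^sup>2) \<le> C\<^sup>2" for N
      using b[of "Suc N"] by (simp add: lessThan_Suc_atMost)
  qed simp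
  have "(\<Sum>n. (norm (f n))\<^sup>2) \<le> C\<^sup>2" by (rule suminf_le_const[OF s b])
  then show "sqrt (\<Sum>n. (norm (f n))\<^sup>2) \<le> C" using C by (simp add: real_le_lsqrt)
qed

lemma L2_partial_le:
  fixes f :: "nat \<Rightarrow> 'h::complex_hilbert_space"
  assumes "summable (\<lambda>n. (norm (f n))\<^sup>2)"
  shows "L2_set (\<lambda>n. norm (f n)) {..<N} \<le> sqrt (\<Sum>n. (norm (f n))\<^sup>2)"
  unfolding L2_set_def using assms by (intro real_sqrt_le_mono sum_le_suminf) auto

lemma L2_add_partial:
  fixes f g :: "nat \<Rightarrow> 'h::complex_hilbert_space"
  assumes "summable (\<lambda>n. (norm (f n))\<^sup>2)" "summable (\<lambda>n. (norm (g n))\<^sup>2)"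
  shows "L2_set (\<lambda>n. norm (f n + g n)) {..<N}
    \<le> sqrt (\<Sum>n. (norm (f n))\<^sup>2) + sqrt (\<Sum>n. (norm (g n))\<^sup>2)"
proof -
  have "L2_set (\<lambda>n. norm (f n + g n)) {..<N} \<le> L2_set (\<lambda>n. norm (f n) + norm (g n)) {..<N}"
    by (rule L2_set_mono) (simp_all add: norm_triangle_ineq)
  also have "\<dots> \<le> L2_set (\<lambda>n. norm (f n)) {..<N} + L2_set (\<lambda>n. norm (g n)) {..<N}"
    by (rule L2_set_triangle_ineq)
  finally show ?thesis using L2_partial_le[OF assms(1), of N] L2_partial_le[OF assms(2), of N]
    by linarith
qed

lemma summable_scaleC:
  fixes f :: "nat \<Rightarrow> 'h::complex_hilbert_space"
  assumes "summable (\<lambda>n. (norm (f n))\<^sup>2)"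
  shows "summable (\<lambda>n. (norm (c *\<^sub>C f n))\<^sup>2)"
  using assms by (simp add: norm_scaleC power_mult_distrib summable_mult)

lemma summable_cinner:
  fixes f g :: "nat \<Rightarrow> 'h::complex_hilbert_space"
  assumes "summable (\<lambda>n. (norm (f n))\<^sup>2)" "summable (\<lambda>n. (norm (g n))\<^sup>2)"
  shows "summable (\<lambda>n. cinner (f n) (g n))"
  by (rule summable_comparison_test[OF _ summable_add[OF assms]]) (auto intro: cinner_bound)

instantiation l2 :: (complex_hilbert_space) real_normed_vector
begin

lift_definition zero_l2 :: "'a l2" is "\<lambda>_. 0" by simp
lift_definition uminus_l2 :: "'a l2 \<Rightarrow> 'a l2" is "\<lambda>f n. - f n" by simp
lift_definition plus_l2 :: "'a l2 \<Rightarrow> 'a l2 \<Rightarrow> 'a l2" is "\<lambda>f g n. f n + g n"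
  by (rule l2_bounded_partial(1)[OF L2_add_partial])
lift_definition minus_l2 :: "'a l2 \<Rightarrow> 'a l2 \<Rightarrow> 'a l2" is "\<lambda>f g n. f n - g n"
proof -
  fix f g :: "nat \<Rightarrow> 'a"
  assume "summable (\<lambda>n. (norm (f n))\<^sup>2)" "summable (\<lambda>n. (norm (g n))\<^sup>2)"
  then show "summable (\<lambda>n. (norm (f n - g n))\<^sup>2)"
    using l2_bounded_partial(1)[OF L2_add_partial, of f "\<lambda>n. - g n"] by simp
qed
lift_definition scaleR_l2 :: "real \<Rightarrow> 'a l2 \<Rightarrow> 'a l2" is "\<lambda>r f n. r *\<^sub>R f n"
  by (simp add: power_mult_distrib summable_mult)
lift_definition norm_l2 :: "'a l2 \<Rightarrow> real" is "\<lambda>f. sqrt (\<Sum>n. (norm (f n))\<^sup>2)" .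
definition sgn_l2 :: "'a l2 \<Rightarrow> 'a l2" where "sgn_l2 x = inverse (norm x) *\<^sub>R x"
definition dist_l2 :: "'a l2 \<Rightarrow> 'a l2 \<Rightarrow> real" where "dist_l2 x y = norm (x - y)"
definition uniformity_l2 :: "('a l2 \<times> 'a l2) filter"
  where "uniformity_l2 = (INF e\<in>{0 <..}. principal {(x, y). dist x y < e})"
definition open_l2 :: "'a l2 set \<Rightarrow> bool"
  where "open_l2 U = (\<forall>x\<in>U. eventually (\<lambda>(x', y). x' = x \<longrightarrow> y \<in> U) uniformity)"

instance
proof
  fix x y z :: "'a l2" and r s :: real
  show "x + y + z = x + (y + z)" by transfer (simp add: add.assoc)
  show "x + y = y + x" by transfer (simp add: add.commute)
  show "0 + x = x" by transfer simp
  show "- x + x = 0" by transfer simp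
  show "x - y = x + - y" by transfer simp
  show "r *\<^sub>R (x + y) = r *\<^sub>R x + r *\<^sub>R y" by transfer (simp add: scaleR_add_right)
  show "(r + s) *\<^sub>R x = r *\<^sub>R x + s *\<^sub>R x" by transfer (simp add: scaleR_add_left)
  show "r *\<^sub>R s *\<^sub>R x = (r * s) *\<^sub>R x" by transfer simp
  show "1 *\<^sub>R x = x" by transfer simp
  show "dist x y = norm (x - y)" by (rule dist_l2_def)
  show "sgn x = inverse (norm x) *\<^sub>R x" by (rule sgn_l2_def)
  show "uniformity = (INF e\<in>{0 <..}. principal {(x :: 'a l2, y). dist x y < e})"
    by (rule uniformity_l2_def)
  show "open U = (\<forall>x\<in>U. eventually (\<lambda>(x', y). x' = x \<longrightarrow> y \<in> U) uniformity)" for U :: "'a l2 set"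
    by (rule open_l2_def)
  show "norm (x + y) \<le> norm x + norm y"
    by transfer (rule l2_bounded_partial(2)[OF L2_add_partial])
  show "norm (r *\<^sub>R x) = \<bar>r\<bar> * norm x"
    by transfer (simp add: power_mult_distrib suminf_mult real_sqrt_mult)
  show "norm x = 0 \<longleftrightarrow> x = 0"
    by transfer (auto simp: suminf_eq_zero_iff)
qed

end

lemma norm_l2_nth_le: "norm (l2_nth x n) \<le> norm x"
proof -
  have "norm (l2_nth x n) \<le> L2_set (\<lambda>k. norm (l2_nth x k)) {..<Suc n}"
    by (rule member_le_L2_set) auto
  also have "\<dots> \<le> norm x"
    unfolding norm_l2.rep_eq using l2_nth[of x] by (intro L2_partial_le) simp
  finally show ?thesis .
qed

instantiation l2 :: (complex_hilbert_space) complex_hilbert_space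
begin

lift_definition scaleC_l2 :: "complex \<Rightarrow> 'a l2 \<Rightarrow> 'a l2" is "\<lambda>c f n. c *\<^sub>C f n"
  by (rule summable_scaleC)
lift_definition cinner_l2 :: "'a l2 \<Rightarrow> 'a l2 \<Rightarrow> complex" is "\<lambda>f g. \<Sum>n. cinner (f n) (g n)" .

instance
proof
  fix X :: "nat \<Rightarrow> 'a l2"
  assume X: "Cauchy X"
  have "Cauchy (\<lambda>k. l2_nth (X k) n)" for n
  proof (rule metric_CauchyI)
    fix e :: real assume "e > 0"
    then obtain M where M: "\<And>k l. k \<ge> M \<Longrightarrow> l \<ge> M \<Longrightarrow> dist (X k) (X l) < e"
      using metric_CauchyD[OF X] by blast
    have "dist (l2_nth (X k) n) (l2_nth (X l) n) \<le> dist (X k) (X l)" for k l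
      using norm_l2_nth_le[of "X k - X l" n] by (simp add: dist_norm minus_l2.rep_eq)
    then show "\<exists>M. \<forall>k\<ge>M. \<forall>l\<ge>M. dist (l2_nth (X k) n) (l2_nth (X l) n) < e"
      using M by (meson le_less_trans)
  qed
  then have "\<exists>l. (\<lambda>k. l2_nth (X k) n) \<longlonglongrightarrow> l" for n
    using Cauchy_convergent convergent_def by blast
  then obtain L where L: "\<And>n. (\<lambda>k. l2_nth (X k) n) \<longlonglongrightarrow> L n" by metis
  have part: "L2_set (\<lambda>n. norm (l2_nth (X k) n - L n)) {..<N} \<le> e"
    if M: "\<And>k l. k \<ge> M \<Longrightarrow> l \<ge> M \<Longrightarrow> dist (X k) (X l) < e" and k: "k \<ge> M" for k N M e
  proof (rule LIMSEQ_le_const2)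
    show "(\<lambda>l. L2_set (\<lambda>n. norm (l2_nth (X k) n - l2_nth (X l) n)) {..<N})
        \<longlonglongrightarrow> L2_set (\<lambda>n. norm (l2_nth (X k) n - L n)) {..<N}"
      unfolding L2_set_def by (intro tendsto_intros L)
    have "L2_set (\<lambda>n. norm (l2_nth (X k) n - l2_nth (X l) n)) {..<N} \<le> dist (X k) (X l)" for l
      using L2_partial_le[of "l2_nth (X k - X l)" N] l2_nth[of "X k - X l"]
      by (simp add: dist_norm norm_l2.rep_eq minus_l2.rep_eq)
    then show "\<exists>M. \<forall>l\<ge>M. L2_set (\<lambda>n. norm (l2_nth (X k) n - l2_nth (X l) n)) {..<N} \<le> e"
      using M[OF k] by (meson le_less_trans less_imp_le)
  qed
  have diff: "summable (\<lambda>n. (norm (l2_nth (X k) n - L n))\<^sup>2)"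
      "sqrt (\<Sum>n. (norm (l2_nth (X k) n - L n))\<^sup>2) \<le> e"
    if M: "\<And>k l. k \<ge> M \<Longrightarrow> l \<ge> M \<Longrightarrow> dist (X k) (X l) < e" and k: "k \<ge> M" for k M e
    using l2_bounded_partial[OF part[OF M k]] by auto
  obtain M where M: "\<And>k l. k \<ge> M \<Longrightarrow> l \<ge> M \<Longrightarrow> dist (X k) (X l) < 1"
    using metric_CauchyD[OF X, of 1] by auto
  have sL: "summable (\<lambda>n. (norm (L n))\<^sup>2)"
    using l2_nth[of "X M - Abs_l2 (\<lambda>n. l2_nth (X M) n - L n)"] diff(1)[OF M order_refl]
    by (simp add: minus_l2.rep_eq Abs_l2_inverse)
  have "X \<longlonglongrightarrow> Abs_l2 L"
  proof (rule metric_LIMSEQ_I)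
    fix e :: real assume e: "e > 0"
    then obtain M where M: "\<And>k l. k \<ge> M \<Longrightarrow> l \<ge> M \<Longrightarrow> dist (X k) (X l) < e / 2"
      using metric_CauchyD[OF X, of "e / 2"] by auto
    have "dist (X k) (Abs_l2 L) \<le> e / 2" if "k \<ge> M" for k
      using diff(2)[OF M that] sL
      by (simp add: dist_norm norm_l2.rep_eq minus_l2.rep_eq Abs_l2_inverse)
    then show "\<exists>M. \<forall>k\<ge>M. dist (X k) (Abs_l2 L) < e" using e by (intro exI[of _ M]) force
  qed
  then show "convergent X" by (rule convergentI)
next
  fix x y z :: "'a l2" and c d :: complex and r :: real
  show "c *\<^sub>C (x + y) = c *\<^sub>C x + c *\<^sub>C y" by transfer (simp add: scaleC_add_right)
  show "(c + d) *\<^sub>C x = c *\<^sub>C x + d *\<^sub>C x" by transfer (simp add: scaleC_add_left)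
  show "c *\<^sub>C (d *\<^sub>C x) = (c * d) *\<^sub>C x" by transfer (simp add: scaleC_scaleC)
  show "of_real r *\<^sub>C x = r *\<^sub>R x" by transfer (simp add: scaleC_of_real)
  show "cinner x y = cnj (cinner y x)"
  proof transfer
    fix x y :: "nat \<Rightarrow> 'a"
    assume a: "summable (\<lambda>n. (norm (x n))\<^sup>2)" "summable (\<lambda>n. (norm (y n))\<^sup>2)"
    have "(\<lambda>n. cnj (cinner (y n) (x n))) sums cnj (\<Sum>n. cinner (y n) (x n))"
      using summable_cinner[OF a(2,1)] by (simp add: sums_cnj summable_sums)
    then show "(\<Sum>n. cinner (x n) (y n)) = cnj (\<Sum>n. cinner (y n) (x n))"
      by (simp add: sums_iff cinner_commute[symmetric])
  qed
  show "cinner x (y + z) = cinner x y + cinner x z"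
    by transfer (simp add: cinner_add_right suminf_add summable_cinner)
  show "cinner x (c *\<^sub>C y) = c * cinner x y"
    by transfer (simp add: cinner_scaleC_right suminf_mult summable_cinner)
  show "cinner x x = of_real ((norm x)\<^sup>2)"
    by transfer
      (simp add: cinner_self suminf_nonneg suminf_of_real[symmetric] del: of_real_power)
qed

end

text \<open>Under the identification of \<open>\<ell>\<^sup>2(\<nat>) \<otimes> H\<close> with \<open>\<ell>\<^sup>2(\<nat>, H)\<close>, the elementary tensor
  of \<open>x\<close> and \<open>h\<close> is the sequence \<open>n \<mapsto> x\<^sub>n h\<close>.\<close>

lift_definition tensor_vec :: "complex l2 \<Rightarrow> 'h::complex_hilbert_space \<Rightarrow> 'h l2"
  is "\<lambda>x h n. x n *\<^sub>C h"
  by (simp add: norm_scaleC power_mult_distrib summable_mult2)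

section \<open>C*-algebras\<close>

text \<open>The algebra operations are only constrained on the carrier, and a unit is not part of the
  structure, so that ideals and algebras of compact operators are covered.\<close>

record 'a star_algebra =
  carr :: "'a set"
  czero :: 'a
  cadd :: "'a \<Rightarrow> 'a \<Rightarrow> 'a"
  cscale :: "complex \<Rightarrow> 'a \<Rightarrow> 'a"
  cmult :: "'a \<Rightarrow> 'a \<Rightarrow> 'a"
  cstar :: "'a \<Rightarrow> 'a"
  cnorm :: "'a \<Rightarrow> real"

definition csub :: "'a star_algebra \<Rightarrow> 'a \<Rightarrow> 'a \<Rightarrow> 'a" where
  "csub A x y = cadd A x (cscale A (- 1) y)"

definition cconverges :: "'a star_algebra \<Rightarrow> (nat \<Rightarrow> 'a) \<Rightarrow> 'a \<Rightarrow> bool" where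
  "cconverges A X l \<longleftrightarrow> (\<lambda>k. cnorm A (csub A (X k) l)) \<longlonglongrightarrow> 0"

definition cCauchy :: "'a star_algebra \<Rightarrow> (nat \<Rightarrow> 'a) \<Rightarrow> bool" where
  "cCauchy A X \<longleftrightarrow> (\<forall>e>0. \<exists>N. \<forall>k\<ge>N. \<forall>l\<ge>N. cnorm A (csub A (X k) (X l)) < e)"

locale cstar_algebra =
  fixes A :: "'a star_algebra"
  assumes zero_closed: "czero A \<in> carr A"
    and add_closed: "\<lbrakk>x \<in> carr A; y \<in> carr A\<rbrakk> \<Longrightarrow> cadd A x y \<in> carr A"
    and scale_closed: "x \<in> carr A \<Longrightarrow> cscale A c x \<in> carr A"
    and mult_closed: "\<lbrakk>x \<in> carr A; y \<in> carr A\<rbrakk> \<Longrightarrow> cmult A x y \<in> carr A"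
    and star_closed: "x \<in> carr A \<Longrightarrow> cstar A x \<in> carr A"
    and add_assoc: "\<lbrakk>x \<in> carr A; y \<in> carr A; z \<in> carr A\<rbrakk>
      \<Longrightarrow> cadd A (cadd A x y) z = cadd A x (cadd A y z)"
    and add_commute: "\<lbrakk>x \<in> carr A; y \<in> carr A\<rbrakk> \<Longrightarrow> cadd A x y = cadd A y x"
    and add_zero: "x \<in> carr A \<Longrightarrow> cadd A x (czero A) = x"
    and add_minus: "x \<in> carr A \<Longrightarrow> cadd A x (cscale A (- 1) x) = czero A"
    and scale_one: "x \<in> carr A \<Longrightarrow> cscale A 1 x = x"
    and scale_scale: "x \<in> carr A \<Longrightarrow> cscale A c (cscale A d x) = cscale A (c * d) x"
    and scale_add_left: "x \<in> carr A \<Longrightarrow> cscale A (c + d) x = cadd A (cscale A c x) (cscale A d x)"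
    and scale_add_right: "\<lbrakk>x \<in> carr A; y \<in> carr A\<rbrakk>
      \<Longrightarrow> cscale A c (cadd A x y) = cadd A (cscale A c x) (cscale A c y)"
    and mult_assoc: "\<lbrakk>x \<in> carr A; y \<in> carr A; z \<in> carr A\<rbrakk>
      \<Longrightarrow> cmult A (cmult A x y) z = cmult A x (cmult A y z)"
    and mult_add_left: "\<lbrakk>x \<in> carr A; y \<in> carr A; z \<in> carr A\<rbrakk>
      \<Longrightarrow> cmult A (cadd A x y) z = cadd A (cmult A x z) (cmult A y z)"
    and mult_add_right: "\<lbrakk>x \<in> carr A; y \<in> carr A; z \<in> carr A\<rbrakk>
      \<Longrightarrow> cmult A x (cadd A y z) = cadd A (cmult A x y) (cmult A x z)"
    and mult_scale_left: "\<lbrakk>x \<in> carr A; y \<in> carr A\<rbrakk>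
      \<Longrightarrow> cmult A (cscale A c x) y = cscale A c (cmult A x y)"
    and mult_scale_right: "\<lbrakk>x \<in> carr A; y \<in> carr A\<rbrakk>
      \<Longrightarrow> cmult A x (cscale A c y) = cscale A c (cmult A x y)"
    and star_star: "x \<in> carr A \<Longrightarrow> cstar A (cstar A x) = x"
    and star_add: "\<lbrakk>x \<in> carr A; y \<in> carr A\<rbrakk> \<Longrightarrow> cstar A (cadd A x y) = cadd A (cstar A x) (cstar A y)"
    and star_scale: "x \<in> carr A \<Longrightarrow> cstar A (cscale A c x) = cscale A (cnj c) (cstar A x)"
    and star_mult: "\<lbrakk>x \<in> carr A; y \<in> carr A\<rbrakk>
      \<Longrightarrow> cstar A (cmult A x y) = cmult A (cstar A y) (cstar A x)"
    and norm_nonneg: "x \<in> carr A \<Longrightarrow> 0 \<le> cnorm A x"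
    and norm_eq_zero: "x \<in> carr A \<Longrightarrow> cnorm A x = 0 \<longleftrightarrow> x = czero A"
    and norm_scale: "x \<in> carr A \<Longrightarrow> cnorm A (cscale A c x) = cmod c * cnorm A x"
    and norm_triangle: "\<lbrakk>x \<in> carr A; y \<in> carr A\<rbrakk> \<Longrightarrow> cnorm A (cadd A x y) \<le> cnorm A x + cnorm A y"
    and norm_mult_le: "\<lbrakk>x \<in> carr A; y \<in> carr A\<rbrakk> \<Longrightarrow> cnorm A (cmult A x y) \<le> cnorm A x * cnorm A y"
    and cstar_identity: "x \<in> carr A \<Longrightarrow> cnorm A (cmult A (cstar A x) x) = (cnorm A x)\<^sup>2"
    and complete: "\<lbrakk>\<And>k. X k \<in> carr A; cCauchy A X\<rbrakk> \<Longrightarrow> \<exists>l\<in>carr A. cconverges A X l"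

definition is_one :: "'a star_algebra \<Rightarrow> 'a \<Rightarrow> bool" where
  "is_one A e \<longleftrightarrow> e \<in> carr A \<and> (\<forall>x\<in>carr A. cmult A e x = x \<and> cmult A x e = x)"

definition cone :: "'a star_algebra \<Rightarrow> 'a" where
  "cone A = (THE e. is_one A e)"

definition unital_cstar_algebra :: "'a star_algebra \<Rightarrow> bool" where
  "unital_cstar_algebra A \<longleftrightarrow> cstar_algebra A \<and> (\<exists>e. is_one A e)"

definition star_hom :: "'a star_algebra \<Rightarrow> 'b star_algebra \<Rightarrow> ('a \<Rightarrow> 'b) \<Rightarrow> bool" where
  "star_hom A D \<phi> \<longleftrightarrow>
    (\<forall>x\<in>carr A. \<phi> x \<in> carr D) \<and>
    (\<forall>x\<in>carr A. \<forall>y\<in>carr A. \<phi> (cadd A x y) = cadd D (\<phi> x) (\<phi> y)) \<and>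
    (\<forall>c. \<forall>x\<in>carr A. \<phi> (cscale A c x) = cscale D c (\<phi> x)) \<and>
    (\<forall>x\<in>carr A. \<forall>y\<in>carr A. \<phi> (cmult A x y) = cmult D (\<phi> x) (\<phi> y)) \<and>
    (\<forall>x\<in>carr A. \<phi> (cstar A x) = cstar D (\<phi> x))"

definition unital_star_hom :: "'a star_algebra \<Rightarrow> 'b star_algebra \<Rightarrow> ('a \<Rightarrow> 'b) \<Rightarrow> bool" where
  "unital_star_hom A D \<phi> \<longleftrightarrow> star_hom A D \<phi> \<and> \<phi> (cone A) = cone D"

definition star_isomorphic :: "'a star_algebra \<Rightarrow> 'b star_algebra \<Rightarrow> bool" where
  "star_isomorphic A D \<longleftrightarrow> (\<exists>\<phi>. star_hom A D \<phi> \<and> bij_betw \<phi> (carr A) (carr D))"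

definition cclosed :: "'a star_algebra \<Rightarrow> 'a set \<Rightarrow> bool" where
  "cclosed A S \<longleftrightarrow> (\<forall>X l. (\<forall>k. X k \<in> S) \<and> l \<in> carr A \<and> cconverges A X l \<longrightarrow> l \<in> S)"

definition closed_ideal :: "'a star_algebra \<Rightarrow> 'a set \<Rightarrow> bool" where
  "closed_ideal A I \<longleftrightarrow> I \<subseteq> carr A \<and> czero A \<in> I \<and>
    (\<forall>x\<in>I. \<forall>y\<in>I. cadd A x y \<in> I) \<and> (\<forall>c. \<forall>x\<in>I. cscale A c x \<in> I) \<and>
    (\<forall>a\<in>carr A. \<forall>x\<in>I. cmult A a x \<in> I \<and> cmult A x a \<in> I) \<and> cclosed A I"

definition closed_ideal_generated :: "'a star_algebra \<Rightarrow> 'a set \<Rightarrow> 'a set" where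
  "closed_ideal_generated A S = \<Inter>{I. closed_ideal A I \<and> S \<subseteq> I}"

definition unital_cstar_subalgebra :: "'a star_algebra \<Rightarrow> 'a set \<Rightarrow> bool" where
  "unital_cstar_subalgebra A S \<longleftrightarrow> S \<subseteq> carr A \<and> czero A \<in> S \<and> cone A \<in> S \<and>
    (\<forall>x\<in>S. \<forall>y\<in>S. cadd A x y \<in> S \<and> cmult A x y \<in> S) \<and>
    (\<forall>c. \<forall>x\<in>S. cscale A c x \<in> S) \<and> (\<forall>x\<in>S. cstar A x \<in> S) \<and> cclosed A S"

section \<open>The universal algebra of twisted isometries\<close>

definition twisted_relations ::
    "nat \<Rightarrow> nat \<Rightarrow> (nat \<Rightarrow> nat \<Rightarrow> real) \<Rightarrow> 'a star_algebra \<Rightarrow> (nat \<Rightarrow> 'a) \<Rightarrow> bool" where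
  "twisted_relations m n \<Theta> A s \<longleftrightarrow>
    (\<forall>i\<in>{1..m+n}. s i \<in> carr A) \<and>
    (\<forall>i j. 1 \<le> i \<and> i < j \<and> j \<le> m + n \<longrightarrow>
       cmult A (s i) (s j) = cscale A (exp (2 * of_real pi * \<i> * of_real (\<Theta> i j))) (cmult A (s j) (s i))) \<and>
    (\<forall>i\<in>{1..m+n}. cmult A (cstar A (s i)) (s i) = cone A) \<and>
    (\<forall>i\<in>{1..m}. cmult A (s i) (cstar A (s i)) = cone A)"

text \<open>The universal property is tested against all unital C*-algebras carried by a set of real
  numbers. This loses nothing: the C*-subalgebra generated by finitely many elements is separable,
  hence has at most continuum many elements and is isomorphic to an algebra of this form.\<close>

definition universal_twisted_algebra ::
    "nat \<Rightarrow> nat \<Rightarrow> (nat \<Rightarrow> nat \<Rightarrow> real) \<Rightarrow> 'a star_algebra \<Rightarrow> (nat \<Rightarrow> 'a) \<Rightarrow> bool" where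
  "universal_twisted_algebra m n \<Theta> B s \<longleftrightarrow>
    unital_cstar_algebra B \<and> twisted_relations m n \<Theta> B s \<and>
    (\<forall>S. unital_cstar_subalgebra B S \<and> s ` {1..m+n} \<subseteq> S \<longrightarrow> S = carr B) \<and>
    (\<forall>(D :: real star_algebra) t. unital_cstar_algebra D \<and> twisted_relations m n \<Theta> D t \<longrightarrow>
       (\<exists>\<phi>. unital_star_hom B D \<phi> \<and> (\<forall>i\<in>{1..m+n}. \<phi> (s i) = t i)))"

definition generator_product :: "'a star_algebra \<Rightarrow> (nat \<Rightarrow> 'a) \<Rightarrow> nat \<Rightarrow> 'a" where
  "generator_product A s N = foldr (cmult A) (map s [1..<Suc N]) (cone A)"

definition J_ideal :: "'a star_algebra \<Rightarrow> (nat \<Rightarrow> 'a) \<Rightarrow> nat \<Rightarrow> 'a set" where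
  "J_ideal A s N = closed_ideal_generated A
    {csub A (cone A) (cmult A (generator_product A s N) (cstar A (generator_product A s N)))}"

section \<open>Operators on a Hilbert space and stability\<close>

definition complex_linear :: "('h::complex_hilbert_space \<Rightarrow>\<^sub>L 'k::complex_hilbert_space) \<Rightarrow> bool" where
  "complex_linear T \<longleftrightarrow> (\<forall>c x. blinfun_apply T (c *\<^sub>C x) = c *\<^sub>C blinfun_apply T x)"

definition op_scale :: "complex \<Rightarrow> ('h::complex_hilbert_space \<Rightarrow>\<^sub>L 'h) \<Rightarrow> ('h \<Rightarrow>\<^sub>L 'h)" where
  "op_scale c T = Blinfun (\<lambda>x. c *\<^sub>C blinfun_apply T x)"

definition adjoint_op :: "('h::complex_hilbert_space \<Rightarrow>\<^sub>L 'h) \<Rightarrow> ('h \<Rightarrow>\<^sub>L 'h)" where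
  "adjoint_op T = (THE S. \<forall>x y. cinner (blinfun_apply S x) y = cinner x (blinfun_apply T y))"

definition operator_algebra :: "('h::complex_hilbert_space \<Rightarrow>\<^sub>L 'h) set \<Rightarrow> ('h \<Rightarrow>\<^sub>L 'h) star_algebra" where
  "operator_algebra S = \<lparr>carr = S, czero = 0, cadd = (+), cscale = op_scale,
     cmult = (o\<^sub>L), cstar = adjoint_op, cnorm = norm\<rparr>"

definition bounded_operators :: "('h::complex_hilbert_space \<Rightarrow>\<^sub>L 'h) star_algebra" where
  "bounded_operators = operator_algebra {T. complex_linear T}"

definition compact_operators :: "('h::complex_hilbert_space \<Rightarrow>\<^sub>L 'h) set" where
  "compact_operators = {T. complex_linear T \<and> compact (closure (blinfun_apply T ` cball 0 1))}"

definition is_tensor_op ::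
    "(complex l2 \<Rightarrow>\<^sub>L complex l2) \<Rightarrow> ('h::complex_hilbert_space \<Rightarrow>\<^sub>L 'h) \<Rightarrow> ('h l2 \<Rightarrow>\<^sub>L 'h l2) \<Rightarrow> bool" where
  "is_tensor_op k a T \<longleftrightarrow> complex_linear T \<and>
    (\<forall>x h. blinfun_apply T (tensor_vec x h) = tensor_vec (blinfun_apply k x) (blinfun_apply a h))"

text \<open>The (spatial) C*-tensor product of the compact operators on \<open>\<ell>\<^sup>2(\<nat>)\<close> with a set \<open>S\<close> of
  operators on \<open>H\<close>, acting on \<open>\<ell>\<^sup>2(\<nat>) \<otimes> H\<close>; the compact operators being nuclear, there is only
  one C*-tensor product. The real span suffices because the elementary tensors are closed under
  complex multiples.\<close>

definition compact_tensor :: "('h::complex_hilbert_space \<Rightarrow>\<^sub>L 'h) set \<Rightarrow> ('h l2 \<Rightarrow>\<^sub>L 'h l2) set" where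
  "compact_tensor S = closure (span {T. \<exists>k\<in>compact_operators. \<exists>a\<in>S. is_tensor_op k a T})"

definition stable_operator_algebra :: "('h::complex_hilbert_space \<Rightarrow>\<^sub>L 'h) set \<Rightarrow> bool" where
  "stable_operator_algebra S \<longleftrightarrow>
    S \<subseteq> {T. complex_linear T} \<and> cstar_algebra (operator_algebra S) \<and>
    star_isomorphic (operator_algebra S) (operator_algebra (compact_tensor S))"

end

theory Submission
  imports Defs
begin

text \<open>Write \<open>S = s\<^sub>1 \<cdots> s\<^bsub>m+n\<^esub>\<close>, an isometry, and \<open>e\<^sub>k = 1 - S\<^sup>k S\<^sup>*\<^sup>k\<close>. Since \<open>s\<^sub>i\<close> commutes with \<open>S\<close> up to a
  scalar and \<open>s\<^sub>i\<^sup>* S\<close> is, up to a scalar, the product of the other generators, \<open>e\<^sub>j b S\<^sup>k\<close> tends to \<open>0\<close> for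
  \<open>k \<rightarrow> \<infinity>\<close> first for generators and their adjoints and then for all \<open>b\<close>. As \<open>e\<^sub>1\<close> generates \<open>J\<^sub>n\<close>, the
  projections \<open>e\<^sub>k\<close> form an approximate unit of \<open>J\<^sub>n\<close>. They are the partial sums of \<open>\<Sum> F\<^sub>k F\<^sub>k\<^sup>*\<close> with
  \<open>F\<^sub>k = S\<^sup>k e\<^sub>1\<close> and \<open>F\<^sub>k\<^sup>* F\<^sub>l = \<delta>\<^sub>k\<^sub>l e\<^sub>1\<close>, so \<open>\<pi>(J\<^sub>n)\<close> is an algebra of infinite matrices over the corner at \<open>e\<^sub>1\<close>,
  and a bijection of \<open>\<nat> \<times> \<nat>\<close> with \<open>\<nat>\<close> gives \<open>\<pi>(J\<^sub>n) \<cong> \<K> \<otimes> \<pi>(J\<^sub>n)\<close>.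

  That \<open>\<pi>(J\<^sub>n)\<close> is closed is proved without functional calculus: for self-adjoint \<open>x\<close> the element
  \<open>\<i> x (x + \<i>)\<^sup>-\<^sup>1\<close> has norm at most \<open>2\<close> by the Cayley transform, and its image differs from \<open>\<pi>(x)\<close> by at
  most \<open>\<parallel>\<pi>(x)\<parallel>\<^sup>2\<close>; rescaling gives approximate preimages of controlled norm, which sum to a preimage.\<close>

section \<open>Operators between Hilbert spaces\<close>

text \<open>The relations let generators move past each other, but for proper isometries they say
  nothing about \<open>s\<^sub>i\<^sup>*\<close> against \<open>s\<^sub>j\<close>, so mixed words in
  generators and adjoints cannot be brought into a normal form. This is why \<open>S\<close>
  contains every generator: an adjoint only ever meets \<open>S\<close>, where it finds the factor
  that it cancels. For arbitrary elements only the asymptotic statement about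
  \<open>e\<^sub>j b S\<^sup>k\<close> survives. It passes to products because it is demanded for
  all \<open>j\<close> at once.

  The representation may be neither faithful nor nondegenerate on the ideal. All estimates with the
  \<open>e\<^sub>k\<close> are therefore made inside the algebra, and \<open>\<pi>\<close>, being
  contractive, only transports them. On the Hilbert space side, the operator that matches the two
  families of partial isometries need not be unitary; it is enough that it behaves like a unitary on
  the closed span of the ranges of the \<open>F\<^sub>k\<close>, where the image of the ideal
  acts.\<close>

lemma bounded_bilinear_scaleC:
  "bounded_bilinear (scaleC :: complex \<Rightarrow> 'a \<Rightarrow> 'a::complex_hilbert_space)"
proof
  fix c d :: complex and x y :: 'a and r :: real
  show "(c + d) *\<^sub>C x = c *\<^sub>C x + d *\<^sub>C x" by (rule scaleC_add_left)
  show "c *\<^sub>C (x + y) = c *\<^sub>C x + c *\<^sub>C y" by (rule scaleC_add_right)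
  show "(r *\<^sub>R c) *\<^sub>C x = r *\<^sub>R (c *\<^sub>C x)"
    by (simp only: scaleC_of_real[symmetric, of r "c *\<^sub>C x"] scaleC_scaleC scaleR_conv_of_real)
  show "c *\<^sub>C (r *\<^sub>R x) = r *\<^sub>R (c *\<^sub>C x)"
    by (simp only: scaleC_of_real[symmetric, of r] scaleC_scaleC mult.commute)
  show "\<exists>K. \<forall>(c::complex) (x::'a). norm (c *\<^sub>C x) \<le> norm c * norm x * K"
    by (rule exI[of _ 1]) (simp add: norm_scaleC)
qed

interpretation scaleC: bounded_bilinear "scaleC :: complex \<Rightarrow> 'a \<Rightarrow> 'a::complex_hilbert_space"
  by (rule bounded_bilinear_scaleC)

lemma scaleC_one [simp]: "1 *\<^sub>C x = (x::'a::complex_hilbert_space)"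
  using scaleC_of_real[of 1 x] by simp

lemma cinner_scaleR_right: "cinner x (r *\<^sub>R y) = r *\<^sub>R cinner x (y::'a::complex_hilbert_space)"
  using cinner_scaleC_right[of x "of_real r" y] by (simp add: scaleC_of_real scaleR_conv_of_real)

lemma cinner_scaleR_left: "cinner (r *\<^sub>R x) y = r *\<^sub>R cinner (x::'a::complex_hilbert_space) y"
  using cinner_scaleC_left[of "of_real r" x y] by (simp add: scaleC_of_real scaleR_conv_of_real)

lemma Re_Cauchy_Schwarz:
  fixes x y :: "'a::complex_hilbert_space"
  shows "\<bar>Re (cinner x y)\<bar> \<le> norm x * norm y"
proof (cases "x = 0 \<or> y = 0")
  case True
  then have "cinner x y = 0"
    using cinner_scaleR_left[of 0 x y] cinner_scaleR_right[of x 0 y] by auto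
  then show ?thesis by simp
next
  case False
  then have p: "norm x > 0" "norm y > 0" by auto
  define a where "a = inverse (norm x) *\<^sub>R x"
  define b where "b = inverse (norm y) *\<^sub>R y"
  have n: "norm a = 1" "norm b = 1" using p by (simp_all add: a_def b_def)
  have "\<bar>Re (cinner a b)\<bar> \<le> 1" using Re_cinner_bound[of a b] n by simp
  moreover have "Re (cinner a b) = Re (cinner x y) / (norm x * norm y)"
    using p by (simp add: a_def b_def cinner_scaleR_left cinner_scaleR_right divide_inverse)
  ultimately show ?thesis using p by (simp add: abs_mult field_simps)
qed

lemma Cauchy_Schwarz:
  fixes x y :: "'a::complex_hilbert_space"
  shows "cmod (cinner x y) \<le> norm x * norm y"
proof (cases "cinner x y = 0")
  case False
  \<comment> \<open>The phase \<open>c\<close> turns \<open>cinner x y\<close> into its absolute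
    value, so that the bound on real parts applies.\<close>
  define c where "c = cnj (cinner x y) / cmod (cinner x y)"
  have "cinner x (c *\<^sub>C y) = cmod (cinner x y)"
    using False complex_norm_square[of "cinner x y"]
    by (simp add: cinner_scaleC_right c_def power2_eq_square field_simps)
  moreover have "norm (c *\<^sub>C y) = norm y"
    using False by (simp add: norm_scaleC c_def norm_divide)
  ultimately show ?thesis using Re_Cauchy_Schwarz[of x "c *\<^sub>C y"] by simp
qed simp

interpretation cinner: bounded_bilinear "cinner :: 'a \<Rightarrow> 'a::complex_hilbert_space \<Rightarrow> complex"
proof
  fix x y z :: 'a and r :: real
  show "cinner (x + y) z = cinner x z + cinner y z" by (rule cinner_add_left)
  show "cinner x (y + z) = cinner x y + cinner x z" by (rule cinner_add_right)
  show "cinner (r *\<^sub>R x) y = r *\<^sub>R cinner x y" by (rule cinner_scaleR_left)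
  show "cinner x (r *\<^sub>R y) = r *\<^sub>R cinner x y" by (rule cinner_scaleR_right)
  show "\<exists>K. \<forall>x y :: 'a. norm (cinner x y) \<le> norm x * norm y * K"
    by (rule exI[of _ 1]) (simp add: Cauchy_Schwarz)
qed

lemma norm_square_cinner: "(norm x)\<^sup>2 = Re (cinner x (x::'a::complex_hilbert_space))"
  by (simp add: cinner_self)

lemma cinner_ext:
  fixes x y :: "'a::complex_hilbert_space"
  assumes "\<And>z. cinner x z = cinner y z"
  shows "x = y"
proof -
  have "cinner (x - y) (x - y) = 0" using assms by (simp add: cinner.diff_left)
  then show ?thesis by (simp add: cinner_self)
qed

lemma norm_add_square:
  fixes x y :: "'a::complex_hilbert_space"
  shows "(norm (x + y))\<^sup>2 = (norm x)\<^sup>2 + (norm y)\<^sup>2 + 2 * Re (cinner x y)"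
  using arg_cong[OF cinner_commute[of x y], of Re]
  by (simp add: norm_square_cinner cinner_add_left cinner_add_right)

section \<open>The Riesz representation theorem and adjoints\<close>

lemma Riesz_representation:
  fixes f :: "'a::complex_hilbert_space \<Rightarrow>\<^sub>L complex"
  assumes "complex_linear f"
  shows "\<exists>y. \<forall>x. f x = cinner y x"
proof -
  \<comment> \<open>Variational proof: if \<open>f\<close> is the inner product with
    \<open>y\<close>, then \<open>g x\<close> is the squared distance from \<open>x\<close> to
    \<open>y\<close> minus the constant \<open>(norm y)\<^sup>2\<close>, so \<open>y\<close> can be
    found as the minimiser of \<open>g\<close>.\<close>
  define g where "g x = (norm x)\<^sup>2 - 2 * Re (f x)" for x
  have lower: "- (norm f)\<^sup>2 \<le> g x" for x
  proof -
    have "Re (f x) \<le> norm f * norm x"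
      using norm_blinfun[of f x] complex_Re_le_cmod[of "f x"] by linarith
    moreover have "2 * (norm f * norm x) \<le> (norm f)\<^sup>2 + (norm x)\<^sup>2"
      using zero_le_power2[of "norm f - norm x"] by (simp add: power2_diff)
    ultimately show ?thesis unfolding g_def by linarith
  qed
  then have bdd: "bdd_below (range g)" by (intro bdd_belowI[of _ "- (norm f)\<^sup>2"]) auto
  define m where "m = Inf (range g)"
  have m_le: "m \<le> g x" for x unfolding m_def by (intro cInf_lower bdd) auto
  have "\<exists>x. g x < m + inverse (Suc k)" for k
    using cInf_lessD[of "range g" "m + inverse (Suc k)"] by (auto simp: m_def)
  then obtain X where X: "\<And>k. g (X k) < m + inverse (Suc k)" by metis
  \<comment> \<open>Parallelogram law, in which the linear part of \<open>g\<close> cancels. The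
    midpoint of two near-minimisers cannot lie much lower than they do, so they must be close to
    each other.\<close>
  have par: "(norm (x - y))\<^sup>2 = 2 * (g x + g y - 2 * g ((1/2) *\<^sub>R (x + y)))" for x y
  proof -
    have "(norm ((1/2) *\<^sub>R (x + y)))\<^sup>2 = (norm (x + y))\<^sup>2 / 4"
      by (simp add: power2_eq_square)
    moreover have "Re (f ((1/2) *\<^sub>R (x + y))) = (Re (f x) + Re (f y)) / 2"
      by (simp add: blinfun.add_right blinfun.scaleR_right)
    ultimately show ?thesis
      using norm_add_square[of x y] norm_add_square[of x "- y"]
      by (simp add: g_def cinner.minus_right)
  qed
  have close: "(norm (X k - X l))\<^sup>2 \<le> 2 * (inverse (Suc k) + inverse (Suc l))" for k l
    using par[of "X k" "X l"] X[of k] X[of l] m_le[of "(1/2) *\<^sub>R (X k + X l)"]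
    by simp
  have "Cauchy X"
  proof (rule metric_CauchyI)
    fix e :: real assume e: "e > 0"
    then obtain M where M: "inverse (Suc M) < e\<^sup>2 / 4"
      using reals_Archimedean[of "e\<^sup>2 / 4"] by auto
    have "dist (X k) (X l) < e" if "k \<ge> M" "l \<ge> M" for k l
    proof -
      have "inverse (real (Suc k)) \<le> inverse (Suc M)" "inverse (real (Suc l)) \<le> inverse (Suc M)"
        using that by (auto intro!: le_imp_inverse_le)
      then have "(norm (X k - X l))\<^sup>2 < e\<^sup>2" using close[of k l] M by argo
      then show ?thesis using e by (simp add: dist_norm power2_less_imp_less)
    qed
    then show "\<exists>M. \<forall>k\<ge>M. \<forall>l\<ge>M. dist (X k) (X l) < e" by blast
  qed
  then obtain y where y: "X \<longlonglongrightarrow> y" using Cauchy_convergent convergent_def by blast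
  have "(\<lambda>k. g (X k)) \<longlonglongrightarrow> g y"
    unfolding g_def by (intro tendsto_intros y)
  moreover have "(\<lambda>k. m + inverse (real (Suc k))) \<longlonglongrightarrow> m + 0"
    by (intro tendsto_intros LIMSEQ_inverse_real_of_nat)
  ultimately have "g y \<le> m + 0"
    by (rule LIMSEQ_le) (use X less_imp_le in blast)
  then have min: "g y \<le> g x" for x using m_le[of x] by simp
  have re: "Re (f x) = Re (cinner y x)" for x
  proof -
    define b where "b = Re (cinner y x) - Re (f x)"
    have q: "0 \<le> t\<^sup>2 * (norm x)\<^sup>2 + 2 * t * b" for t
      using min[of "y + t *\<^sub>R x"] norm_add_square[of y "t *\<^sub>R x"]
      by (simp add: g_def b_def blinfun.add_right blinfun.scaleR_right cinner_scaleR_right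
          power_mult_distrib algebra_simps)
    \<comment> \<open>A quadratic in \<open>t\<close> without constant term that is never negative
      has no linear term; the test value is \<open>t = - b / K\<close>. The added 1 keeps
      \<open>K\<close> positive when \<open>x = 0\<close>.\<close>
    define K where "K = (norm x)\<^sup>2 + 1"
    have K: "K > 0" by (simp add: K_def add_nonneg_pos)
    have "0 \<le> (b / K)\<^sup>2 * (norm x)\<^sup>2 - 2 * (b / K) * b" using q[of "- b / K"] by simp
    also have "\<dots> \<le> (b / K)\<^sup>2 * K - 2 * (b / K) * b"
      by (intro diff_right_mono mult_left_mono) (simp_all add: K_def)
    also have "\<dots> = - (b\<^sup>2 / K)" using K by (simp add: power2_eq_square field_simps)
    finally have "b\<^sup>2 / K \<le> 0" by simp
    then have "b = 0" using K by (simp add: divide_le_0_iff)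
    then show ?thesis by (simp add: b_def)
  qed
  have "f x = cinner y x" for x
  proof (rule complex_eqI)
    show "Im (f x) = Im (cinner y x)"
      \<comment> \<open>By complex linearity the imaginary part at \<open>x\<close> is minus the
        real part at \<open>\<i> *\<^sub>C x\<close>.\<close>
      using re[of "\<i> *\<^sub>C x"] assms
      by (simp add: complex_linear_def cinner_scaleC_right scaleC_complex_def)
  qed (rule re)
  then show ?thesis by blast
qed

text \<open>The formula of \<open>adjoint_op\<close>, freed from equal domain and codomain:
  coordinate embeddings into sequences and the intertwining operator go between different
  spaces.\<close>

definition adj :: "('a::complex_hilbert_space \<Rightarrow>\<^sub>L 'b::complex_hilbert_space) \<Rightarrow> ('b \<Rightarrow>\<^sub>L 'a)" where
  "adj T = (THE S. \<forall>x y. cinner (blinfun_apply S x) y = cinner x (blinfun_apply T y))"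

lemma adjoint_op_eq_adj: "adjoint_op = adj"
  by (rule ext) (simp add: adjoint_op_def adj_def)

lemma adj_eqI:
  assumes "\<And>x y. cinner (blinfun_apply S x) y = cinner x (blinfun_apply T y)"
  shows "adj T = S"
  unfolding adj_def
proof (rule the_equality)
  fix R assume "\<forall>x y. cinner (blinfun_apply R x) y = cinner x (blinfun_apply T y)"
  then show "R = S" by - (rule blinfun_eqI, rule cinner_ext, simp add: assms)
qed (simp add: assms)

lemma complex_linearD: "complex_linear T \<Longrightarrow> blinfun_apply T (c *\<^sub>C x) = c *\<^sub>C blinfun_apply T x"
  by (simp add: complex_linear_def)

lemma adjoint_exists:
  fixes T :: "'a::complex_hilbert_space \<Rightarrow>\<^sub>L 'b::complex_hilbert_space"
  assumes T: "complex_linear T"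
  shows "\<exists>S. \<forall>x y. cinner (blinfun_apply S x) y = cinner x (blinfun_apply T y)"
proof -
  have "\<exists>z. \<forall>y. cinner x (T y) = cinner z y" for x
  proof -
    have "bounded_linear (\<lambda>y. cinner x (T y))"
      by (rule bounded_linear_compose[OF cinner.bounded_linear_right blinfun.bounded_linear_right])
    then have app: "blinfun_apply (Blinfun (\<lambda>y. cinner x (T y))) = (\<lambda>y. cinner x (T y))"
      by (rule bounded_linear_Blinfun_apply)
    then have "complex_linear (Blinfun (\<lambda>y. cinner x (T y)))"
      using T by (simp add: complex_linear_def cinner_scaleC_right scaleC_complex_def)
    from Riesz_representation[OF this] app show ?thesis by simp
  qed
  then obtain s where s: "\<And>x y. cinner (s x) y = cinner x (T y)" by metis
  have "bounded_linear s"
  proof (rule bounded_linear_intro)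
    show "s (x + y) = s x + s y" for x y by (rule cinner_ext) (simp add: s cinner_add_left)
    show "s (r *\<^sub>R x) = r *\<^sub>R s x" for r x by (rule cinner_ext) (simp add: s cinner_scaleR_left)
    show "norm (s x) \<le> norm x * norm T" for x
    proof (cases "s x = 0")
      case False
      have "(norm (s x))\<^sup>2 = Re (cinner x (T (s x)))" by (simp add: norm_square_cinner s)
      also have "\<dots> \<le> norm x * norm (T (s x))"
        using Re_Cauchy_Schwarz[of x "T (s x)"] by linarith
      also have "\<dots> \<le> norm x * (norm T * norm (s x))"
        by (intro mult_left_mono norm_blinfun) simp
      finally show ?thesis using False by (simp add: power2_eq_square)
    qed simp
  qed
  then show ?thesis
    by (intro exI[of _ "Blinfun s"]) (simp add: bounded_linear_Blinfun_apply s)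
qed

lemma cinner_adj_left:
  assumes "complex_linear T"
  shows "cinner (adj T x) y = cinner x (T y)"
proof -
  obtain S where S: "\<And>x y. cinner (blinfun_apply S x) y = cinner x (blinfun_apply T y)"
    using adjoint_exists[OF assms] by blast
  then have "adj T = S" by (rule adj_eqI)
  with S show ?thesis by simp
qed

lemma cinner_adj_right:
  assumes "complex_linear T"
  shows "cinner x (adj T y) = cinner (T x) y"
  using cinner_adj_left[OF assms, of y x] cinner_commute[of x] cinner_commute[of "T x"] by simp

section \<open>Complex-linear operators, their adjoints and the C*-identity\<close>

lemma op_scale_apply [simp]: "blinfun_apply (op_scale c T) x = c *\<^sub>C T x"
proof -
  have "bounded_linear (\<lambda>x. c *\<^sub>C T x)"
    by (rule bounded_linear_compose[OF scaleC.bounded_linear_right blinfun.bounded_linear_right])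
  then show ?thesis by (simp add: op_scale_def bounded_linear_Blinfun_apply)
qed

lemma norm_op_scale: "norm (op_scale c T) = cmod c * norm T"
proof (cases "c = 0")
  case True
  then have "op_scale c T = 0" by (intro blinfun_eqI) (simp add: scaleC.zero_left)
  then show ?thesis using True by simp
next
  case False
  have le: "norm (op_scale c S) \<le> cmod c * norm S" for c and S :: "'a \<Rightarrow>\<^sub>L 'a"
    by (rule norm_blinfun_bound)
       (simp_all add: norm_scaleC mult.assoc mult_left_mono norm_blinfun)
  have "op_scale (inverse c) (op_scale c T) = T"
    using False by (intro blinfun_eqI) (simp add: scaleC_scaleC)
  then have "norm T \<le> inverse (cmod c) * norm (op_scale c T)"
    using le[of "inverse c" "op_scale c T"] by (simp add: norm_inverse)
  then show ?thesis using le[of c T] False by (simp add: field_simps)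
qed

lemma complex_linear_zero [simp]: "complex_linear 0"
  by (simp add: complex_linear_def scaleC.zero_right)

lemma complex_linear_id [simp]: "complex_linear id_blinfun"
  by (simp add: complex_linear_def)

lemma complex_linear_add [simp]: "complex_linear S \<Longrightarrow> complex_linear T \<Longrightarrow> complex_linear (S + T)"
  by (simp add: complex_linear_def blinfun.add_left scaleC_add_right)

lemma complex_linear_diff [simp]: "complex_linear S \<Longrightarrow> complex_linear T \<Longrightarrow> complex_linear (S - T)"
  by (simp add: complex_linear_def blinfun.diff_left scaleC.diff_right)

lemma complex_linear_scaleR [simp]: "complex_linear T \<Longrightarrow> complex_linear (r *\<^sub>R T)"
  by (simp add: complex_linear_def blinfun.scaleR_left scaleC.scaleR_right)

lemma complex_linear_op_scale [simp]: "complex_linear T \<Longrightarrow> complex_linear (op_scale c T)"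
  by (simp add: complex_linear_def scaleC_scaleC mult.commute)

lemma complex_linear_compose [simp]:
  "complex_linear S \<Longrightarrow> complex_linear T \<Longrightarrow> complex_linear (S o\<^sub>L T)"
  by (simp add: complex_linear_def)

lemma complex_linear_sum [simp]:
  "(\<And>i. i \<in> I \<Longrightarrow> complex_linear (f i)) \<Longrightarrow> complex_linear (sum f I)"
  by (induction I rule: infinite_finite_induct) auto

lemma complex_linear_adj [simp]:
  assumes "complex_linear T"
  shows "complex_linear (adj T)"
  unfolding complex_linear_def
  by (intro allI, rule cinner_ext) (simp add: assms cinner_adj_left cinner_scaleC_left)

lemma adj_adj: "complex_linear T \<Longrightarrow> adj (adj T) = T"
  by (rule adj_eqI) (simp add: cinner_adj_right)

lemma adj_compose:
  "complex_linear S \<Longrightarrow> complex_linear T \<Longrightarrow> adj (S o\<^sub>L T) = adj T o\<^sub>L adj S"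
  by (rule adj_eqI) (simp add: cinner_adj_left)

lemma adj_add: "complex_linear S \<Longrightarrow> complex_linear T \<Longrightarrow> adj (S + T) = adj S + adj T"
  by (rule adj_eqI) (simp add: cinner_adj_left blinfun.add_left cinner_add_left cinner_add_right)

lemma adj_diff: "complex_linear S \<Longrightarrow> complex_linear T \<Longrightarrow> adj (S - T) = adj S - adj T"
  by (rule adj_eqI) (simp add: cinner_adj_left blinfun.diff_left cinner.diff_left cinner.diff_right)

lemma adj_op_scale: "complex_linear T \<Longrightarrow> adj (op_scale c T) = op_scale (cnj c) (adj T)"
  by (rule adj_eqI) (simp add: cinner_adj_left cinner_scaleC_left cinner_scaleC_right)

lemma adj_zero [simp]: "adj 0 = 0"
  by (rule adj_eqI) (simp add: cinner.zero_left cinner.zero_right)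

lemma adj_id [simp]: "adj id_blinfun = id_blinfun"
  by (rule adj_eqI) simp

lemma adj_sum:
  "(\<And>i. i \<in> I \<Longrightarrow> complex_linear (f i)) \<Longrightarrow> adj (sum f I) = (\<Sum>i\<in>I. adj (f i))"
  by (induction I rule: infinite_finite_induct) (auto simp: adj_add)

lemma norm_square_le_adj_compose:
  assumes S: "complex_linear S"
  shows "(norm S)\<^sup>2 \<le> norm (adj S o\<^sub>L S)"
proof -
  have "norm S \<le> sqrt (norm (adj S o\<^sub>L S))"
  proof (rule norm_blinfun_bound)
    fix x
    have "(norm (S x))\<^sup>2 = Re (cinner x ((adj S o\<^sub>L S) x))"
      by (simp add: norm_square_cinner cinner_adj_right S)
    also have "\<dots> \<le> norm x * norm ((adj S o\<^sub>L S) x)"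
      by (rule abs_le_D1[OF Re_Cauchy_Schwarz])
    also have "\<dots> \<le> norm x * (norm (adj S o\<^sub>L S) * norm x)"
      by (intro mult_left_mono norm_blinfun) simp
    also have "\<dots> = (sqrt (norm (adj S o\<^sub>L S)) * norm x)\<^sup>2"
      by (simp add: power_mult_distrib) (simp add: power2_eq_square mult_ac)
    finally show "norm (S x) \<le> sqrt (norm (adj S o\<^sub>L S)) * norm x"
      by (rule power2_le_imp_le) simp
  qed simp
  then have "(norm S)\<^sup>2 \<le> (sqrt (norm (adj S o\<^sub>L S)))\<^sup>2" by (intro power_mono) auto
  then show ?thesis by simp
qed

lemma norm_adj:
  assumes T: "complex_linear T"
  shows "norm (adj T) = norm T"
proof -
  \<comment> \<open>Stated for arbitrary spaces, since it is applied both to \<open>T\<close> and to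
    \<open>adj T\<close>, whose domain and codomain are exchanged.\<close>
  have le: "norm S \<le> norm (adj S)" if S: "complex_linear S"
    for S :: "'x::complex_hilbert_space \<Rightarrow>\<^sub>L 'y::complex_hilbert_space"
  proof (cases "S = 0")
    case False
    have "norm S * norm S \<le> norm (adj S) * norm S"
      using norm_square_le_adj_compose[OF S] norm_blinfun_compose[of "adj S" S]
      by (simp add: power2_eq_square)
    then show ?thesis using False by simp
  qed simp
  show ?thesis using le[OF T] le[of "adj T"] T by (simp add: adj_adj)
qed

lemma norm_adj_compose:
  assumes T: "complex_linear T"
  shows "norm (adj T o\<^sub>L T) = (norm T)\<^sup>2"
  using norm_square_le_adj_compose[OF T] norm_blinfun_compose[of "adj T" T]
  by (simp add: norm_adj[OF T] power2_eq_square)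

section \<open>Square-summable sequences and tensor products with compact operators\<close>

lemma l2_eqI: "(\<And>i. l2_nth x i = l2_nth y i) \<Longrightarrow> x = y"
  using l2_nth_inject by blast

lemma l2_nth_add [simp]: "l2_nth (x + y) i = l2_nth x i + l2_nth y i"
  by (simp add: plus_l2.rep_eq)

lemma l2_nth_diff [simp]: "l2_nth (x - y) i = l2_nth x i - l2_nth y i"
  by (simp add: minus_l2.rep_eq)

lemma l2_nth_scaleC [simp]: "l2_nth (c *\<^sub>C x) i = c *\<^sub>C l2_nth x i"
  by (simp add: scaleC_l2.rep_eq)

lemma l2_nth_scaleR [simp]: "l2_nth (r *\<^sub>R x) i = r *\<^sub>R l2_nth x i"
  by (simp add: scaleR_l2.rep_eq)

lemma l2_nth_zero [simp]: "l2_nth 0 i = 0"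
  by (simp add: zero_l2.rep_eq)

lemma l2_nth_sum: "l2_nth (sum f I) i = (\<Sum>j\<in>I. l2_nth (f j) i)"
  by (induction I rule: infinite_finite_induct) auto

lemma summable_l2: "summable (\<lambda>n. (norm (l2_nth x n))\<^sup>2)"
  using l2_nth by blast

lemma norm_l2_square: "(norm x)\<^sup>2 = (\<Sum>n. (norm (l2_nth x n))\<^sup>2)"
  by (simp add: norm_l2.rep_eq suminf_nonneg summable_l2)

lemma norm_l2_square_partial: "(\<Sum>i<n. (norm (l2_nth x i))\<^sup>2) \<le> (norm x)\<^sup>2"
  unfolding norm_l2_square by (intro sum_le_suminf summable_l2) auto

lemma norm_l2_square_leI:
  "(\<And>n. (\<Sum>i<n. (norm (l2_nth x i))\<^sup>2) \<le> C) \<Longrightarrow> (norm x)\<^sup>2 \<le> C"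
  unfolding norm_l2_square by (intro suminf_le_const summable_l2)

lemma norm_l2_square_finite:
  assumes "\<And>i. i \<ge> n \<Longrightarrow> l2_nth x i = 0"
  shows "(norm x)\<^sup>2 = (\<Sum>i<n. (norm (l2_nth x i))\<^sup>2)"
  unfolding norm_l2_square using assms by (intro suminf_finite) auto

section \<open>Coordinates, coordinate embeddings and truncations\<close>

lift_definition l2_single :: "nat \<Rightarrow> 'h \<Rightarrow> 'h::complex_hilbert_space l2"
  is "\<lambda>i h n. if n = i then h else 0"
  by (rule summable_finite[of "{i}" for i]) auto

lemma l2_nth_single: "l2_nth (l2_single i h) n = (if n = i then h else 0)"
  by (simp add: l2_single.rep_eq)

lift_definition l2_coord :: "nat \<Rightarrow> 'h::complex_hilbert_space l2 \<Rightarrow>\<^sub>L 'h" is "\<lambda>i x. l2_nth x i"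
  by (rule bounded_linear_intro[of _ 1]) (simp_all add: norm_l2_nth_le)

lift_definition l2_incl :: "nat \<Rightarrow> 'h::complex_hilbert_space \<Rightarrow>\<^sub>L 'h l2" is l2_single
proof (rule bounded_linear_intro[of _ 1])
  fix i and x y :: 'h and r :: real
  show "l2_single i (x + y) = l2_single i x + l2_single i y"
    by (rule l2_eqI) (simp add: l2_nth_single)
  show "l2_single i (r *\<^sub>R x) = r *\<^sub>R l2_single i x"
    by (rule l2_eqI) (simp add: l2_nth_single)
  have "(norm (l2_single i x))\<^sup>2 = (\<Sum>n<Suc i. (norm (l2_nth (l2_single i x) n))\<^sup>2)"
    by (rule norm_l2_square_finite) (simp add: l2_nth_single)
  then have "(norm (l2_single i x))\<^sup>2 = (norm x)\<^sup>2" by (simp add: l2_nth_single)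
  then show "norm (l2_single i x) \<le> norm x * 1" by simp
qed

lemma l2_coord_apply [simp]: "blinfun_apply (l2_coord i) x = l2_nth x i"
  by (simp add: l2_coord.rep_eq)

lemma l2_nth_incl: "l2_nth (blinfun_apply (l2_incl i) h) n = (if n = i then h else 0)"
  by (simp add: l2_incl.rep_eq l2_nth_single)

lemma complex_linear_coord [simp]: "complex_linear (l2_coord i)"
  by (simp add: complex_linear_def)

lemma complex_linear_incl [simp]: "complex_linear (l2_incl i)"
  unfolding complex_linear_def
  by (intro allI l2_eqI) (simp add: l2_nth_incl scaleC.zero_right)

lemma norm_l2_incl [simp]: "norm (l2_incl i h) = norm h"
proof -
  have "(norm (l2_incl i h))\<^sup>2 = (norm h)\<^sup>2"
    by (subst norm_l2_square_finite[of "Suc i"]) (auto simp: l2_nth_incl)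
  then show ?thesis by simp
qed

lemma cinner_l2_incl: "cinner x (l2_incl i h) = cinner (l2_nth x i) h"
proof -
  have "cinner x (l2_incl i h) = (\<Sum>n\<in>{i}. cinner (l2_nth x n) (l2_nth (l2_incl i h) n))"
    unfolding cinner_l2.rep_eq
    by (rule suminf_finite) (auto simp: l2_nth_incl cinner.zero_right)
  then show ?thesis by (simp add: l2_nth_incl)
qed

lemma adj_incl [simp]: "adj (l2_incl i) = l2_coord i"
  by (rule adj_eqI) (simp add: cinner_l2_incl)

lemma adj_coord [simp]: "adj (l2_coord i) = l2_incl i"
  using adj_adj[OF complex_linear_incl[of i]] by simp

definition l2_trunc :: "nat \<Rightarrow> 'h::complex_hilbert_space l2 \<Rightarrow>\<^sub>L 'h l2" where
  "l2_trunc n = (\<Sum>i<n. l2_incl i o\<^sub>L l2_coord i)"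

lemma l2_nth_trunc: "l2_nth (l2_trunc n x) i = (if i < n then l2_nth x i else 0)"
  by (simp add: l2_trunc_def blinfun.sum_left l2_nth_sum l2_nth_incl)

lemma complex_linear_trunc [simp]: "complex_linear (l2_trunc n)"
  by (simp add: l2_trunc_def)

lemma adj_trunc [simp]: "adj (l2_trunc n) = l2_trunc n"
  by (simp add: l2_trunc_def adj_sum adj_compose)

lemma norm_trunc_square: "(norm (l2_trunc n x))\<^sup>2 = (\<Sum>i<n. (norm (l2_nth x i))\<^sup>2)"
  by (subst norm_l2_square_finite[of n]) (auto simp: l2_nth_trunc)

lemma norm_trunc_le: "norm (l2_trunc n) \<le> 1"
proof (rule norm_blinfun_bound)
  show "norm (l2_trunc n x) \<le> 1 * norm x" for x :: "'a l2"
    using norm_l2_square_partial[where n=n and x=x] norm_trunc_square[of n x]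
    by (auto intro: power2_le_imp_le)
qed simp

lemma norm_diff_trunc_square:
  "(norm (x - l2_trunc n x))\<^sup>2 = (norm x)\<^sup>2 - (\<Sum>i<n. (norm (l2_nth x i))\<^sup>2)"
proof -
  have "l2_trunc n x + (x - l2_trunc n x) = x" by simp
  moreover have "cinner (l2_trunc n x) (x - l2_trunc n x) = 0"
  proof -
    have "l2_trunc n (x - l2_trunc n x) = 0"
      by (rule l2_eqI) (simp add: l2_nth_trunc)
    then show ?thesis
      using cinner_adj_left[OF complex_linear_trunc[of n], of x "x - l2_trunc n x"]
      by (simp add: cinner.zero_right)
  qed
  ultimately show ?thesis
    using norm_add_square[of "l2_trunc n x" "x - l2_trunc n x"] by (simp add: norm_trunc_square)
qed

lemma norm_id_minus_trunc_le: "norm (id_blinfun - l2_trunc n) \<le> 1"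
proof (rule norm_blinfun_bound)
  fix x :: "'a l2"
  have "(norm ((id_blinfun - l2_trunc n) x))\<^sup>2 \<le> (norm x)\<^sup>2"
    using norm_diff_trunc_square[where n=n and x=x] by (simp add: blinfun.diff_left sum_nonneg)
  then show "norm ((id_blinfun - l2_trunc n) x) \<le> 1 * norm x" by simp
qed simp

lemma trunc_tendsto: "(\<lambda>n. l2_trunc n x) \<longlonglongrightarrow> x"
proof -
  have "(\<lambda>n. (norm x)\<^sup>2 - (\<Sum>i<n. (norm (l2_nth x i))\<^sup>2)) \<longlonglongrightarrow> (norm x)\<^sup>2 - (norm x)\<^sup>2"
    unfolding norm_l2_square by (intro tendsto_intros summable_LIMSEQ summable_l2)
  then have "(\<lambda>n. sqrt ((norm (x - l2_trunc n x))\<^sup>2)) \<longlonglongrightarrow> sqrt 0"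
    by (intro tendsto_intros) (simp add: norm_diff_trunc_square)
  then have "(\<lambda>n. x - l2_trunc n x) \<longlonglongrightarrow> 0" by (simp add: tendsto_norm_zero_iff)
  then have "(\<lambda>n. x - (x - l2_trunc n x)) \<longlonglongrightarrow> x - 0" by (intro tendsto_intros)
  then show ?thesis by simp
qed

lemma l2_nth_tensor_vec [simp]: "l2_nth (tensor_vec x h) n = l2_nth x n *\<^sub>C h"
  by (simp add: tensor_vec.rep_eq)

lemma l2_incl_eq_tensor_vec: "l2_incl i h = tensor_vec (l2_incl i 1) h"
  by (rule l2_eqI) (simp add: l2_nth_incl scaleC.zero_left)

lemma l2_incl_complex: "l2_incl i (c :: complex) = c *\<^sub>C l2_incl i 1"
  using complex_linearD[OF complex_linear_incl, of i c "1::complex"] by (simp add: scaleC_complex_def)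

text \<open>Induction on the number of nonzero vectors: splitting off from all of them the component along
  one of them leaves fewer.\<close>

lemma matrix_amplification_bound:
  fixes K :: "nat \<Rightarrow> nat \<Rightarrow> complex" and h :: "nat \<Rightarrow> 'h::complex_hilbert_space"
  assumes "\<And>c. (\<Sum>i<m. (cmod (\<Sum>l<n. K i l * c l))\<^sup>2) \<le> C * (\<Sum>l<n. (cmod (c l))\<^sup>2)"
  shows "(\<Sum>i<m. (norm (\<Sum>l<n. K i l *\<^sub>C h l))\<^sup>2) \<le> C * (\<Sum>l<n. (norm (h l))\<^sup>2)"
proof (induction "card {l. l < n \<and> h l \<noteq> 0}" arbitrary: h rule: less_induct)
  case less
  show ?case
  proof (cases "\<exists>l<n. h l \<noteq> 0")
    case False
    then show ?thesis by (simp add: scaleC.zero_right)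
  next
    case True
    then obtain l0 where l0: "l0 < n" "h l0 \<noteq> 0" by blast
    define f where "f = inverse (norm (h l0)) *\<^sub>R h l0"
    define c where "c l = cinner f (h l)" for l
    define h' where "h' l = h l - c l *\<^sub>C f" for l
    have nf: "norm f = 1" using l0 by (simp add: f_def)
    have perp: "cinner f (h' l) = 0" for l
      using nf by (simp add: h'_def cinner.diff_right cinner_scaleC_right cinner_self) (simp add: c_def)
    have pyth: "(norm (d *\<^sub>C f + u))\<^sup>2 = (cmod d)\<^sup>2 + (norm u)\<^sup>2" if "cinner f u = 0" for d u
      using that nf by (simp add: norm_add_square cinner_scaleC_left norm_scaleC)
    have h: "h l = c l *\<^sub>C f + h' l" for l by (simp add: h'_def)
    have "h' l0 = 0"
    proof -
      have "c l0 = norm (h l0)"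
        using l0 by (simp add: c_def f_def cinner_scaleR_left cinner_self power2_eq_square scaleR_conv_of_real)
      then show ?thesis using l0 by (simp add: h'_def f_def scaleC_of_real)
    qed
    moreover have "h' l = 0" if "h l = 0" for l
      using that by (simp add: h'_def c_def cinner.zero_right scaleC.zero_left)
    ultimately have "{l. l < n \<and> h' l \<noteq> 0} \<subset> {l. l < n \<and> h l \<noteq> 0}" using l0 by blast
    then have "card {l. l < n \<and> h' l \<noteq> 0} < card {l. l < n \<and> h l \<noteq> 0}"
      by (intro psubset_card_mono) auto
    then have IH: "(\<Sum>i<m. (norm (\<Sum>l<n. K i l *\<^sub>C h' l))\<^sup>2) \<le> C * (\<Sum>l<n. (norm (h' l))\<^sup>2)"
      by (rule less)
    have "(norm (\<Sum>l<n. K i l *\<^sub>C h l))\<^sup>2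
        = (cmod (\<Sum>l<n. K i l * c l))\<^sup>2 + (norm (\<Sum>l<n. K i l *\<^sub>C h' l))\<^sup>2" for i
    proof -
      have "(\<Sum>l<n. K i l *\<^sub>C h l) = (\<Sum>l<n. K i l * c l) *\<^sub>C f + (\<Sum>l<n. K i l *\<^sub>C h' l)"
        by (simp add: h'_def scaleC.diff_right scaleC_scaleC sum_subtractf scaleC.sum_left)
      then show ?thesis
        by (simp add: pyth cinner.sum_right cinner_scaleC_right perp)
    qed
    then have "(\<Sum>i<m. (norm (\<Sum>l<n. K i l *\<^sub>C h l))\<^sup>2)
        = (\<Sum>i<m. (cmod (\<Sum>l<n. K i l * c l))\<^sup>2) + (\<Sum>i<m. (norm (\<Sum>l<n. K i l *\<^sub>C h' l))\<^sup>2)"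
      by (simp add: sum.distrib)
    \<comment> \<open>The coefficients along \<open>f\<close> obey the scalar bound, and the
      remainders orthogonal to \<open>f\<close> obey the induction hypothesis.\<close>
    also have "\<dots> \<le> C * (\<Sum>l<n. (cmod (c l))\<^sup>2) + C * (\<Sum>l<n. (norm (h' l))\<^sup>2)"
      by (intro add_mono assms IH)
    also have "\<dots> = C * (\<Sum>l<n. (norm (h l))\<^sup>2)"
    proof -
      have "(norm (h l))\<^sup>2 = (cmod (c l))\<^sup>2 + (norm (h' l))\<^sup>2" for l
        using pyth[OF perp, of "c l" l] by (simp only: h[symmetric])
      then show ?thesis by (simp add: sum.distrib distrib_left)
    qed
    finally show ?thesis .
  qed
qed

section \<open>Elementary tensors and approximation of compact operators by finite matrices\<close>

lemma is_tensor_op_incl: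
  assumes "is_tensor_op k a T"
  shows "l2_nth (T (l2_incl l h)) i = l2_nth (k (l2_incl l 1)) i *\<^sub>C a h"
  using assms by (simp add: l2_incl_eq_tensor_vec[of l h] is_tensor_op_def)

text \<open>On a truncated vector, \<open>T\<close> applies the scalar matrix of \<open>k\<close> to
  the vectors \<open>a (l2_nth x l)\<close>, so the amplification bound gives the estimate there,
  and truncations are dense. It lets an approximation of \<open>k\<close> in norm carry over to
  \<open>T\<close>.\<close>

lemma norm_tensor_op_le:
  assumes T: "is_tensor_op k a T" and k: "complex_linear k"
  shows "norm T \<le> norm k * norm a"
proof -
  define K where "K i l = l2_nth (k (l2_incl l 1)) i" for i l
  have scalar: "(\<Sum>i<m. (cmod (\<Sum>l<n. K i l * c l))\<^sup>2) \<le> (norm k)\<^sup>2 * (\<Sum>l<n. (cmod (c l))\<^sup>2)"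
    for m n c
  proof -
    define x where "x = (\<Sum>l<n. l2_incl l (c l))"
    have x: "l2_nth x i = (if i < n then c i else 0)" for i
      by (simp add: x_def l2_nth_sum l2_nth_incl)
    have "k x = (\<Sum>l<n. c l *\<^sub>C k (l2_incl l 1))"
      by (simp add: x_def blinfun.sum_right l2_incl_complex[of _ "c _"] complex_linearD[OF k])
    then have "l2_nth (k x) i = (\<Sum>l<n. K i l * c l)" for i
      by (simp add: l2_nth_sum K_def scaleC_complex_def mult.commute)
    then have "(\<Sum>i<m. (cmod (\<Sum>l<n. K i l * c l))\<^sup>2) \<le> (norm (k x))\<^sup>2"
      using norm_l2_square_partial[of "k x" m] by simp
    also have "\<dots> \<le> (norm k * norm x)\<^sup>2" by (intro power_mono norm_blinfun) simp
    also have "(norm x)\<^sup>2 = (\<Sum>l<n. (cmod (c l))\<^sup>2)"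
      by (subst norm_l2_square_finite[of n]) (auto simp: x)
    then have "(norm k * norm x)\<^sup>2 = (norm k)\<^sup>2 * (\<Sum>l<n. (cmod (c l))\<^sup>2)"
      by (simp add: power_mult_distrib)
    finally show ?thesis .
  qed
  have fin: "norm (T (l2_trunc n x)) \<le> norm k * norm a * norm x" for n x
  proof -
    have Tx: "l2_nth (T (l2_trunc n x)) i = (\<Sum>l<n. K i l *\<^sub>C a (l2_nth x l))" for i
      by (simp add: l2_trunc_def blinfun.sum_left blinfun.sum_right l2_nth_sum
          is_tensor_op_incl[OF T] K_def)
    have "(norm (T (l2_trunc n x)))\<^sup>2 \<le> (norm k)\<^sup>2 * (\<Sum>l<n. (norm (a (l2_nth x l)))\<^sup>2)"
      unfolding Tx[symmetric]
      by (rule norm_l2_square_leI) (simp add: Tx matrix_amplification_bound[OF scalar])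
    also have "\<dots> \<le> (norm k)\<^sup>2 * (\<Sum>l<n. (norm a)\<^sup>2 * (norm (l2_nth x l))\<^sup>2)"
      unfolding power_mult_distrib[symmetric]
      by (intro mult_left_mono sum_mono power_mono norm_blinfun) auto
    also have "\<dots> \<le> (norm k)\<^sup>2 * ((norm a)\<^sup>2 * (norm x)\<^sup>2)"
      unfolding sum_distrib_left[symmetric]
      by (intro mult_left_mono norm_l2_square_partial) auto
    finally have "(norm (T (l2_trunc n x)))\<^sup>2 \<le> (norm k * norm a * norm x)\<^sup>2"
      by (simp add: power_mult_distrib mult.assoc)
    then show ?thesis by (rule power2_le_imp_le) simp
  qed
  show ?thesis
  proof (rule norm_blinfun_bound)
    fix x
    have "(\<lambda>n. norm (T (l2_trunc n x))) \<longlonglongrightarrow> norm (T x)"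
      by (intro tendsto_intros trunc_tendsto)
    then show "norm (T x) \<le> norm k * norm a * norm x"
      by (rule LIMSEQ_le_const2) (use fin in blast)
  qed simp
qed

text \<open>The operators \<open>id_blinfun - l2_trunc n\<close> tend to 0 at each vector and have
  norm at most 1, hence they tend to 0 uniformly on a compact set; a finite net for the image of the
  unit ball makes this explicit.\<close>

lemma trunc_compact_tendsto:
  fixes k :: "'h::complex_hilbert_space l2 \<Rightarrow>\<^sub>L 'h l2"
  assumes "compact (closure (blinfun_apply k ` cball 0 1))" and "e > 0"
  shows "\<forall>\<^sub>F n in sequentially. norm (k - (l2_trunc n o\<^sub>L k)) \<le> e"
proof -
  obtain F where F: "finite F" "closure (k ` cball 0 1) \<subseteq> (\<Union>y\<in>F. ball y (e / 2))"
    by (rule compactE_image[OF assms(1), of "closure (k ` cball 0 1)" "\<lambda>y. ball y (e / 2)"])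
       (use assms(2) in auto)
  have "\<forall>\<^sub>F n in sequentially. norm (y - l2_trunc n y) < e / 2" for y :: "'h l2"
    using tendstoD[OF trunc_tendsto[of y], of "e / 2"] assms(2) by (simp add: dist_norm norm_minus_commute)
  then have "\<forall>\<^sub>F n in sequentially. \<forall>y\<in>F. norm (y - l2_trunc n y) < e / 2"
    using F(1) by (intro eventually_ball_finite) auto
  then show ?thesis
  proof eventually_elim
    case (elim n)
    have unit: "norm ((k - (l2_trunc n o\<^sub>L k)) x) \<le> e" if "norm x \<le> 1" for x
    proof -
      have "k x \<in> closure (k ` cball 0 1)" using that closure_subset by force
      then obtain y where y: "y \<in> F" "norm (k x - y) < e / 2"
        using F(2) by (auto simp: dist_norm norm_minus_commute)
      have "(k - (l2_trunc n o\<^sub>L k)) x = (id_blinfun - l2_trunc n) (k x - y) + (y - l2_trunc n y)"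
        by (simp add: blinfun.diff_left blinfun.diff_right)
      also have "norm \<dots> \<le> norm ((id_blinfun - l2_trunc n) (k x - y)) + norm (y - l2_trunc n y)"
        by (rule norm_triangle_ineq)
      also have "\<dots> \<le> 1 * norm (k x - y) + norm (y - l2_trunc n y)"
        by (intro add_right_mono order_trans[OF norm_blinfun] mult_right_mono norm_id_minus_trunc_le) simp
      also have "\<dots> \<le> e" using y elim by (smt (verit) field_sum_of_halves)
      finally show ?thesis .
    qed
    show ?case
    proof (rule norm_blinfun_bound)
      fix x
      show "norm ((k - (l2_trunc n o\<^sub>L k)) x) \<le> e * norm x"
      proof (cases "x = 0")
        case False
        then show ?thesis using unit[of "inverse (norm x) *\<^sub>R x"]
          by (simp add: blinfun.scaleR_right field_simps)
      qed (simp add: blinfun.zero_right)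
    qed (use assms(2) in simp)
  qed
qed

text \<open>Compactness handles the truncation on the left. For the one on the right, compactness of
  the adjoint is avoided: \<open>k\<close> is first replaced by
  \<open>l2_trunc m o\<^sub>L k\<close> for a fixed \<open>m\<close>. This operator has only
  \<open>m\<close> rows, given by the vectors \<open>adj k (l2_incl i 1)\<close>, and on finitely
  many vectors pointwise convergence of truncations suffices.\<close>

lemma compact_op_trunc_tendsto:
  fixes k :: "complex l2 \<Rightarrow>\<^sub>L complex l2"
  assumes "k \<in> compact_operators"
  shows "(\<lambda>n. norm (k - (l2_trunc n o\<^sub>L k o\<^sub>L l2_trunc n))) \<longlonglongrightarrow> 0"
proof (rule tendstoI)
  fix e :: real assume e: "e > 0"
  have k: "complex_linear k" and comp: "compact (closure (blinfun_apply k ` cball 0 1))"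
    using assms by (auto simp: compact_operators_def)
  have ev: "\<forall>\<^sub>F n in sequentially. norm (k - (l2_trunc n o\<^sub>L k)) \<le> e / 4"
    by (rule trunc_compact_tendsto[OF comp]) (use e in simp)
  then obtain m where m: "norm (k - (l2_trunc m o\<^sub>L k)) \<le> e / 4"
    using eventually_happens'[OF sequentially_bot ev] by blast
  define b where "b n = (\<Sum>i<m. norm ((id_blinfun - l2_trunc n) (adj k (l2_incl i 1))))" for n
  have "b \<longlonglongrightarrow> (\<Sum>i<m. norm (adj k (l2_incl i 1) - adj k (l2_incl i 1)))"
    unfolding b_def blinfun.diff_left id_blinfun.rep_eq by (intro tendsto_intros trunc_tendsto)
  then have evb: "\<forall>\<^sub>F n in sequentially. b n < e / 4"
    using e by (intro order_tendstoD(2)) auto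
  have bound: "norm (l2_trunc m o\<^sub>L k o\<^sub>L (id_blinfun - l2_trunc n)) \<le> b n" for n
  proof (rule norm_blinfun_bound)
    fix x
    define Q where "Q = (id_blinfun - l2_trunc n :: complex l2 \<Rightarrow>\<^sub>L complex l2)"
    have Q: "complex_linear Q" "adj Q = Q" by (simp_all add: Q_def adj_diff)
    have co: "l2_nth (k (Q x)) i = cinner (Q (adj k (l2_incl i 1))) x" for i
    proof -
      have "l2_nth y i = cinner (l2_incl i 1) y" for y :: "complex l2"
        using cinner_adj_left[OF complex_linear_coord, of i "1 :: complex" y]
        by (simp add: cinner_complex_def)
      then have "l2_nth (k (Q x)) i = cinner (l2_incl i 1) (k (Q x))" .
      also have "\<dots> = cinner (adj Q (adj k (l2_incl i 1))) x"
        by (simp add: cinner_adj_left k Q(1))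
      finally show ?thesis by (simp add: Q)
    qed
    have "norm ((l2_trunc m o\<^sub>L k o\<^sub>L Q) x) = norm (\<Sum>i<m. l2_incl i (l2_nth (k (Q x)) i))"
      by (simp add: l2_trunc_def blinfun.sum_left)
    also have "\<dots> \<le> (\<Sum>i<m. norm (l2_nth (k (Q x)) i))"
    proof (rule sum_norm_le)
      fix i
      show "norm (l2_incl i (l2_nth (k (Q x)) i)) \<le> norm (l2_nth (k (Q x)) i)" by simp
    qed
    also have "\<dots> \<le> (\<Sum>i<m. norm (Q (adj k (l2_incl i 1))) * norm x)"
      unfolding co by (intro sum_mono Cauchy_Schwarz)
    finally show "norm ((l2_trunc m o\<^sub>L k o\<^sub>L (id_blinfun - l2_trunc n)) x) \<le> b n * norm x"
      by (simp add: b_def Q_def sum_distrib_right)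
  qed (simp add: b_def sum_nonneg)
  show "\<forall>\<^sub>F n in sequentially. dist (norm (k - (l2_trunc n o\<^sub>L k o\<^sub>L l2_trunc n))) 0 < e"
    using evb ev
  proof eventually_elim
    case (elim n)
    let ?p = "l2_trunc n :: complex l2 \<Rightarrow>\<^sub>L complex l2"
    let ?q = "l2_trunc m :: complex l2 \<Rightarrow>\<^sub>L complex l2"
    let ?Q = "id_blinfun - ?p"
    \<comment> \<open>Apart from the loss of the left truncation, the error is
      \<open>?p o\<^sub>L k o\<^sub>L ?Q\<close>, which is split by inserting the fixed truncation
      \<open>?q\<close>. Each of the three terms is at most \<open>e / 4\<close>.\<close>
    have "k - (?p o\<^sub>L k o\<^sub>L ?p)
        = (k - (?p o\<^sub>L k)) + ((?p o\<^sub>L (k - (?q o\<^sub>L k)) o\<^sub>L ?Q) + (?p o\<^sub>L (?q o\<^sub>L k o\<^sub>L ?Q)))"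
      by (rule blinfun_eqI) (simp add: blinfun.diff_left blinfun.diff_right blinfun.add_left)
    also have "norm \<dots> \<le> norm (k - (?p o\<^sub>L k))
        + (norm (?p o\<^sub>L (k - (?q o\<^sub>L k)) o\<^sub>L ?Q) + norm (?p o\<^sub>L (?q o\<^sub>L k o\<^sub>L ?Q)))"
      by (intro order_trans[OF norm_triangle_ineq] add_left_mono norm_triangle_ineq)
    also have "norm (?p o\<^sub>L (k - (?q o\<^sub>L k)) o\<^sub>L ?Q) \<le> 1 * (e / 4) * 1"
      using e by (intro order_trans[OF norm_blinfun_compose] mult_mono norm_trunc_le norm_id_minus_trunc_le m
          mult_nonneg_nonneg) auto
    also have "norm (?p o\<^sub>L (?q o\<^sub>L k o\<^sub>L ?Q)) \<le> 1 * b n"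
      by (intro order_trans[OF norm_blinfun_compose] mult_mono norm_trunc_le bound) auto
    finally show ?case using elim e by simp
  qed
qed

text \<open>The unit ball is mapped into the image of the closed unit disc of the complex numbers,
  which is compact.\<close>

lemma matrix_unit_compact: "l2_incl i o\<^sub>L l2_coord l \<in> (compact_operators :: (complex l2 \<Rightarrow>\<^sub>L complex l2) set)"
proof -
  let ?e = "l2_incl i o\<^sub>L l2_coord l :: complex l2 \<Rightarrow>\<^sub>L complex l2"
  have "compact (l2_incl i ` cball (0::complex) 1)"
    by (intro compact_continuous_image linear_continuous_on blinfun.bounded_linear_right) auto
  moreover have "?e ` cball 0 1 \<subseteq> l2_incl i ` cball (0::complex) 1"
    using norm_l2_nth_le order_trans by fastforce
  ultimately have "compact (closure (?e ` cball 0 1))"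
    by (metis closed_closure closure_minimal compact_Int_closed compact_imp_closed inf.absorb_iff2)
  then show ?thesis by (simp add: compact_operators_def)
qed

lemma subspace_closure:
  fixes S :: "'a::real_normed_vector set"
  assumes "subspace S"
  shows "subspace (closure S)"
proof (rule subspaceI)
  show "0 \<in> closure S" using subspace_0[OF assms] closure_subset by blast
next
  fix x y assume "x \<in> closure S" "y \<in> closure S"
  then obtain X Y where "\<And>n. X n \<in> S" "X \<longlonglongrightarrow> x" "\<And>n. Y n \<in> S" "Y \<longlonglongrightarrow> y"
    unfolding closure_sequential by blast
  then show "x + y \<in> closure S"
    unfolding closure_sequential
    by (intro exI[of _ "\<lambda>n. X n + Y n"] conjI allI tendsto_add subspace_add[OF assms])
next
  fix x and c :: real assume "x \<in> closure S"
  then obtain X where "\<And>n. X n \<in> S" "X \<longlonglongrightarrow> x"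
    unfolding closure_sequential by blast
  then show "c *\<^sub>R x \<in> closure S"
    unfolding closure_sequential
    by (intro exI[of _ "\<lambda>n. c *\<^sub>R X n"] conjI allI tendsto_scaleR tendsto_const subspace_scale[OF assms])
qed

text \<open>Truncating an elementary tensor on both sides leaves a finite block matrix, and the
  error is again an elementary tensor, of \<open>k\<close> minus its truncation with
  \<open>a\<close>, so its norm tends to 0. From here on the tensor product is handled through
  matrix blocks alone.\<close>

lemma compact_tensor_eq:
  fixes S :: "('h::complex_hilbert_space \<Rightarrow>\<^sub>L 'h) set"
  assumes lin: "S \<subseteq> {T. complex_linear T}" and scale: "\<And>c a. a \<in> S \<Longrightarrow> op_scale c a \<in> S"
  shows "compact_tensor S = closure (span {l2_incl i o\<^sub>L a o\<^sub>L l2_coord l | i l a. a \<in> S})"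
    (is "_ = closure (span ?M)")
proof (rule subset_antisym)
  have "is_tensor_op (l2_incl i o\<^sub>L l2_coord l) a (l2_incl i o\<^sub>L a o\<^sub>L l2_coord l)" if "a \<in> S" for i l a
  proof -
    have "complex_linear a" using that lin by auto
    then show ?thesis unfolding is_tensor_op_def
      by (auto intro!: l2_eqI simp: l2_nth_incl complex_linearD scaleC.zero_left scaleC.zero_right)
  qed
  then have "?M \<subseteq> {T. \<exists>k\<in>compact_operators. \<exists>a\<in>S. is_tensor_op k a T}"
    using matrix_unit_compact by blast
  then show "closure (span ?M) \<subseteq> compact_tensor S"
    unfolding compact_tensor_def by (intro closure_mono span_mono)
next
  have tensor: "T \<in> closure (span ?M)" if k: "k \<in> compact_operators" and a: "a \<in> S" and T: "is_tensor_op k a T"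
    for k a T
  proof -
    let ?P = "\<lambda>n. l2_trunc n o\<^sub>L T o\<^sub>L l2_trunc n"
    have klin: "complex_linear k" using k by (simp add: compact_operators_def)
    have trunc: "l2_trunc n (tensor_vec x h) = tensor_vec (l2_trunc n x) h" for n x and h :: 'h
      by (rule l2_eqI) (simp add: l2_nth_trunc scaleC.zero_left)
    have diff: "tensor_vec (x - y) h = tensor_vec x h - tensor_vec y h" for x y and h :: 'h
      by (rule l2_eqI) (simp add: scaleC.diff_left)
    have "is_tensor_op (k - (l2_trunc n o\<^sub>L k o\<^sub>L l2_trunc n)) a (T - ?P n)" for n
      using T by (simp add: is_tensor_op_def blinfun.diff_left trunc diff)
    then have "norm (T - ?P n) \<le> norm (k - (l2_trunc n o\<^sub>L k o\<^sub>L l2_trunc n)) * norm a" for n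
      by (rule norm_tensor_op_le) (simp add: klin)
    moreover have "(\<lambda>n. norm (k - (l2_trunc n o\<^sub>L k o\<^sub>L l2_trunc n)) * norm a) \<longlonglongrightarrow> 0 * norm a"
      by (intro tendsto_intros compact_op_trunc_tendsto k)
    ultimately have "(\<lambda>n. T - ?P n) \<longlonglongrightarrow> 0"
      by (intro Lim_null_comparison[where f="\<lambda>n. T - ?P n"]) auto
    then have "(\<lambda>n. T - (T - ?P n)) \<longlonglongrightarrow> T - 0" by (intro tendsto_intros)
    then have lim: "?P \<longlonglongrightarrow> T" by simp
    have "?P n \<in> span ?M" for n
    proof -
      \<comment> \<open>The complex matrix entries of \<open>k\<close> are absorbed into
        \<open>a\<close>; this is where \<open>S\<close> must be closed under complex multiples for
        a real span to suffice.\<close>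
      have "?P n = (\<Sum>i<n. \<Sum>l<n. l2_incl i o\<^sub>L op_scale (l2_nth (k (l2_incl l 1)) i) a o\<^sub>L l2_coord l)"
        by (intro blinfun_eqI, subst sum.swap) (simp add: l2_trunc_def blinfun.sum_left blinfun.sum_right
            l2_nth_sum is_tensor_op_incl[OF T])
      also have "\<dots> \<in> span ?M"
        by (intro span_sum span_base) (use a scale in blast)
      finally show ?thesis .
    qed
    with lim show ?thesis unfolding closure_sequential by (intro exI[of _ ?P] conjI allI)
  qed
  have sub: "{T. \<exists>k\<in>compact_operators. \<exists>a\<in>S. is_tensor_op k a T} \<subseteq> closure (span ?M)"
    by (rule subsetI, elim CollectE bexE) (rule tensor)
  have "subspace (closure (span ?M))" by (rule subspace_closure[OF subspace_span])
  then show "compact_tensor S \<subseteq> closure (span ?M)"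
    unfolding compact_tensor_def by (intro closure_minimal[OF _ closed_closure] span_minimal[OF sub])
qed

section \<open>A criterion for stability\<close>

lemmas tendsto_compose = bounded_bilinear.tendsto[OF bounded_bilinear_blinfun_compose]

lemma norm_orthogonal_sum_square:
  fixes v :: "'i \<Rightarrow> 'h::complex_hilbert_space"
  assumes "finite I" and "\<And>k l. k \<noteq> l \<Longrightarrow> cinner (v k) (v l) = 0"
  shows "(norm (sum v I))\<^sup>2 = (\<Sum>k\<in>I. (norm (v k))\<^sup>2)"
  using assms(1)
proof (induction I rule: finite_induct)
  case (insert k I)
  have "cinner (v k) (sum v I) = 0"
    unfolding cinner.sum_right using insert assms(2) by (intro sum.neutral) metis
  then show ?case using insert by (simp add: norm_add_square)
qed simp

lemma orthogonal_series:
  fixes v :: "nat \<Rightarrow> 'h::complex_hilbert_space"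
  assumes orth: "\<And>k l. k \<noteq> l \<Longrightarrow> cinner (v k) (v l) = 0"
    and bound: "\<And>n. (\<Sum>k<n. (norm (v k))\<^sup>2) \<le> C"
  shows "summable v" and "(norm (suminf v))\<^sup>2 \<le> C"
proof -
  have "(\<Sum>k\<le>n. (norm (v k))\<^sup>2) \<le> C" for n
    using bound[of "Suc n"] by (simp add: lessThan_Suc_atMost)
  then have sq: "summable (\<lambda>k. (norm (v k))\<^sup>2)" by (intro bounded_imp_summable) auto
  show v: "summable v"
    unfolding summable_Cauchy
  proof (intro allI impI)
    fix e :: real assume e: "e > 0"
    then have "\<exists>N. \<forall>m\<ge>N. \<forall>n. norm (\<Sum>k=m..<n. (norm (v k))\<^sup>2) < e\<^sup>2"
      using sq unfolding summable_Cauchy by simp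
    then obtain N where N: "\<And>m n. m \<ge> N \<Longrightarrow> norm (\<Sum>k=m..<n. (norm (v k))\<^sup>2) < e\<^sup>2" by blast
    have "norm (sum v {m..<n}) < e" if "m \<ge> N" for m n
    proof -
      have "(norm (sum v {m..<n}))\<^sup>2 < e\<^sup>2"
        using N[OF that, of n] norm_orthogonal_sum_square[OF _ orth, of "{m..<n}"]
        by (simp add: sum_nonneg)
      then show ?thesis using e by (simp add: power2_less_imp_less)
    qed
    then show "\<exists>N. \<forall>m\<ge>N. \<forall>n. norm (sum v {m..<n}) < e" by blast
  qed
  have "(\<lambda>n. (norm (sum v {..<n}))\<^sup>2) \<longlonglongrightarrow> (norm (suminf v))\<^sup>2"
    by (intro tendsto_intros summable_LIMSEQ v)
  then show "(norm (suminf v))\<^sup>2 \<le> C"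
    by (rule LIMSEQ_le_const2) (simp add: norm_orthogonal_sum_square[OF _ orth] bound)
qed

text \<open>\<open>U\<close> is the sum of all \<open>G k o\<^sub>L adj (F k)\<close>. The series
  converges at each vector, though not in norm: its terms are orthogonal, and their squared norms
  are summable by Bessel's inequality for the \<open>F k\<close>. The common initial projection
  \<open>p\<close> makes the terms fit together.\<close>

lemma intertwining_operator:
  fixes F :: "nat \<Rightarrow> 'h::complex_hilbert_space \<Rightarrow>\<^sub>L 'h"
    and G :: "nat \<Rightarrow> 'h \<Rightarrow>\<^sub>L 'k::complex_hilbert_space"
  assumes F: "\<And>k. complex_linear (F k)" "\<And>k l. adj (F k) o\<^sub>L F l = (if k = l then p else 0)"
      "\<And>k. F k o\<^sub>L p = F k"
    and G: "\<And>k. complex_linear (G k)" "\<And>k l. adj (G k) o\<^sub>L G l = (if k = l then p else 0)"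
      "\<And>k. G k o\<^sub>L p = G k"
  shows "\<exists>U. complex_linear U \<and> (\<forall>k. U o\<^sub>L F k = G k) \<and> (\<forall>k. adj U o\<^sub>L G k = F k)"
proof -
  have p: "p = adj (F 0) o\<^sub>L F 0" using F(2)[of 0 0] by simp
  have p_lin: "complex_linear p" unfolding p by (intro complex_linear_compose complex_linear_adj F(1))
  have p_adj: "adj p = p" unfolding p by (simp only: adj_compose adj_adj complex_linear_adj F(1))
  have "adj (F k o\<^sub>L p) = p o\<^sub>L adj (F k)" for k
    by (simp only: adj_compose[OF F(1) p_lin] p_adj)
  then have pF: "p (adj (F k) h) = adj (F k) h" for k h
    using F(3)[of k] by (metis blinfun_apply_blinfun_compose)
  have FF: "adj (F k) (F l x) = (if k = l then p x else 0)" for k l x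
    using arg_cong[OF F(2)[of k l], of "\<lambda>T. blinfun_apply T x"] by simp
  have GG: "adj (G k) (G l x) = (if k = l then p x else 0)" for k l x
    using arg_cong[OF G(2)[of k l], of "\<lambda>T. blinfun_apply T x"] by simp
  have Gp: "G k (p x) = G k x" for k x
    using arg_cong[OF G(3)[of k], of "\<lambda>T. blinfun_apply T x"] by simp
  define v where "v h k = G k (adj (F k) h)" for h k
  define w where "w h k = F k (adj (F k) h)" for h k
  have cv: "cinner (v h k) (v h l) = (if k = l then of_real ((norm (adj (F k) h))\<^sup>2) else 0)" for h k l
  proof -
    have "cinner (v h k) (v h l) = cinner (adj (F k) h) (adj (G k) (v h l))"
      by (simp only: v_def cinner_adj_right[OF G(1)])
    then show ?thesis by (simp add: v_def GG pF cinner_self cinner.zero_right)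
  qed
  have cw: "cinner (w h k) (w h l) = (if k = l then of_real ((norm (adj (F k) h))\<^sup>2) else 0)" for h k l
  proof -
    have "cinner (w h k) (w h l) = cinner (adj (F k) h) (adj (F k) (w h l))"
      by (simp only: w_def cinner_adj_right[OF F(1)])
    then show ?thesis by (simp add: w_def FF pF cinner_self cinner.zero_right)
  qed
  have nv: "(norm (v h k))\<^sup>2 = (norm (adj (F k) h))\<^sup>2" for h k
    by (simp add: norm_square_cinner cv)
  have nw: "(norm (w h k))\<^sup>2 = (norm (adj (F k) h))\<^sup>2" for h k
    by (simp add: norm_square_cinner cw)
  \<comment> \<open>Here \<open>s\<close> is the orthogonal projection of \<open>h\<close> to the
    ranges of the first \<open>n\<close> operators, so \<open>cinner h s\<close> equals the square
    of the norm of \<open>s\<close>, and Cauchy-Schwarz gives the bound.\<close>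
  have Bessel: "(\<Sum>k<n. (norm (adj (F k) h))\<^sup>2) \<le> (norm h)\<^sup>2" for n h
  proof -
    define s where "s = sum (w h) {..<n}"
    have s: "(norm s)\<^sup>2 = (\<Sum>k<n. (norm (adj (F k) h))\<^sup>2)"
      unfolding s_def nw[symmetric] by (rule norm_orthogonal_sum_square) (simp_all add: cw)
    have "cinner h (w h k) = of_real ((norm (adj (F k) h))\<^sup>2)" for k
      by (simp only: w_def cinner_adj_left[OF F(1), symmetric] cinner_self)
    then have "cinner h s = of_real ((norm s)\<^sup>2)" unfolding s by (simp add: s_def cinner.sum_right)
    then have "norm s * norm s \<le> norm h * norm s"
      using Re_Cauchy_Schwarz[of h s] by (simp add: power2_eq_square)
    then have "norm s \<le> norm h" by (cases "s = 0") auto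
    then show ?thesis unfolding s[symmetric] by simp
  qed
  have orth: "k \<noteq> l \<Longrightarrow> cinner (v h k) (v h l) = 0" for h k l by (simp add: cv)
  have bound: "(\<Sum>k<n. (norm (v h k))\<^sup>2) \<le> (norm h)\<^sup>2" for h n by (simp add: nv Bessel)
  have v_sum: "summable (v h)" for h by (rule orthogonal_series(1)[OF orth bound])
  have v_norm: "norm (suminf (v h)) \<le> norm h" for h
    by (rule power2_le_imp_le[OF orthogonal_series(2)[OF orth bound] norm_ge_zero])
  have "bounded_linear (\<lambda>h. suminf (v h))"
  proof (rule bounded_linear_intro[of _ 1])
    fix x y and r :: real
    have "v (x + y) = (\<lambda>k. v x k + v y k)" by (simp add: v_def fun_eq_iff blinfun.add_right)
    then show "suminf (v (x + y)) = suminf (v x) + suminf (v y)"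
      by (simp add: suminf_add v_sum)
    have "v (r *\<^sub>R x) = (\<lambda>k. r *\<^sub>R v x k)" by (simp add: v_def fun_eq_iff blinfun.scaleR_right)
    then show "suminf (v (r *\<^sub>R x)) = r *\<^sub>R suminf (v x)"
      by (simp add: suminf_scaleR_right v_sum)
  qed (simp add: v_norm)
  then have U: "blinfun_apply (Blinfun (\<lambda>h. suminf (v h))) h = suminf (v h)" for h
    by (simp add: bounded_linear_Blinfun_apply)
  define U where "U = Blinfun (\<lambda>h. suminf (v h))"
  have U_lin: "complex_linear U"
    unfolding complex_linear_def
  proof (intro allI)
    fix c x
    have "v (c *\<^sub>C x) = (\<lambda>k. c *\<^sub>C v x k)" by (simp add: v_def fun_eq_iff complex_linearD F G)
    then show "U (c *\<^sub>C x) = c *\<^sub>C U x"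
      by (simp add: U_def U bounded_linear.suminf[OF scaleC.bounded_linear_right v_sum])
  qed
  moreover have "U o\<^sub>L F l = G l" for l
  proof (rule blinfun_eqI)
    fix x
    have "suminf (v (F l x)) = sum (v (F l x)) {l}"
      by (rule suminf_finite) (auto simp: v_def FF blinfun.zero_right)
    then show "(U o\<^sub>L F l) x = G l x" by (simp add: U_def U v_def FF Gp)
  qed
  moreover have "adj U o\<^sub>L G k = F k" for k
  proof (rule blinfun_eqI, rule cinner_ext)
    fix x y
    have "cinner ((adj U o\<^sub>L G k) x) y = cinner (G k x) (suminf (v y))"
      by (simp add: cinner_adj_left U_lin) (simp add: U_def U)
    also have "\<dots> = (\<Sum>l. cinner (G k x) (v y l))"
      by (rule bounded_linear.suminf[OF cinner.bounded_linear_right v_sum])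
    also have "\<dots> = (\<Sum>l. cinner x (adj (G k) (v y l)))" by (simp add: cinner_adj_right G)
    also have "\<dots> = (\<Sum>l\<in>{k}. cinner x (adj (G k) (v y l)))"
      by (rule suminf_finite) (auto simp: v_def GG cinner.zero_right)
    also have "\<dots> = cinner (F k x) y" by (simp add: v_def GG pF cinner_adj_right F)
    finally show "cinner ((adj U o\<^sub>L G k) x) y = cinner (F k x) y" .
  qed
  ultimately show ?thesis by blast
qed

section \<open>Closed star algebras of operators and their stabilisation\<close>

locale concrete_cstar_algebra =
  fixes A :: "('h::complex_hilbert_space \<Rightarrow>\<^sub>L 'h) set"
  assumes lin: "a \<in> A \<Longrightarrow> complex_linear a"
    and zero: "0 \<in> A"
    and add: "a \<in> A \<Longrightarrow> b \<in> A \<Longrightarrow> a + b \<in> A"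
    and scale: "a \<in> A \<Longrightarrow> op_scale c a \<in> A"
    and comp: "a \<in> A \<Longrightarrow> b \<in> A \<Longrightarrow> a o\<^sub>L b \<in> A"
    and adjoint: "a \<in> A \<Longrightarrow> adj a \<in> A"
    and closed: "closed A"
begin

lemma scaleR: "a \<in> A \<Longrightarrow> r *\<^sub>R a \<in> A"
proof -
  have "r *\<^sub>R a = op_scale (of_real r) a"
    by (rule blinfun_eqI) (simp add: scaleC_of_real blinfun.scaleR_left)
  then show "a \<in> A \<Longrightarrow> r *\<^sub>R a \<in> A" by (simp add: scale)
qed

lemma subspace: "subspace A"
  by (intro subspaceI zero add scaleR)

lemma csub_operator: "csub (operator_algebra S) a b = a - b"
  unfolding csub_def operator_algebra_def
  by (rule blinfun_eqI) (simp add: blinfun.add_left blinfun.diff_left scaleC.minus_left)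

lemma cstar_algebra: "cstar_algebra (operator_algebra A)"
proof unfold_locales
  fix X assume X: "\<And>k. X k \<in> carr (operator_algebra A)" and C: "cCauchy (operator_algebra A) X"
  have "Cauchy X"
    using C unfolding cCauchy_def csub_operator Cauchy_def
    by (simp add: operator_algebra_def dist_norm)
  then obtain l where l: "X \<longlonglongrightarrow> l" using Cauchy_convergent convergent_def by blast
  moreover have "l \<in> A"
    using closed_sequentially[OF closed, of X l] X l by (simp add: operator_algebra_def)
  ultimately show "\<exists>l\<in>carr (operator_algebra A). cconverges (operator_algebra A) X l"
    unfolding cconverges_def csub_operator
    by (intro bexI[of _ l]) (simp_all add: operator_algebra_def LIM_zero tendsto_norm_zero)
qed (auto simp: operator_algebra_def adjoint_op_eq_adj lin zero add scale comp adjoint adj_adj adj_add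
    adj_compose adj_op_scale norm_op_scale norm_triangle_ineq norm_blinfun_compose norm_adj_compose
    complex_linearD scaleC_scaleC scaleC_add_left scaleC_add_right scaleC.minus_left
    blinfun.add_left blinfun.add_right intro!: blinfun_eqI)

text \<open>The partial isometries \<open>F\<^sub>k\<close> decompose the underlying space into infinitely many copies of one space,
  and the pairing of \<open>\<nat> \<times> \<nat>\<close> with \<open>\<nat>\<close> identifies it with infinitely many copies of itself.\<close>

lemma stable:
  fixes F :: "nat \<Rightarrow> 'h \<Rightarrow>\<^sub>L 'h"
  assumes F_lin: "\<And>k. complex_linear (F k)"
    and FF: "\<And>k l. adj (F k) o\<^sub>L F l = (if k = l then p else 0)"
    and Fp: "\<And>k. F k o\<^sub>L p = F k"
    and F_mult: "\<And>k a. a \<in> A \<Longrightarrow> F k o\<^sub>L a \<in> A" "\<And>k a. a \<in> A \<Longrightarrow> adj (F k) o\<^sub>L a \<in> A"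
    and F_unit: "\<And>a. a \<in> A \<Longrightarrow> (\<lambda>m. \<Sum>k<m. F k o\<^sub>L (adj (F k) o\<^sub>L a)) \<longlonglongrightarrow> a"
  shows "stable_operator_algebra A"
proof -
  \<comment> \<open>The index \<open>k\<close> is read as a pair: the copy of the space in which the
    range is placed, and the number of the partial isometry used there.\<close>
  define G where "G k = l2_incl (fst (prod_decode k)) o\<^sub>L F (snd (prod_decode k))" for k
  have G_lin: "complex_linear (G k)" for k by (simp add: G_def F_lin)
  have FF': "adj (F k) (F l x) = (if k = l then p x else 0)" for k l x
    using arg_cong[OF FF[of k l], of "\<lambda>T. blinfun_apply T x"] by simp
  have GG: "adj (G k) o\<^sub>L G l = (if k = l then p else 0)" for k l
  proof (rule blinfun_eqI)
    fix x
    have inj: "k = l" if "fst (prod_decode k) = fst (prod_decode l)" "snd (prod_decode k) = snd (prod_decode l)"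
      using that by (metis prod.expand prod_decode_inverse)
    then show "(adj (G k) o\<^sub>L G l) x = (if k = l then p else 0) x"
      by (auto simp: G_def adj_compose F_lin l2_nth_incl FF' blinfun.zero_right dest: inj)
  qed
  have "F k (p x) = F k x" for k x
    using arg_cong[OF Fp[of k], of "\<lambda>T. blinfun_apply T x"] by simp
  then have Gp: "G k o\<^sub>L p = G k" for k by (intro blinfun_eqI) (simp add: G_def)
  obtain U where U_lin: "complex_linear U" and UF: "\<And>k. U o\<^sub>L F k = G k"
    and UG: "\<And>k. adj U o\<^sub>L G k = F k"
    using intertwining_operator[OF F_lin FF Fp G_lin GG Gp] by blast
  have UF': "U (F k x) = G k x" for k x
    using arg_cong[OF UF[of k], of "\<lambda>T. blinfun_apply T x"] by simp
  have UG': "adj U (G k x) = F k x" for k x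
    using arg_cong[OF UG[of k], of "\<lambda>T. blinfun_apply T x"] by simp
  have adjUF: "adj (F k) (adj U y) = adj (G k) y" for k y
    using arg_cong[OF UF[of k], of "\<lambda>T. blinfun_apply (adj T) y"] by (simp add: adj_compose U_lin F_lin)
  \<comment> \<open>The hypotheses concern multiplication from the left; passing to adjoints gives
    the right side.\<close>
  have F_mult_right: "a o\<^sub>L F k \<in> A" "a o\<^sub>L adj (F k) \<in> A" if "a \<in> A" for a k
    using adjoint[OF F_mult(2)[OF adjoint[OF that]], of k] adjoint[OF F_mult(1)[OF adjoint[OF that]], of k]
    by (simp_all add: adj_compose adj_adj lin adjoint that F_lin)
  have F_unit_right: "(\<lambda>m. \<Sum>k<m. a o\<^sub>L F k o\<^sub>L adj (F k)) \<longlonglongrightarrow> a" if a: "a \<in> A" for a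
  proof -
    have eq: "adj (\<Sum>k<m. F k o\<^sub>L (adj (F k) o\<^sub>L adj a)) = (\<Sum>k<m. a o\<^sub>L F k o\<^sub>L adj (F k))" for m
      by (simp add: adj_sum adj_compose adj_adj lin adjoint a F_lin)
    have mem: "(\<Sum>k<m. F k o\<^sub>L (adj (F k) o\<^sub>L adj a)) \<in> A" for m
      by (intro subspace_sum[OF subspace] F_mult adjoint a)
    have "(\<lambda>m. (\<Sum>k<m. F k o\<^sub>L (adj (F k) o\<^sub>L adj a)) - adj a) \<longlonglongrightarrow> 0"
      using F_unit[OF adjoint[OF a]] by (rule LIM_zero)
    moreover have "norm ((\<Sum>k<m. a o\<^sub>L F k o\<^sub>L adj (F k)) - a)
        = norm ((\<Sum>k<m. F k o\<^sub>L (adj (F k) o\<^sub>L adj a)) - adj a)" for m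
      using norm_adj[of "(\<Sum>k<m. F k o\<^sub>L (adj (F k) o\<^sub>L adj a)) - adj a"]
      by (simp add: adj_diff eq lin[OF mem] lin adjoint a adj_adj)
    ultimately have "(\<lambda>m. (\<Sum>k<m. a o\<^sub>L F k o\<^sub>L adj (F k)) - a) \<longlonglongrightarrow> 0"
      by (subst tendsto_norm_zero_iff[symmetric]) (simp add: tendsto_norm_zero)
    then show ?thesis by (rule LIM_zero_cancel)
  qed
  \<comment> \<open>Every \<open>a\<close> is a limit of sums of its blocks, first over
    \<open>k\<close> and then over \<open>l\<close>, so membership need only be checked on blocks.
    Used with \<open>L = \<phi>\<close> for one inclusion of the image and with the embedding of
    \<open>a\<close> as a single matrix entry for the other.\<close>
  have density: "L a \<in> C"
    if a: "a \<in> A" and C: "closed C" "subspace C" and L: "bounded_linear L"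
      and mem: "\<And>k l. L (F k o\<^sub>L (adj (F k) o\<^sub>L (a o\<^sub>L F l o\<^sub>L adj (F l)))) \<in> C"
    for a C and L :: "('h \<Rightarrow>\<^sub>L 'h) \<Rightarrow> ('k::complex_hilbert_space \<Rightarrow>\<^sub>L 'k)"
  proof -
    interpret L: bounded_linear L by (rule L)
    have "L (a o\<^sub>L F l o\<^sub>L adj (F l)) \<in> C" for l
    proof (rule closed_sequentially[OF C(1)])
      show "(\<lambda>m. L (\<Sum>k<m. F k o\<^sub>L (adj (F k) o\<^sub>L (a o\<^sub>L F l o\<^sub>L adj (F l)))))
          \<longlonglongrightarrow> L (a o\<^sub>L F l o\<^sub>L adj (F l))"
        by (intro L.tendsto F_unit F_mult_right a)
      show "L (\<Sum>k<m. F k o\<^sub>L (adj (F k) o\<^sub>L (a o\<^sub>L F l o\<^sub>L adj (F l)))) \<in> C" for m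
        unfolding L.sum by (intro subspace_sum[OF C(2)] mem)
    qed
    then have mem': "L (\<Sum>l<m. a o\<^sub>L F l o\<^sub>L adj (F l)) \<in> C" for m
      unfolding L.sum by (intro subspace_sum[OF C(2)])
    have "(\<lambda>m. L (\<Sum>l<m. a o\<^sub>L F l o\<^sub>L adj (F l))) \<longlonglongrightarrow> L a"
      by (intro L.tendsto F_unit_right a)
    then show ?thesis by (rule closed_sequentially[OF C(1) mem'])
  qed
  have sandwich: "bounded_linear (\<lambda>a. S o\<^sub>L a o\<^sub>L T)"
    for S :: "'x::real_normed_vector \<Rightarrow>\<^sub>L 'y::real_normed_vector"
      and T :: "'v::real_normed_vector \<Rightarrow>\<^sub>L 'w::real_normed_vector"
    by (rule bounded_linear_compose[OF
      bounded_bilinear.bounded_linear_left[OF bounded_bilinear_blinfun_compose]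
      bounded_bilinear.bounded_linear_right[OF bounded_bilinear_blinfun_compose]])
  define \<phi> where "\<phi> a = U o\<^sub>L a o\<^sub>L adj U" for a
  have \<phi>_lin: "bounded_linear \<phi>" unfolding \<phi>_def by (rule sandwich)
  interpret \<phi>: bounded_linear \<phi> by (rule \<phi>_lin)
  \<comment> \<open>In place of unitarity: \<open>adj U o\<^sub>L U\<close> fixes the ranges of the
    \<open>F k\<close>, and by \<open>F_unit\<close> the range of every \<open>a\<close> lies in
    their closed span. Multiplicativity and injectivity of \<open>\<phi>\<close> rest on
    this.\<close>
  have UU_left: "adj U (U (a x)) = a x" if a: "a \<in> A" for a x
  proof -
    let ?s = "\<lambda>m. (\<Sum>k<m. F k o\<^sub>L (adj (F k) o\<^sub>L a)) x"
    have lim: "?s \<longlonglongrightarrow> a x" by (intro tendsto_intros F_unit a)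
    have "(\<lambda>m. adj U (U (?s m))) \<longlonglongrightarrow> adj U (U (a x))"
      by (intro blinfun.tendsto tendsto_const lim)
    moreover have "adj U (U (?s m)) = ?s m" for m
      by (simp add: blinfun.sum_left blinfun.sum_right UF' UG')
    ultimately have "?s \<longlonglongrightarrow> adj U (U (a x))" by simp
    then show ?thesis by (rule LIMSEQ_unique[OF _ lim])
  qed
  have UU_right: "a (adj U (U x)) = a x" if a: "a \<in> A" for a x
  proof -
    have "adj U o\<^sub>L U o\<^sub>L adj a = adj a"
      by (rule blinfun_eqI) (simp add: UU_left adjoint a)
    then have "adj (adj U o\<^sub>L U o\<^sub>L adj a) = a" by (simp add: adj_adj lin a)
    then have "a o\<^sub>L (adj U o\<^sub>L U) = a"
      by (simp add: adj_compose adj_adj lin a U_lin)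
    then show ?thesis by (metis blinfun_apply_blinfun_compose)
  qed
  have inverse: "adj U o\<^sub>L \<phi> a o\<^sub>L U = a" if "a \<in> A" for a
    by (rule blinfun_eqI) (simp add: \<phi>_def UU_left UU_right that)
  let ?M = "{l2_incl i o\<^sub>L a o\<^sub>L l2_coord l | i l a. a \<in> A}"
  have tensor: "compact_tensor A = closure (span ?M)"
    by (rule compact_tensor_eq) (auto simp: lin scale)
  have \<phi>_mem: "\<phi> a \<in> compact_tensor A" if a: "a \<in> A" for a
    unfolding tensor
  proof (rule density[OF a closed_closure subspace_closure[OF subspace_span] \<phi>_lin])
    fix k l
    let ?i = "fst (prod_decode k)" and ?j = "snd (prod_decode k)"
    let ?i' = "fst (prod_decode l)" and ?j' = "snd (prod_decode l)"
    \<comment> \<open>\<open>\<phi>\<close> turns a block of \<open>a\<close> into one matrix entry,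
      at the position given by the first components of the decoded indices. The second components
      only multiply the entry by some \<open>F ?j\<close> and \<open>adj (F ?j')\<close>, which
      keeps it in \<open>A\<close>.\<close>
    have "\<phi> (F k o\<^sub>L (adj (F k) o\<^sub>L (a o\<^sub>L F l o\<^sub>L adj (F l))))
        = l2_incl ?i o\<^sub>L (F ?j o\<^sub>L (adj (F k) o\<^sub>L (a o\<^sub>L F l o\<^sub>L adj (F ?j')))) o\<^sub>L l2_coord ?i'"
      by (rule blinfun_eqI) (simp add: \<phi>_def UF' adjUF G_def adj_compose F_lin)
    moreover have "F ?j o\<^sub>L (adj (F k) o\<^sub>L (a o\<^sub>L F l o\<^sub>L adj (F ?j'))) \<in> A"
      by (intro F_mult F_mult_right a)
    ultimately have "\<phi> (F k o\<^sub>L (adj (F k) o\<^sub>L (a o\<^sub>L F l o\<^sub>L adj (F l)))) \<in> ?M" by blast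
    then show "\<phi> (F k o\<^sub>L (adj (F k) o\<^sub>L (a o\<^sub>L F l o\<^sub>L adj (F l)))) \<in> closure (span ?M)"
      by (intro subsetD[OF closure_subset] span_base)
  qed
  \<comment> \<open>The map \<open>T \<mapsto> adj U o\<^sub>L T o\<^sub>L U\<close> is continuous
    and inverts \<open>\<phi>\<close> on \<open>A\<close>, so preimages of a convergent sequence
    converge.\<close>
  have image_closed: "closed (\<phi> ` A)"
    unfolding closed_sequential_limits
  proof (intro allI impI, elim conjE)
    fix X T assume X: "\<forall>n. X n \<in> \<phi> ` A" and lim: "X \<longlonglongrightarrow> T"
    define a where "a n = adj U o\<^sub>L X n o\<^sub>L U" for n
    have a: "a n \<in> A \<and> \<phi> (a n) = X n" for n
    proof -
      obtain b where "b \<in> A" "X n = \<phi> b" using X by blast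
      then show ?thesis by (simp add: a_def inverse)
    qed
    have lim_a: "a \<longlonglongrightarrow> (adj U o\<^sub>L T o\<^sub>L U)"
      unfolding a_def by (intro tendsto_compose tendsto_const lim)
    then have mem: "adj U o\<^sub>L T o\<^sub>L U \<in> A" using closed_sequentially[OF closed, of a] a by blast
    have "X \<longlonglongrightarrow> \<phi> (adj U o\<^sub>L T o\<^sub>L U)" using \<phi>.tendsto[OF lim_a] by (simp add: a)
    then have "T = \<phi> (adj U o\<^sub>L T o\<^sub>L U)" by (rule LIMSEQ_unique[OF lim])
    with mem show "T \<in> \<phi> ` A" by blast
  qed
  have image_subspace: "subspace (\<phi> ` A)"
    by (rule linear_subspace_image[OF \<phi>.linear_axioms subspace])
  have "T \<in> \<phi> ` A" if "T \<in> ?M" for T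
  proof -
    from that obtain i l a where a: "a \<in> A" and T: "T = l2_incl i o\<^sub>L a o\<^sub>L l2_coord l" by blast
    show ?thesis unfolding T
    proof (rule density[OF a image_closed image_subspace sandwich])
      fix j j'
      let ?x = "adj (F j) o\<^sub>L (a o\<^sub>L F j')"
      \<comment> \<open>These are the indices at which \<open>G\<close> equals
        \<open>l2_incl i o\<^sub>L F j\<close> and \<open>l2_incl l o\<^sub>L F j'\<close>, so the
        matrix entry is the image of a single block.\<close>
      let ?k = "prod_encode (i, j)" and ?k' = "prod_encode (l, j')"
      have "l2_incl i o\<^sub>L (F j o\<^sub>L (adj (F j) o\<^sub>L (a o\<^sub>L F j' o\<^sub>L adj (F j')))) o\<^sub>L l2_coord l
          = \<phi> (F ?k o\<^sub>L (?x o\<^sub>L adj (F ?k')))"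
        by (rule blinfun_eqI) (simp add: \<phi>_def UF' adjUF G_def adj_compose F_lin)
      moreover have "F ?k o\<^sub>L (?x o\<^sub>L adj (F ?k')) \<in> A" by (intro F_mult F_mult_right a)
      ultimately show "l2_incl i o\<^sub>L (F j o\<^sub>L (adj (F j) o\<^sub>L (a o\<^sub>L F j' o\<^sub>L adj (F j')))) o\<^sub>L l2_coord l
          \<in> \<phi> ` A" by blast
    qed
  qed
  then have "?M \<subseteq> \<phi> ` A" by (rule subsetI)
  then have "compact_tensor A \<subseteq> \<phi> ` A"
    unfolding tensor by (intro closure_minimal[OF _ image_closed] span_minimal[OF _ image_subspace])
  moreover have "\<phi> ` A \<subseteq> compact_tensor A" by (rule image_subsetI[OF \<phi>_mem])
  ultimately have image: "\<phi> ` A = compact_tensor A" by (rule subset_antisym[rotated])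
  have "star_hom (operator_algebra A) (operator_algebra (compact_tensor A)) \<phi>"
    unfolding star_hom_def operator_algebra_def adjoint_op_eq_adj
  proof (simp, intro conjI ballI allI)
    fix a b c assume a: "a \<in> A"
    show "\<phi> a \<in> compact_tensor A" by (rule \<phi>_mem[OF a])
    show "\<phi> (a + b) = \<phi> a + \<phi> b" by (rule \<phi>.add)
    show "\<phi> (op_scale c a) = op_scale c (\<phi> a)"
      by (rule blinfun_eqI) (simp add: \<phi>_def complex_linearD U_lin)
    show "\<phi> (adj a) = adj (\<phi> a)"
      by (rule blinfun_eqI) (simp add: \<phi>_def adj_compose adj_adj lin a U_lin)
    show "\<phi> (a o\<^sub>L b) = \<phi> a o\<^sub>L \<phi> b" if "b \<in> A"
      by (rule blinfun_eqI) (simp add: \<phi>_def UU_left that)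
  qed
  moreover have "bij_betw \<phi> A (compact_tensor A)"
    unfolding bij_betw_def
    by (intro conjI image inj_on_inverseI[of A "\<lambda>T. adj U o\<^sub>L T o\<^sub>L U"] inverse)
  ultimately have "star_isomorphic (operator_algebra A) (operator_algebra (compact_tensor A))"
    unfolding star_isomorphic_def by (auto simp: operator_algebra_def)
  then show ?thesis
    unfolding stable_operator_algebra_def using cstar_algebra lin by blast
qed

end

section \<open>Unital C*-algebras\<close>

locale unital_cstar = cstar_algebra A for A :: "'a star_algebra" +
  assumes unital: "\<exists>e. is_one A e"
begin

abbreviation plus (infixl \<open>\<oplus>\<close> 65) where "x \<oplus> y \<equiv> cadd A x y"
abbreviation sub (infixl \<open>\<ominus>\<close> 65) where "x \<ominus> y \<equiv> csub A x y"
abbreviation times (infixl \<open>\<otimes>\<close> 70) where "x \<otimes> y \<equiv> cmult A x y"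
abbreviation smult (infixr \<open>\<odot>\<close> 75) where "c \<odot> x \<equiv> cscale A c x"
abbreviation one (\<open>\<one>\<close>) where "\<one> \<equiv> cone A"
abbreviation zer (\<open>\<zero>\<close>) where "\<zero> \<equiv> czero A"

section \<open>Arithmetic and elementary norm estimates\<close>

lemma is_one_cone: "is_one A \<one>"
proof -
  obtain e where e: "is_one A e" using unital by blast
  show ?thesis unfolding cone_def
  proof (rule theI)
    fix x assume "is_one A x"
    with e show "x = e" unfolding is_one_def by metis
  qed (rule e)
qed

lemma one_closed: "\<one> \<in> carr A"
  using is_one_cone by (simp add: is_one_def)

lemma one_mult [simp]: "x \<in> carr A \<Longrightarrow> \<one> \<otimes> x = x" and mult_one [simp]: "x \<in> carr A \<Longrightarrow> x \<otimes> \<one> = x"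
  using is_one_cone by (simp_all add: is_one_def)

lemma sub_closed: "x \<in> carr A \<Longrightarrow> y \<in> carr A \<Longrightarrow> x \<ominus> y \<in> carr A"
  by (simp add: csub_def add_closed scale_closed)

lemmas closed = zero_closed one_closed add_closed sub_closed scale_closed mult_closed star_closed

declare closed [simp]

lemma zero_add [simp]: "x \<in> carr A \<Longrightarrow> \<zero> \<oplus> x = x"
  by (simp add: add_commute[of \<zero>] add_zero)

lemma add_minus_cancel [simp]: "x \<in> carr A \<Longrightarrow> y \<in> carr A \<Longrightarrow> x \<oplus> ((- 1) \<odot> x \<oplus> y) = y"
  by (simp add: add_assoc[symmetric] add_minus)

lemma add_left_commute:
  "x \<in> carr A \<Longrightarrow> y \<in> carr A \<Longrightarrow> z \<in> carr A \<Longrightarrow> x \<oplus> (y \<oplus> z) = y \<oplus> (x \<oplus> z)"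
  using add_assoc[of x y z] add_assoc[of y x z] add_commute[of x y] by simp

lemma scale_zero_left: "x \<in> carr A \<Longrightarrow> 0 \<odot> x = \<zero>"
  using scale_add_left[of x 1 "- 1"] by (simp add: scale_one add_minus)

lemma sub_add_cancel: "x \<in> carr A \<Longrightarrow> y \<in> carr A \<Longrightarrow> (x \<ominus> y) \<oplus> y = x"
  by (simp add: csub_def add_assoc add_commute[of "(- 1) \<odot> y" y] add_minus add_zero)

lemma add_sub_cancel: "x \<in> carr A \<Longrightarrow> y \<in> carr A \<Longrightarrow> (x \<oplus> y) \<ominus> x = y"
  by (simp add: csub_def add_assoc add_commute[of y] add_left_commute)

lemma add_sub_cancel_right: "x \<in> carr A \<Longrightarrow> y \<in> carr A \<Longrightarrow> (x \<oplus> y) \<ominus> y = x"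
  by (simp add: csub_def add_assoc add_minus add_zero)

lemma sub_self: "x \<in> carr A \<Longrightarrow> x \<ominus> x = \<zero>"
  by (simp add: csub_def add_minus)

lemma sub_eq_zero: "x \<in> carr A \<Longrightarrow> y \<in> carr A \<Longrightarrow> x \<ominus> y = \<zero> \<Longrightarrow> x = y"
  using sub_add_cancel[of x y] by simp

lemma sub_add_sub:
  "x \<in> carr A \<Longrightarrow> y \<in> carr A \<Longrightarrow> z \<in> carr A \<Longrightarrow> (x \<ominus> y) \<oplus> (y \<ominus> z) = x \<ominus> z"
  by (simp add: csub_def add_assoc) (simp add: add_left_commute[of "(- 1) \<odot> y"])

lemma add_sub_add_left:
  assumes "a \<in> carr A" "b \<in> carr A" "c \<in> carr A"
  shows "(a \<oplus> b) \<ominus> (a \<oplus> c) = b \<ominus> c"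
  using assms by (simp add: csub_def scale_add_right add_assoc add_left_commute[of b])

lemma mult_sub_right:
  "x \<in> carr A \<Longrightarrow> y \<in> carr A \<Longrightarrow> z \<in> carr A \<Longrightarrow> x \<otimes> (y \<ominus> z) = x \<otimes> y \<ominus> x \<otimes> z"
  by (simp add: csub_def mult_add_right mult_scale_right)

lemma mult_sub_left:
  "x \<in> carr A \<Longrightarrow> y \<in> carr A \<Longrightarrow> z \<in> carr A \<Longrightarrow> (y \<ominus> z) \<otimes> x = y \<otimes> x \<ominus> z \<otimes> x"
  by (simp add: csub_def mult_add_left mult_scale_left)

lemma star_sub: "x \<in> carr A \<Longrightarrow> y \<in> carr A \<Longrightarrow> cstar A (x \<ominus> y) = cstar A x \<ominus> cstar A y"
  by (simp add: csub_def star_add star_scale)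

lemma star_one [simp]: "cstar A \<one> = \<one>"
proof -
  have "cstar A (cstar A \<one> \<otimes> \<one>) = cstar A \<one> \<otimes> cstar A (cstar A \<one>)"
    by (rule star_mult) simp_all
  then show ?thesis by (simp add: star_star)
qed

lemma norm_zero [simp]: "cnorm A \<zero> = 0"
  by (simp add: norm_eq_zero)

lemma norm_sub_commute: "x \<in> carr A \<Longrightarrow> y \<in> carr A \<Longrightarrow> cnorm A (x \<ominus> y) = cnorm A (y \<ominus> x)"
proof -
  assume xy: "x \<in> carr A" "y \<in> carr A"
  then have "y \<ominus> x = (- 1) \<odot> (x \<ominus> y)"
    by (simp add: csub_def scale_add_right scale_scale scale_one add_commute)
  then show ?thesis using xy by (simp add: norm_scale)
qed

lemma norm_sub_triangle:
  assumes "x \<in> carr A" "y \<in> carr A" "z \<in> carr A"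
  shows "cnorm A (x \<ominus> z) \<le> cnorm A (x \<ominus> y) + cnorm A (y \<ominus> z)"
  using norm_triangle[of "x \<ominus> y" "y \<ominus> z"] assms by (simp add: sub_add_sub)

lemma norm_sub_le:
  assumes "x \<in> carr A" "y \<in> carr A"
  shows "cnorm A (x \<ominus> y) \<le> cnorm A x + cnorm A y"
  using norm_triangle[of x "(- 1) \<odot> y"] assms by (simp add: csub_def norm_scale)

lemma norm_star:
  assumes x: "x \<in> carr A"
  shows "cnorm A (cstar A x) = cnorm A x"
proof -
  have le: "cnorm A y \<le> cnorm A (cstar A y)" if y: "y \<in> carr A" for y
  proof (cases "cnorm A y = 0")
    case False
    then have "cnorm A y * cnorm A y \<le> cnorm A (cstar A y) * cnorm A y"
      using cstar_identity[OF y] norm_mult_le[of "cstar A y" y] y by (simp add: power2_eq_square)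
    then show ?thesis using False norm_nonneg[OF y] by simp
  qed (use norm_nonneg[of "cstar A y"] y in simp)
  show ?thesis using le[OF x] le[of "cstar A x"] x by (simp add: star_star)
qed

lemma norm_one_le: "cnorm A \<one> \<le> 1"
  using cstar_identity[OF one_closed] by (auto simp: power2_eq_square)

section \<open>Geometric convergence, Neumann series and resolvents\<close>

lemma geometric_convergence:
  assumes X: "\<And>k. X k \<in> carr A" and q: "0 \<le> q" "q < 1"
    and step: "\<And>k. cnorm A (X (Suc k) \<ominus> X k) \<le> C * q ^ k"
  shows "\<exists>l\<in>carr A. cconverges A X l"
proof (rule complete[OF X])
  have C: "C \<ge> 0" using norm_nonneg[of "X (Suc 0) \<ominus> X 0"] step[of 0] X by simp
  \<comment> \<open>\<open>D\<close> is the sum of the geometric series that starts with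
    \<open>C\<close>. Since \<open>C * q ^ k = D * (q ^ k - q ^ Suc k)\<close>, the estimate
    \<open>tail\<close> telescopes.\<close>
  define D where "D = C / (1 - q)"
  have D: "D \<ge> 0" "C = D * (1 - q)" using C q by (simp_all add: D_def)
  have tail: "cnorm A (X (k + d) \<ominus> X k) \<le> D * (q ^ k - q ^ (k + d))" for k d
  proof (induction d)
    case 0
    then show ?case using X by (simp add: sub_self norm_eq_zero)
  next
    case (Suc d)
    have "cnorm A (X (k + Suc d) \<ominus> X k)
        \<le> cnorm A (X (Suc (k + d)) \<ominus> X (k + d)) + cnorm A (X (k + d) \<ominus> X k)"
      using norm_sub_triangle[of "X (Suc (k + d))" "X (k + d)" "X k"] X by simp
    also have "\<dots> \<le> C * q ^ (k + d) + D * (q ^ k - q ^ (k + d))"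
      by (intro add_mono step Suc)
    also have "\<dots> = D * (q ^ k - q ^ (k + Suc d))" by (simp add: D(2) algebra_simps)
    finally show ?case .
  qed
  have bound: "cnorm A (X l \<ominus> X k) \<le> D * q ^ N" if "N \<le> k" "k \<le> l" for N k l
  proof -
    have "cnorm A (X l \<ominus> X k) \<le> D * (q ^ k - q ^ l)" using tail[of k "l - k"] that by simp
    also have "\<dots> \<le> D * q ^ N"
      using D q that by (intro mult_left_mono) (auto intro: order_trans[OF _ power_decreasing[of N k q]])
    finally show ?thesis .
  qed
  show "cCauchy A X"
    unfolding cCauchy_def
  proof (intro allI impI)
    fix e :: real assume e: "e > 0"
    have "(\<lambda>N. D * q ^ N) \<longlonglongrightarrow> D * 0" using q by (intro tendsto_intros LIMSEQ_realpow_zero)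
    then have "\<forall>\<^sub>F N in sequentially. D * q ^ N < e" using e by (intro order_tendstoD) auto
    then obtain N where N: "D * q ^ N < e" by (auto simp: eventually_sequentially)
    show "\<exists>N. \<forall>k\<ge>N. \<forall>l\<ge>N. cnorm A (X k \<ominus> X l) < e"
    proof (intro exI[of _ N] allI impI)
      fix k l assume "N \<le> k" "N \<le> l"
      then have "cnorm A (X k \<ominus> X l) \<le> D * q ^ N"
        using bound[of N k l] bound[of N l k] norm_sub_commute[OF X X, of k l]
        by (cases "k \<le> l") auto
      then show "cnorm A (X k \<ominus> X l) < e" using N by simp
    qed
  qed
qed

text \<open>The partial sums of the Neumann series arise by iterating the contraction
  \<open>y \<mapsto> \<one> \<oplus> x \<otimes> y\<close>, and the limit is its fixed point. A
  one-sided inverse is enough: the resolvent estimates use only the right side, and in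
  \<open>rep_norm_le\<close> self-adjointness supplies the left side.\<close>

lemma Neumann_right_inverse:
  assumes x: "x \<in> carr A" and less: "cnorm A x < 1"
  shows "\<exists>y\<in>carr A. (\<one> \<ominus> x) \<otimes> y = \<one>"
proof -
  define Y where "Y = rec_nat \<one> (\<lambda>_ y. \<one> \<oplus> x \<otimes> y)"
  have Y0: "Y 0 = \<one>" and YS: "Y (Suc k) = \<one> \<oplus> x \<otimes> Y k" for k by (simp_all add: Y_def)
  have Y: "Y k \<in> carr A" for k by (induction k) (simp_all add: Y0 YS x)
  have diff: "Y (Suc k) \<ominus> (\<one> \<oplus> x \<otimes> z) = x \<otimes> (Y k \<ominus> z)" if "z \<in> carr A" for k z
    using that x Y by (simp add: YS add_sub_add_left mult_sub_right)
  have step: "cnorm A (Y (Suc k) \<ominus> Y k) \<le> cnorm A (Y 1 \<ominus> Y 0) * cnorm A x ^ k" for k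
  proof (induction k)
    case (Suc k)
    have "cnorm A (Y (Suc (Suc k)) \<ominus> Y (Suc k)) = cnorm A (x \<otimes> (Y (Suc k) \<ominus> Y k))"
      using diff[of "Y k" "Suc k"] Y by (simp add: YS[of k])
    also have "\<dots> \<le> cnorm A x * cnorm A (Y (Suc k) \<ominus> Y k)"
      using x Y by (intro norm_mult_le) auto
    also have "\<dots> \<le> cnorm A x * (cnorm A (Y 1 \<ominus> Y 0) * cnorm A x ^ k)"
      using Suc norm_nonneg[OF x] by (intro mult_left_mono)
    finally show ?case by (simp add: mult_ac)
  qed simp
  obtain l where l: "l \<in> carr A" "cconverges A Y l"
    using geometric_convergence[OF Y norm_nonneg[OF x] less step] by blast
  then have lim: "(\<lambda>k. cnorm A (Y k \<ominus> l)) \<longlonglongrightarrow> 0" by (simp add: cconverges_def)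
  have "cnorm A (l \<ominus> (\<one> \<oplus> x \<otimes> l)) \<le> cnorm A (Y (Suc k) \<ominus> l) + cnorm A x * cnorm A (Y k \<ominus> l)" for k
  proof -
    have "cnorm A (l \<ominus> (\<one> \<oplus> x \<otimes> l))
        \<le> cnorm A (l \<ominus> Y (Suc k)) + cnorm A (Y (Suc k) \<ominus> (\<one> \<oplus> x \<otimes> l))"
      by (rule norm_sub_triangle) (simp_all add: l Y x)
    also have "cnorm A (Y (Suc k) \<ominus> (\<one> \<oplus> x \<otimes> l)) \<le> cnorm A x * cnorm A (Y k \<ominus> l)"
      using norm_mult_le[of x "Y k \<ominus> l"] by (simp add: diff l x Y)
    finally show ?thesis by (simp add: norm_sub_commute l Y)
  qed
  moreover have "(\<lambda>k. cnorm A (Y (Suc k) \<ominus> l) + cnorm A x * cnorm A (Y k \<ominus> l))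
      \<longlonglongrightarrow> 0 + cnorm A x * 0"
    by (intro tendsto_intros lim LIMSEQ_Suc[OF lim])
  ultimately have "cnorm A (l \<ominus> (\<one> \<oplus> x \<otimes> l)) \<le> 0 + cnorm A x * 0"
    by (intro LIMSEQ_le_const) auto
  then have "cnorm A (l \<ominus> (\<one> \<oplus> x \<otimes> l)) = 0"
    using norm_nonneg[of "l \<ominus> (\<one> \<oplus> x \<otimes> l)"] l x by simp
  then have "l \<ominus> (\<one> \<oplus> x \<otimes> l) = \<zero>" using l x by (simp add: norm_eq_zero)
  then have eq: "l = \<one> \<oplus> x \<otimes> l" by (intro sub_eq_zero[of l "\<one> \<oplus> x \<otimes> l"] closed l x)
  have "(\<one> \<ominus> x) \<otimes> l = l \<ominus> x \<otimes> l" using l x by (simp add: mult_sub_left)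
  also have "\<dots> = (\<one> \<oplus> x \<otimes> l) \<ominus> x \<otimes> l"
    by (rule arg_cong[OF eq, of "\<lambda>u. u \<ominus> x \<otimes> l"])
  also have "\<dots> = \<one>" using l x by (simp add: add_sub_cancel_right)
  finally show ?thesis using l by blast
qed

text \<open>The Cayley transform \<open>z\<^sup>* z\<^sup>-\<^sup>1\<close> is an isometry, which bounds the inverse of \<open>z\<close>.\<close>

lemma norm_Cayley_inverse:
  assumes z: "z \<in> carr A" and w: "w \<in> carr A" and star: "cstar A z = z \<oplus> c \<odot> \<one>"
    and zw: "z \<otimes> w = \<one>"
  shows "cmod c * cnorm A w \<le> 2"
proof -
  define u where "u = cstar A z \<otimes> w"
  have u: "u \<in> carr A" by (simp add: u_def z w)
  have comm: "z \<otimes> cstar A z = cstar A z \<otimes> z"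
    using z by (simp add: star mult_add_left mult_add_right mult_scale_left mult_scale_right)
  have "cstar A u \<otimes> u = cstar A w \<otimes> ((z \<otimes> cstar A z) \<otimes> w)"
    using z w by (simp add: u_def star_mult star_star mult_assoc)
  also have "\<dots> = cstar A (z \<otimes> w) \<otimes> (z \<otimes> w)"
    unfolding comm using z w by (simp add: star_mult mult_assoc)
  also have "\<dots> = \<one>" by (simp add: zw)
  finally have "(cnorm A u)\<^sup>2 \<le> 1\<^sup>2" using cstar_identity[OF u] norm_one_le by simp
  then have nu: "cnorm A u \<le> 1" by (rule power2_le_imp_le) simp
  have "u = \<one> \<oplus> c \<odot> w"
    using z w zw by (simp add: u_def star mult_add_left mult_scale_left)
  then have "c \<odot> w = u \<ominus> \<one>" using w by (simp add: add_sub_cancel)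
  then have "cmod c * cnorm A w = cnorm A (u \<ominus> \<one>)" using norm_scale[OF w, of c] by simp
  also have "\<dots> \<le> 1 + 1" using norm_sub_le[OF u one_closed] nu norm_one_le by linarith
  finally show ?thesis by simp
qed

text \<open>For \<open>z = x + \<i>t\<close> the adjoint is \<open>z - 2\<i>t\<close>, so the Cayley
  estimate applies with a constant of modulus \<open>2 * t\<close>.\<close>

lemma norm_resolvent:
  assumes x: "x \<in> carr A" "cstar A x = x" and w: "w \<in> carr A"
    and t: "t > 0" and inv: "(x \<oplus> (\<i> * of_real t) \<odot> \<one>) \<otimes> w = \<one>"
  shows "cnorm A w \<le> 1 / t"
proof -
  let ?z = "x \<oplus> (\<i> * of_real t) \<odot> \<one>"
  have "cstar A ?z = x \<oplus> (- (\<i> * of_real t)) \<odot> \<one>" using x by (simp add: star_add star_scale)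
  also have "- (\<i> * of_real t) = \<i> * of_real t + - (2 * \<i> * of_real t)" by simp
  also have "x \<oplus> (\<i> * of_real t + - (2 * \<i> * of_real t)) \<odot> \<one> = ?z \<oplus> (- (2 * \<i> * of_real t)) \<odot> \<one>"
    using x by (simp only: scale_add_left[OF one_closed] add_assoc closed)
  finally have "cmod (- (2 * \<i> * of_real t)) * cnorm A w \<le> 2"
    by (intro norm_Cayley_inverse[OF _ w _ inv]) (use x in simp_all)
  then show ?thesis using t by (simp add: norm_mult field_simps)
qed

text \<open>Invertibility of \<open>x + \<i>t\<close> is clear for large \<open>t\<close>, and by the bound \<open>1 / t\<close> on the inverse it passes
  from \<open>t\<close> to every smaller \<open>t' > t / 2\<close>.\<close>

lemma resolvent_exists:
  assumes x: "x \<in> carr A" "cstar A x = x"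
  shows "\<exists>w\<in>carr A. (x \<oplus> \<i> \<odot> \<one>) \<otimes> w = \<one>"
proof -
  define P where "P t \<longleftrightarrow> (\<exists>w\<in>carr A. (x \<oplus> (\<i> * of_real t) \<odot> \<one>) \<otimes> w = \<one>)" for t :: real
  have large: "P t" if t: "cnorm A x < t" for t
  proof -
    have t0: "t > 0" using t norm_nonneg[OF x(1)] by linarith
    \<comment> \<open>Since \<open>?c * ?d = - 1\<close>, the element to be inverted is
      \<open>?c\<close> times \<open>\<one> \<ominus> ?d \<odot> x\<close>, a Neumann case.\<close>
    let ?c = "\<i> * of_real t" and ?d = "\<i> / of_real t"
    have cd: "?c * ?d = - 1" using t0 by simp
    have "cnorm A (?d \<odot> x) < 1" using t t0 by (simp add: norm_scale x norm_divide)
    then obtain y where y: "y \<in> carr A" "(\<one> \<ominus> ?d \<odot> x) \<otimes> y = \<one>"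
      using Neumann_right_inverse[of "?d \<odot> x"] x by auto
    have "?c \<odot> (\<one> \<ominus> ?d \<odot> x) = ?c \<odot> \<one> \<oplus> (?c * (- 1 * ?d)) \<odot> x"
      using x by (simp only: csub_def scale_add_right scale_scale closed)
    also have "?c * (- 1 * ?d) = 1" using cd by simp
    also have "?c \<odot> \<one> \<oplus> 1 \<odot> x = x \<oplus> ?c \<odot> \<one>" using x by (simp add: scale_one add_commute)
    finally have "(x \<oplus> ?c \<odot> \<one>) \<otimes> (inverse ?c \<odot> y) = (?c \<odot> (\<one> \<ominus> ?d \<odot> x)) \<otimes> (inverse ?c \<odot> y)" by simp
    also have "\<dots> = (inverse ?c * ?c) \<odot> \<one>"
      using x y by (simp only: mult_scale_left mult_scale_right closed scale_scale)
    also have "inverse ?c * ?c = 1" by (rule left_inverse) (use t0 in simp)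
    also have "1 \<odot> \<one> = \<one>" by (simp add: scale_one)
    finally show ?thesis unfolding P_def using y by (intro bexI[of _ "inverse ?c \<odot> y"]) auto
  qed
  have descend: "P t'" if P: "P t" and t: "0 < t'" "t' \<le> t" "t < 2 * t'" for t t'
  proof -
    obtain w where w: "w \<in> carr A" "(x \<oplus> (\<i> * of_real t) \<odot> \<one>) \<otimes> w = \<one>"
      using P by (auto simp: P_def)
    \<comment> \<open>Because \<open>?z \<otimes> w = \<one>\<close>, the new element is
      \<open>?z \<otimes> (\<one> \<ominus> ?d \<odot> w)\<close>. The second factor is a Neumann
      case, as the resolvent bound gives \<open>?d \<odot> w\<close> norm at most
      \<open>(t - t') / t\<close>.\<close>
    let ?z = "x \<oplus> (\<i> * of_real t) \<odot> \<one>" and ?d = "\<i> * of_real (t - t')"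
    have "cmod ?d = t - t'" using t by (simp only: norm_mult norm_of_real) simp
    then have "cmod ?d * cnorm A w \<le> (t - t') * (1 / t)"
      using t norm_resolvent[OF x w(1) _ w(2)]
      by (intro mult_mono) (auto simp: norm_nonneg w)
    also have "\<dots> < 1" using t by (simp add: field_simps)
    finally have "cnorm A (?d \<odot> w) < 1" by (simp add: norm_scale w)
    then obtain y where y: "y \<in> carr A" "(\<one> \<ominus> ?d \<odot> w) \<otimes> y = \<one>"
      using Neumann_right_inverse[of "?d \<odot> w"] w by auto
    have "?z \<otimes> (\<one> \<ominus> ?d \<odot> w) = ?z \<ominus> ?d \<odot> \<one>"
      using x w by (simp add: mult_sub_right mult_scale_right)
    also have "\<dots> = x \<oplus> (\<i> * of_real t + - 1 * ?d) \<odot> \<one>"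
      using x by (simp only: csub_def scale_scale closed add_assoc scale_add_left)
    also have "\<i> * of_real t + - 1 * ?d = \<i> * of_real t'" by (simp add: algebra_simps)
    finally have "(x \<oplus> (\<i> * of_real t') \<odot> \<one>) \<otimes> (y \<otimes> w) = ((?z \<otimes> (\<one> \<ominus> ?d \<odot> w)) \<otimes> y) \<otimes> w"
      using x w y by (simp add: mult_assoc)
    also have "\<dots> = (?z \<otimes> ((\<one> \<ominus> ?d \<odot> w) \<otimes> y)) \<otimes> w"
      using x w y by (simp only: mult_assoc closed)
    also have "\<dots> = \<one>" using x w y by simp
    finally show ?thesis unfolding P_def using w y by (intro bexI[of _ "y \<otimes> w"]) auto
  qed
  \<comment> \<open>The ratio \<open>3/2\<close> lies below the factor 2 that \<open>descend\<close>
    permits, so finitely many steps lead from a parameter above the norm of \<open>x\<close> down to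
    \<open>t = 1\<close>.\<close>
  obtain k where k: "cnorm A x < (3/2) ^ k" using real_arch_pow[of "3/2 :: real"] by auto
  have "P ((3/2) ^ (k - j))" if "j \<le> k" for j
    using that
  proof (induction j)
    case 0
    then show ?case using large[OF k] by simp
  next
    case (Suc j)
    then have eq: "k - j = Suc (k - Suc j)" by simp
    have "P ((3/2) * (3/2) ^ (k - Suc j))" using Suc unfolding eq by simp
    then show ?case by (rule descend) simp_all
  qed
  from this[of k] show ?thesis by (simp add: P_def)
qed

end

section \<open>Representations\<close>

lemma cone_bounded_operators:
  "cone (bounded_operators :: ('h::complex_hilbert_space \<Rightarrow>\<^sub>L 'h) star_algebra) = id_blinfun"
  unfolding cone_def
proof (rule the_equality)
  show "is_one (bounded_operators :: ('h \<Rightarrow>\<^sub>L 'h) star_algebra) id_blinfun"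
    by (auto simp: is_one_def bounded_operators_def operator_algebra_def intro: blinfun_eqI)
next
  fix e :: "'h \<Rightarrow>\<^sub>L 'h"
  assume "is_one bounded_operators e"
  then have "e o\<^sub>L id_blinfun = id_blinfun"
    by (auto simp: is_one_def bounded_operators_def operator_algebra_def)
  then have "(e o\<^sub>L id_blinfun) h = id_blinfun h" for h by simp
  then show "e = id_blinfun" by (intro blinfun_eqI) simp
qed

locale representation = unital_cstar A for A :: "'a star_algebra" +
  fixes \<pi> :: "'a \<Rightarrow> ('h::complex_hilbert_space \<Rightarrow>\<^sub>L 'h)"
  assumes hom: "unital_star_hom A bounded_operators \<pi>"
begin

lemma rep_linear [simp]: "x \<in> carr A \<Longrightarrow> complex_linear (\<pi> x)"
  and rep_add: "x \<in> carr A \<Longrightarrow> y \<in> carr A \<Longrightarrow> \<pi> (x \<oplus> y) = \<pi> x + \<pi> y"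
  and rep_scale: "x \<in> carr A \<Longrightarrow> \<pi> (c \<odot> x) = op_scale c (\<pi> x)"
  and rep_mult: "x \<in> carr A \<Longrightarrow> y \<in> carr A \<Longrightarrow> \<pi> (x \<otimes> y) = \<pi> x o\<^sub>L \<pi> y"
  and rep_star: "x \<in> carr A \<Longrightarrow> \<pi> (cstar A x) = adj (\<pi> x)"
  and rep_one: "\<pi> \<one> = id_blinfun"
  using hom unfolding unital_star_hom_def star_hom_def cone_bounded_operators
  by (auto simp: bounded_operators_def operator_algebra_def adjoint_op_eq_adj)

lemma rep_sub:
  assumes "x \<in> carr A" "y \<in> carr A"
  shows "\<pi> (x \<ominus> y) = \<pi> x - \<pi> y"
  using assms
  by (intro blinfun_eqI)
     (simp add: csub_def rep_add rep_scale blinfun.add_left blinfun.diff_left scaleC.minus_left)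

lemma rep_zero: "\<pi> \<zero> = 0"
  using rep_sub[of \<zero> \<zero>] by (simp add: sub_self)

text \<open>On a vector where \<open>X = \<pi> x\<close> nearly attains its norm \<open>s\<close>, the operator \<open>1 - X\<^sup>*X / s\<^sup>2\<close> is nearly \<open>0\<close>,
  so it is not invertible; hence \<open>\<parallel>x\<parallel> \<ge> s\<close> by the Neumann series.\<close>

lemma rep_norm_le:
  assumes x: "x \<in> carr A"
  shows "norm (\<pi> x) \<le> cnorm A x"
proof (rule ccontr)
  define s where "s = norm (\<pi> x)"
  define X where "X = \<pi> x"
  assume "\<not> norm (\<pi> x) \<le> cnorm A x"
  then have less: "cnorm A x < s" by (simp add: s_def)
  then have s: "s > 0" using norm_nonneg[OF x] by linarith
  \<comment> \<open>Scaled by the norm of the image: \<open>v\<close> itself has norm below 1, while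
    its image would have norm exactly 1.\<close>
  define v where "v = of_real (inverse (s\<^sup>2)) \<odot> (cstar A x \<otimes> x)"
  have v: "v \<in> carr A" by (simp add: v_def x)
  have "cnorm A v = (cnorm A x)\<^sup>2 / s\<^sup>2"
    using s x by (simp add: v_def norm_scale cstar_identity norm_inverse norm_power divide_inverse mult.commute)
  also have "\<dots> < 1" using less s norm_nonneg[OF x] by (simp add: power_strict_mono)
  finally obtain y where y: "y \<in> carr A" "(\<one> \<ominus> v) \<otimes> y = \<one>"
    using Neumann_right_inverse[OF v] by blast
  define V where "V = id_blinfun - inverse (s\<^sup>2) *\<^sub>R (adj X o\<^sub>L X)"
  have X: "complex_linear X" using x by (simp add: X_def)
  have piv: "\<pi> (\<one> \<ominus> v) = V"
    using x by (intro blinfun_eqI) (simp add: V_def v_def rep_sub rep_one rep_scale rep_mult rep_star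
      X_def blinfun.diff_left blinfun.scaleR_left scaleC_of_real del: of_real_inverse)
  have V: "complex_linear V" "adj V = V"
  proof -
    show "complex_linear V" by (simp add: V_def X)
    have "cstar A (\<one> \<ominus> v) = \<one> \<ominus> v"
      using x by (simp add: star_sub v_def star_scale star_mult star_star)
    then show "adj V = V" using piv rep_star[of "\<one> \<ominus> v"] v by simp
  qed
  have Vy: "V o\<^sub>L \<pi> y = id_blinfun" using arg_cong[OF y(2), of \<pi>] v y(1) by (simp add: rep_mult piv rep_one)
  \<comment> \<open>\<open>V\<close> is self-adjoint, so the adjoint of a right inverse is a left
    inverse; hence \<open>V\<close> is bounded below.\<close>
  have "adj (\<pi> y) o\<^sub>L V = adj (V o\<^sub>L \<pi> y)"
    using adj_compose[OF V(1) rep_linear[OF y(1)]] V(2) by simp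
  then have "adj (\<pi> y) o\<^sub>L V = id_blinfun" by (simp add: Vy)
  then have inv: "adj (\<pi> y) (V h) = h" for h
    by (metis blinfun_apply_blinfun_compose id_blinfun.rep_eq id_apply)
  \<comment> \<open>\<open>K\<close> bounds the square of the norm of the left inverse. The added 1
    gives \<open>K \<ge> 1\<close>, so that \<open>1 - 1 / K\<close> has a square root.\<close>
  define K where "K = (norm (adj (\<pi> y)))\<^sup>2 + 1"
  have K: "K \<ge> 1" by (simp add: K_def)
  have Vh: "(norm (V h))\<^sup>2 \<le> (norm h)\<^sup>2 - (norm (X h))\<^sup>2 / s\<^sup>2" for h
  proof -
    have "(norm (adj X (X h)))\<^sup>2 \<le> (s * norm (X h))\<^sup>2"
      using norm_blinfun[of "adj X" "X h"] unfolding norm_adj[OF X]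
      by (intro power_mono) (simp_all add: s_def X_def)
    then have "(norm (adj X (X h)))\<^sup>2 / (s\<^sup>2 * s\<^sup>2) \<le> (s * norm (X h))\<^sup>2 / (s\<^sup>2 * s\<^sup>2)"
      by (intro divide_right_mono) simp_all
    also have "\<dots> = (norm (X h))\<^sup>2 / s\<^sup>2"
      unfolding power_mult_distrib by (rule nonzero_mult_divide_mult_cancel_left) (use s in simp)
    finally have le: "(norm (adj X (X h)))\<^sup>2 / (s\<^sup>2 * s\<^sup>2) \<le> (norm (X h))\<^sup>2 / s\<^sup>2" .
    define b where "b = - inverse (s\<^sup>2)"
    have "V h = h + b *\<^sub>R adj X (X h)"
      by (simp add: V_def b_def blinfun.diff_left blinfun.scaleR_left)
    moreover have "cinner h (adj X (X h)) = of_real ((norm (X h))\<^sup>2)"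
      by (simp only: cinner_adj_right[OF X] cinner_self)
    ultimately have "(norm (V h))\<^sup>2
        = (norm h)\<^sup>2 + b\<^sup>2 * (norm (adj X (X h)))\<^sup>2 + 2 * b * (norm (X h))\<^sup>2"
      by (simp add: norm_add_square cinner.scaleR_right power_mult_distrib del: of_real_power)
    also have "\<dots> = (norm h)\<^sup>2 + (norm (adj X (X h)))\<^sup>2 / (s\<^sup>2 * s\<^sup>2) - 2 * ((norm (X h))\<^sup>2 / s\<^sup>2)"
    proof -
      have "b\<^sup>2 = 1 / (s\<^sup>2 * s\<^sup>2)" by (simp add: b_def power2_eq_square divide_inverse)
      moreover have "b = - (1 / s\<^sup>2)" by (simp add: b_def divide_inverse)
      ultimately show ?thesis by simp
    qed
    finally have "(norm (V h))\<^sup>2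
        = (norm h)\<^sup>2 + (norm (adj X (X h)))\<^sup>2 / (s\<^sup>2 * s\<^sup>2) - 2 * ((norm (X h))\<^sup>2 / s\<^sup>2)" .
    with le show ?thesis by simp
  qed
  \<comment> \<open>No near-extremal vector has to be chosen: as \<open>V\<close> is bounded below,
    the estimate \<open>Vh\<close> keeps all \<open>X h\<close> uniformly below
    \<open>s * norm h\<close>, which is absurd because \<open>s\<close> is the norm of
    \<open>X\<close>.\<close>
  have "norm X \<le> s * sqrt (1 - 1 / K)"
  proof (rule norm_blinfun_bound)
    fix h
    have "(norm h)\<^sup>2 \<le> (norm (adj (\<pi> y)) * norm (V h))\<^sup>2"
      using norm_blinfun[of "adj (\<pi> y)" "V h"] by (intro power_mono) (simp_all add: inv)
    also have "\<dots> \<le> K * (norm (V h))\<^sup>2"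
      unfolding power_mult_distrib by (intro mult_right_mono) (simp_all add: K_def)
    also have "\<dots> \<le> K * ((norm h)\<^sup>2 - (norm (X h))\<^sup>2 / s\<^sup>2)"
      using K by (intro mult_left_mono Vh) simp
    finally have "(norm (X h))\<^sup>2 \<le> s\<^sup>2 * (1 - 1 / K) * (norm h)\<^sup>2"
      using K s by (simp add: field_simps)
    also have "\<dots> = (s * sqrt (1 - 1 / K) * norm h)\<^sup>2"
      using K by (simp add: power_mult_distrib)
    finally show "norm (X h) \<le> s * sqrt (1 - 1 / K) * norm h"
      by (rule power2_le_imp_le) (use K s in simp)
  qed (use K s in simp)
  also have "\<dots> < s * 1" using K s by (intro mult_strict_left_mono) (simp_all add: real_sqrt_lt_1_iff)
  finally show False by (simp add: s_def X_def)
qed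

section \<open>Closedness of the image of an ideal\<close>

lemma rep_tendsto:
  assumes "\<And>k. X k \<in> carr A" "l \<in> carr A" "cconverges A X l"
  shows "(\<lambda>k. \<pi> (X k)) \<longlonglongrightarrow> \<pi> l"
proof -
  have "norm (\<pi> (X k) - \<pi> l) \<le> cnorm A (X k \<ominus> l)" for k
    using rep_norm_le[of "X k \<ominus> l"] assms by (simp add: rep_sub)
  then have "(\<lambda>k. \<pi> (X k) - \<pi> l) \<longlonglongrightarrow> 0"
    using assms(3) unfolding cconverges_def by (rule Lim_null_comparison[OF always_eventually[rule_format]])
  then show ?thesis by (rule LIM_zero_cancel)
qed

text \<open>For \<open>w = (x + \<i>)\<^sup>-\<^sup>1\<close> one has \<open>\<i> x w = \<i> + w\<close> and \<open>x - \<i> x w = x\<^sup>2 w\<close>.\<close>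

lemma self_adjoint_lift:
  assumes J: "closed_ideal A J" and x: "x \<in> J" "cstar A x = x"
  shows "\<exists>x'\<in>J. cnorm A x' \<le> 2 \<and> norm (\<pi> x - \<pi> x') \<le> (norm (\<pi> x))\<^sup>2"
proof -
  have xA: "x \<in> carr A" using J x by (auto simp: closed_ideal_def)
  obtain w where w: "w \<in> carr A" "(x \<oplus> \<i> \<odot> \<one>) \<otimes> w = \<one>"
    using resolvent_exists[OF xA x(2)] by blast
  have nw: "cnorm A w \<le> 1" using norm_resolvent[OF xA x(2) w(1), of 1] w(2) by simp
  have sum: "x \<otimes> w \<oplus> \<i> \<odot> w = \<one>" using w xA by (simp add: mult_add_left mult_scale_left)
  then have "x \<otimes> w = \<one> \<ominus> \<i> \<odot> w" using w xA add_sub_cancel_right[of "x \<otimes> w" "\<i> \<odot> w"] by simp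
  then have "cnorm A (x \<otimes> w) \<le> 2"
    using norm_sub_le[of \<one> "\<i> \<odot> w"] norm_one_le nw w by (simp add: norm_scale)
  then have 1: "cnorm A (\<i> \<odot> (x \<otimes> w)) \<le> 2" using w xA by (simp add: norm_scale)
  have eq: "\<pi> x (\<pi> w h) + \<i> *\<^sub>C \<pi> w h = h" for h
    using arg_cong[OF sum, of "\<lambda>y. blinfun_apply (\<pi> y) h"] w xA
    by (simp add: rep_add rep_mult rep_scale rep_one blinfun.add_left)
  have "\<pi> x - \<pi> (\<i> \<odot> (x \<otimes> w)) = \<pi> x o\<^sub>L (\<pi> x o\<^sub>L \<pi> w)"
  proof (rule blinfun_eqI)
    fix h
    have "\<pi> x h = \<pi> x (\<pi> x (\<pi> w h) + \<i> *\<^sub>C \<pi> w h)" by (simp only: eq)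
    also have "\<dots> = \<pi> x (\<pi> x (\<pi> w h)) + \<i> *\<^sub>C \<pi> x (\<pi> w h)"
      using xA by (simp add: blinfun.add_right complex_linearD)
    finally show "(\<pi> x - \<pi> (\<i> \<odot> (x \<otimes> w))) h = (\<pi> x o\<^sub>L (\<pi> x o\<^sub>L \<pi> w)) h"
      using w xA by (simp add: rep_scale rep_mult blinfun.diff_left)
  qed
  also have "norm \<dots> \<le> norm (\<pi> x) * (norm (\<pi> x) * norm (\<pi> w))"
    by (intro order_trans[OF norm_blinfun_compose] mult_left_mono norm_blinfun_compose) simp
  also have "\<dots> \<le> norm (\<pi> x) * (norm (\<pi> x) * 1)"
    using rep_norm_le[OF w(1)] nw by (intro mult_left_mono) simp_all
  finally have "norm (\<pi> x - \<pi> (\<i> \<odot> (x \<otimes> w))) \<le> (norm (\<pi> x))\<^sup>2" by (simp add: power2_eq_square)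
  moreover have "\<i> \<odot> (x \<otimes> w) \<in> J" using J x w by (simp add: closed_ideal_def)
  ultimately show ?thesis using 1 by blast
qed

lemma approximate_lift:
  assumes J: "closed_ideal A J" and star: "\<And>x. x \<in> J \<Longrightarrow> cstar A x \<in> J"
    and x: "x \<in> J" and r: "r > 0" "norm (\<pi> x) \<le> r"
  shows "\<exists>x'\<in>J. cnorm A x' \<le> 16 * r \<and> norm (\<pi> x - \<pi> x') \<le> r / 2"
proof -
  have sub: "y \<in> J \<Longrightarrow> y \<in> carr A" for y using J by (auto simp: closed_ideal_def)
  have Jadd: "y \<in> J \<Longrightarrow> z \<in> J \<Longrightarrow> y \<oplus> z \<in> J" and Jscale: "y \<in> J \<Longrightarrow> c \<odot> y \<in> J" for y z c
    using J by (auto simp: closed_ideal_def)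
  have lift: "\<exists>y'\<in>J. cnorm A y' \<le> 2 \<and> norm (\<pi> y - \<pi> y') \<le> 1 / 16"
    if y: "y \<in> J" "cstar A y = y" "norm (\<pi> y) \<le> 1 / 4" for y
  proof -
    have "(norm (\<pi> y))\<^sup>2 \<le> (1 / 4)\<^sup>2" using y(3) by (intro power_mono) auto
    then show ?thesis using self_adjoint_lift[OF J y(1,2)] by (force simp: power2_eq_square)
  qed
  \<comment> \<open>\<open>a\<close> and \<open>b\<close> are the real and imaginary part of
    \<open>x\<close> up to scale. The factor \<open>1 / (8 * r)\<close> brings their images, a
    priori of norm \<open>2 * r\<close>, down to \<open>1 / 4\<close>, where the quadratic error of
    \<open>self_adjoint_lift\<close> is at most \<open>1 / 16\<close>.\<close>
  define e :: complex where "e = of_real (inverse (8 * r))"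
  define a where "a = e \<odot> (x \<oplus> cstar A x)"
  define b where "b = (- \<i> * e) \<odot> (x \<ominus> cstar A x)"
  have xA: "x \<in> carr A" by (rule sub[OF x])
  have e: "cnj e = e" "cmod e = inverse (8 * r)"
    using r unfolding e_def by (simp, simp only: norm_of_real) simp
  have aJ: "a \<in> J" and bJ: "b \<in> J"
    using x star by (auto simp: a_def b_def csub_def intro!: Jadd Jscale)
  have a_star: "cstar A a = a"
    using xA by (simp add: a_def star_scale star_add star_star e add_commute)
  have b_star: "cstar A b = b"
  proof -
    have "cstar A b = (\<i> * e) \<odot> (cstar A x \<ominus> x)"
      using xA by (simp add: b_def star_scale star_sub star_star e)
    also have "\<dots> = (\<i> * e) \<odot> ((- 1) \<odot> (x \<ominus> cstar A x))"
      using xA by (simp add: csub_def scale_add_right scale_scale scale_one add_commute)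
    also have "\<dots> = b" using xA by (simp add: b_def scale_scale)
    finally show ?thesis .
  qed
  have n: "norm (\<pi> x + adj (\<pi> x)) \<le> 2 * r" "norm (\<pi> x - adj (\<pi> x)) \<le> 2 * r"
    using norm_triangle_ineq[of "\<pi> x" "adj (\<pi> x)"] norm_triangle_ineq4[of "\<pi> x" "adj (\<pi> x)"]
      norm_adj[OF rep_linear[OF xA]] r by linarith+
  have e_bound: "cmod e * t \<le> 1 / 4" if "t \<le> 2 * r" for t
    using that r by (simp add: e field_simps)
  have a_norm: "norm (\<pi> a) \<le> 1 / 4"
    using xA e_bound[OF n(1)] by (simp add: a_def rep_scale rep_add rep_star norm_op_scale)
  have b_norm: "norm (\<pi> b) \<le> 1 / 4"
    using xA e_bound[OF n(2)] by (simp add: b_def rep_scale rep_sub rep_star norm_op_scale norm_mult)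
  obtain a' where a': "a' \<in> J" "cnorm A a' \<le> 2" "norm (\<pi> a - \<pi> a') \<le> 1 / 16"
    using lift[OF aJ a_star a_norm] by blast
  obtain b' where b': "b' \<in> J" "cnorm A b' \<le> 2" "norm (\<pi> b - \<pi> b') \<le> 1 / 16"
    using lift[OF bJ b_star b_norm] by blast
  \<comment> \<open>Undoes the scaling: \<open>2 * d * e = 1\<close>, so \<open>x\<close> is
    \<open>d\<close> times \<open>a \<oplus> \<i> \<odot> b\<close>. The norm becomes at most
    \<open>4 * r * (2 + 2)\<close> and the error at most
    \<open>4 * r * (1 / 16 + 1 / 16)\<close>.\<close>
  define d :: complex where "d = of_real (4 * r)"
  have d: "cmod d = 4 * r" using r unfolding d_def by (simp only: norm_of_real)
  have de: "d * e = 1 / 2" using r unfolding d_def e_def of_real_mult[symmetric] by simp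
  define x' where "x' = d \<odot> (a' \<oplus> \<i> \<odot> b')"
  have x'J: "x' \<in> J" unfolding x'_def by (intro Jadd Jscale a' b')
  have "cnorm A x' = 4 * r * cnorm A (a' \<oplus> \<i> \<odot> b')"
    using a' b' sub by (simp add: x'_def norm_scale d)
  also have "\<dots> \<le> 4 * r * 4"
    using norm_triangle[of a' "\<i> \<odot> b'"] a' b' sub r by (intro mult_left_mono) (auto simp: norm_scale)
  finally have 1: "cnorm A x' \<le> 16 * r" by simp
  have pix: "\<pi> x = op_scale d (\<pi> a + op_scale \<i> (\<pi> b))"
  proof (rule blinfun_eqI)
    fix h
    have "op_scale d (\<pi> a + op_scale \<i> (\<pi> b)) h
        = (d * e) *\<^sub>C (\<pi> x h + adj (\<pi> x) h) + (d * e) *\<^sub>C (\<pi> x h - adj (\<pi> x) h)"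
      using xA by (simp add: a_def b_def rep_scale rep_add rep_sub rep_star blinfun.add_left
          blinfun.diff_left scaleC_add_right scaleC_scaleC mult_ac)
    also have "\<dots> = (1 / 2 + 1 / 2) *\<^sub>C \<pi> x h"
      by (simp only: de scaleC_add_left scaleC_add_right scaleC.diff_right) simp
    finally show "\<pi> x h = op_scale d (\<pi> a + op_scale \<i> (\<pi> b)) h" by simp
  qed
  have "\<pi> x - \<pi> x' = op_scale d ((\<pi> a - \<pi> a') + op_scale \<i> (\<pi> b - \<pi> b'))"
    unfolding pix using a' b' sub
    by (intro blinfun_eqI) (simp add: x'_def rep_scale rep_add blinfun.add_left blinfun.diff_left
        scaleC_add_right scaleC.diff_right)
  then have "norm (\<pi> x - \<pi> x') = 4 * r * norm ((\<pi> a - \<pi> a') + op_scale \<i> (\<pi> b - \<pi> b'))"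
    by (simp add: norm_op_scale d)
  also have "\<dots> \<le> 4 * r * (1 / 16 + 1 / 16)"
    using r a' b' by (intro mult_left_mono norm_triangle_mono) (simp_all add: norm_op_scale)
  finally have "norm (\<pi> x - \<pi> x') \<le> r / 2" by simp
  with 1 x'J show ?thesis by blast
qed

lemma closed_image_ideal:
  assumes J: "closed_ideal A J" and star: "\<And>x. x \<in> J \<Longrightarrow> cstar A x \<in> J"
  shows "closed (\<pi> ` J)"
proof -
  have sub: "y \<in> J \<Longrightarrow> y \<in> carr A" for y using J by (auto simp: closed_ideal_def)
  have Jadd: "y \<in> J \<Longrightarrow> z \<in> J \<Longrightarrow> y \<oplus> z \<in> J" and Jzero: "\<zero> \<in> J" for y z
    using J by (auto simp: closed_ideal_def)
  have "T \<in> \<pi> ` J" if T: "T \<in> closure (\<pi> ` J)" for T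
  proof -
    \<comment> \<open>\<open>T\<close> is only a limit of images, so it is first replaced by
      \<open>\<pi> y\<close> at a cost of \<open>r / 8\<close>. What remains to be lifted has norm
      at most \<open>9 / 8 * r\<close>; the lift has norm at most
      \<open>16 * (9 / 8 * r) = 18 * r\<close> and leaves \<open>9 / 16 * r\<close>. The total error
      \<open>11 / 16 * r\<close> is below \<open>3 / 4 * r\<close>.\<close>
    have step: "\<exists>x\<in>J. cnorm A x \<le> 18 * r \<and> norm (T - \<pi> (z \<oplus> x)) \<le> 3 / 4 * r"
      if z: "z \<in> J" and r: "r > 0" "norm (T - \<pi> z) \<le> r" for z r
    proof -
      obtain y where y: "y \<in> J" "norm (T - \<pi> y) < r / 8"
      proof -
        have "r / 8 > 0" using r(1) by simp
        then obtain S where "S \<in> \<pi> ` J" "dist S T < r / 8"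
          using T closure_approachable by blast
        then show ?thesis using that by (auto simp: dist_norm norm_minus_commute)
      qed
      let ?y = "y \<oplus> (- 1) \<odot> z"
      have yJ: "?y \<in> J" using J y z by (auto simp: closed_ideal_def)
      have piy: "\<pi> ?y = \<pi> y - \<pi> z" using y z sub rep_sub[of y z] by (simp add: csub_def)
      have "norm (\<pi> ?y) \<le> 9 / 8 * r"
        unfolding piy using norm_triangle_ineq[of "\<pi> y - T" "T - \<pi> z"] y r
        by (simp add: norm_minus_commute)
      then obtain x where x: "x \<in> J" "cnorm A x \<le> 16 * (9 / 8 * r)" "norm (\<pi> ?y - \<pi> x) \<le> 9 / 8 * r / 2"
        using approximate_lift[OF J star yJ, of "9 / 8 * r"] r by auto
      have "T - \<pi> (z \<oplus> x) = (T - \<pi> y) + (\<pi> ?y - \<pi> x)"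
        using x z sub by (simp add: rep_add piy)
      then have "norm (T - \<pi> (z \<oplus> x)) \<le> norm (T - \<pi> y) + norm (\<pi> ?y - \<pi> x)"
        by (simp only: norm_triangle_ineq)
      then show ?thesis using x y r by (intro bexI[of _ x]) auto
    qed
    define R where "R = norm T + 1"
    have R: "R > 0" by (simp add: R_def add_nonneg_pos)
    have "\<exists>Z. \<forall>k. (Z k \<in> J \<and> norm (T - \<pi> (Z k)) \<le> R * (3 / 4) ^ k) \<and>
        cnorm A (Z (Suc k) \<ominus> Z k) \<le> 18 * R * (3 / 4) ^ k"
    proof (rule dependent_nat_choice)
      show "\<exists>z. z \<in> J \<and> norm (T - \<pi> z) \<le> R * (3 / 4) ^ 0"
        using Jzero by (intro exI[of _ \<zero>]) (simp add: rep_zero R_def)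
    next
      fix z k assume z: "z \<in> J \<and> norm (T - \<pi> z) \<le> R * (3 / 4) ^ k"
      then obtain x where x: "x \<in> J" "cnorm A x \<le> 18 * (R * (3 / 4) ^ k)"
          "norm (T - \<pi> (z \<oplus> x)) \<le> 3 / 4 * (R * (3 / 4) ^ k)"
        using step[of z "R * (3 / 4) ^ k"] R by auto
      then show "\<exists>z'. (z' \<in> J \<and> norm (T - \<pi> z') \<le> R * (3 / 4) ^ Suc k) \<and>
          cnorm A (z' \<ominus> z) \<le> 18 * R * (3 / 4) ^ k"
        using z sub by (intro exI[of _ "z \<oplus> x"]) (simp add: Jadd add_sub_cancel mult_ac)
    qed
    then obtain Z where Z: "\<And>k. Z k \<in> J" "\<And>k. norm (T - \<pi> (Z k)) \<le> R * (3 / 4) ^ k"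
        "\<And>k. cnorm A (Z (Suc k) \<ominus> Z k) \<le> 18 * R * (3 / 4) ^ k" by blast
    obtain l where l: "l \<in> carr A" "cconverges A Z l"
      using geometric_convergence[OF sub[OF Z(1)] _ _ Z(3)] by auto
    then have "l \<in> J" using J Z(1) unfolding closed_ideal_def cclosed_def by blast
    moreover have "T = \<pi> l"
    proof (rule LIMSEQ_unique[OF _ rep_tendsto[OF sub[OF Z(1)] l]])
      have "(\<lambda>k. R * (3 / 4) ^ k) \<longlonglongrightarrow> R * 0" by (intro tendsto_intros LIMSEQ_realpow_zero) auto
      then have "(\<lambda>k. T - \<pi> (Z k)) \<longlonglongrightarrow> 0"
        by (intro Lim_null_comparison[OF always_eventually[rule_format, OF Z(2)]]) simp
      then have "(\<lambda>k. T - (T - \<pi> (Z k))) \<longlonglongrightarrow> T - 0" by (intro tendsto_intros)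
      then show "(\<lambda>k. \<pi> (Z k)) \<longlonglongrightarrow> T" by simp
    qed
    ultimately show ?thesis by blast
  qed
  then show ?thesis by (simp add: closure_subset_eq[symmetric] subsetI)
qed

end

section \<open>Convergence and generated closed ideals\<close>

context unital_cstar
begin

lemma zero_scale [simp]: "c \<odot> \<zero> = \<zero>"
  using scale_scale[of \<zero> c 0] scale_zero_left[of \<zero>] by simp

lemma mult_zero [simp]: "x \<in> carr A \<Longrightarrow> x \<otimes> \<zero> = \<zero>"
  using mult_scale_right[of x \<zero> 0] by (simp add: scale_zero_left)

lemma zero_mult [simp]: "x \<in> carr A \<Longrightarrow> \<zero> \<otimes> x = \<zero>"
  using mult_scale_left[of \<zero> x 0] by (simp add: scale_zero_left)

lemma star_zero [simp]: "cstar A \<zero> = \<zero>"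
  using star_scale[of \<zero> 0] by (simp add: scale_zero_left)

lemma cconverges_bound:
  assumes "cconverges A X l" and "\<And>k. cnorm A (Y k \<ominus> l') \<le> C * cnorm A (X k \<ominus> l)"
    and "\<And>k. Y k \<in> carr A" "l' \<in> carr A"
  shows "cconverges A Y l'"
  unfolding cconverges_def
proof (rule tendsto_sandwich[OF always_eventually always_eventually tendsto_const])
  show "\<forall>k. 0 \<le> cnorm A (Y k \<ominus> l')" using assms by (simp add: norm_nonneg)
  show "\<forall>k. cnorm A (Y k \<ominus> l') \<le> C * cnorm A (X k \<ominus> l)" using assms by blast
  show "(\<lambda>k. C * cnorm A (X k \<ominus> l)) \<longlonglongrightarrow> 0"
    using tendsto_mult_right_zero[OF assms(1)[unfolded cconverges_def]] .
qed

lemma cconverges_mult_left: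
  assumes "cconverges A X l" "\<And>k. X k \<in> carr A" "l \<in> carr A" "a \<in> carr A"
  shows "cconverges A (\<lambda>k. a \<otimes> X k) (a \<otimes> l)"
proof (rule cconverges_bound[OF assms(1)])
  show "cnorm A (a \<otimes> X k \<ominus> a \<otimes> l) \<le> cnorm A a * cnorm A (X k \<ominus> l)" for k
    using norm_mult_le[of a "X k \<ominus> l"] assms by (simp add: mult_sub_right)
qed (use assms in simp_all)

lemma cconverges_mult_right:
  assumes "cconverges A X l" "\<And>k. X k \<in> carr A" "l \<in> carr A" "a \<in> carr A"
  shows "cconverges A (\<lambda>k. X k \<otimes> a) (l \<otimes> a)"
proof (rule cconverges_bound[OF assms(1)])
  show "cnorm A (X k \<otimes> a \<ominus> l \<otimes> a) \<le> cnorm A a * cnorm A (X k \<ominus> l)" for k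
    using norm_mult_le[of "X k \<ominus> l" a] assms by (simp add: mult_sub_left mult.commute)
qed (use assms in simp_all)

lemma cconverges_star:
  assumes "cconverges A X l" "\<And>k. X k \<in> carr A" "l \<in> carr A"
  shows "cconverges A (\<lambda>k. cstar A (X k)) (cstar A l)"
proof (rule cconverges_bound[OF assms(1)])
  show "cnorm A (cstar A (X k) \<ominus> cstar A l) \<le> 1 * cnorm A (X k \<ominus> l)" for k
    using norm_star[of "X k \<ominus> l"] assms by (simp add: star_sub)
qed (use assms in simp_all)

lemma closed_ideal_generated_is_ideal:
  assumes "S \<subseteq> carr A"
  shows "closed_ideal A (closed_ideal_generated A S)"
proof -
  \<comment> \<open>The carrier is one of the ideals intersected, so the intersection is not over an
    empty family.\<close>
  have "closed_ideal A (carr A)" by (simp add: closed_ideal_def cclosed_def)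
  then have "closed_ideal_generated A S \<subseteq> carr A"
    using assms unfolding closed_ideal_generated_def by blast
  moreover have "cclosed A (closed_ideal_generated A S)"
    unfolding cclosed_def
  proof (intro allI impI, elim conjE)
    fix X l
    assume X: "\<forall>k. X k \<in> closed_ideal_generated A S" and l: "l \<in> carr A" "cconverges A X l"
    have "l \<in> I" if I: "closed_ideal A I" "S \<subseteq> I" for I
    proof -
      have "\<forall>k. X k \<in> I" using X I unfolding closed_ideal_generated_def by blast
      moreover have "cclosed A I" using I(1) by (simp add: closed_ideal_def)
      ultimately show ?thesis using l unfolding cclosed_def by blast
    qed
    then show "l \<in> closed_ideal_generated A S" unfolding closed_ideal_generated_def by blast
  qed
  ultimately show ?thesis
    unfolding closed_ideal_def[of A "closed_ideal_generated A S"]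
    unfolding closed_ideal_generated_def by (auto simp: closed_ideal_def)
qed

lemma closed_ideal_generated_minimal:
  "closed_ideal A I \<Longrightarrow> S \<subseteq> I \<Longrightarrow> closed_ideal_generated A S \<subseteq> I"
  by (auto simp: closed_ideal_generated_def)

text \<open>The elements whose adjoint lies in the generated ideal form a closed ideal containing
  \<open>S\<close>, so minimality applies. This bypasses the general theorem that closed ideals are
  self-adjoint.\<close>

lemma closed_ideal_generated_star:
  assumes S: "S \<subseteq> carr A" "\<And>x. x \<in> S \<Longrightarrow> cstar A x \<in> S" and x: "x \<in> closed_ideal_generated A S"
  shows "cstar A x \<in> closed_ideal_generated A S"
proof -
  let ?J = "closed_ideal_generated A S"
  have J: "closed_ideal A ?J" by (rule closed_ideal_generated_is_ideal[OF S(1)])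
  have S_sub: "S \<subseteq> ?J" by (auto simp: closed_ideal_generated_def)
  have "closed_ideal A {x \<in> carr A. cstar A x \<in> ?J}"
    unfolding closed_ideal_def
  proof (intro conjI ballI allI)
    show "cclosed A {x \<in> carr A. cstar A x \<in> ?J}"
      unfolding cclosed_def
    proof (intro allI impI)
      fix X l assume a: "(\<forall>k. X k \<in> {x \<in> carr A. cstar A x \<in> ?J}) \<and> l \<in> carr A \<and> cconverges A X l"
      then have "cconverges A (\<lambda>k. cstar A (X k)) (cstar A l)"
        by (intro cconverges_star) auto
      moreover have "\<forall>k. cstar A (X k) \<in> ?J" "cstar A l \<in> carr A" using a by simp_all
      moreover have "cclosed A ?J" using J by (simp add: closed_ideal_def)
      ultimately have "cstar A l \<in> ?J"
        unfolding cclosed_def by (elim allE[of _ "\<lambda>k. cstar A (X k)"] allE[of _ "cstar A l"]) simp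
      then show "l \<in> {x \<in> carr A. cstar A x \<in> ?J}" using a by simp
    qed
  qed (use J in \<open>auto simp: closed_ideal_def star_add star_scale star_mult\<close>)
  then have "?J \<subseteq> {x \<in> carr A. cstar A x \<in> ?J}"
    by (rule closed_ideal_generated_minimal) (use S S_sub in blast)
  then show ?thesis using x by blast
qed

end

section \<open>An isometry that commutes asymptotically with the generators\<close>

locale isometry = unital_cstar A for A :: "'a star_algebra" +
  fixes S :: 'a
  assumes S_closed [simp]: "S \<in> carr A" and S_isometry: "cstar A S \<otimes> S = \<one>"
begin

section \<open>Powers of the isometry, defect projections and wandering elements\<close>

definition pw :: "nat \<Rightarrow> 'a" where
  "pw k = ((\<lambda>x. S \<otimes> x) ^^ k) \<one>"

definition defect :: "nat \<Rightarrow> 'a" where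
  "defect k = \<one> \<ominus> pw k \<otimes> cstar A (pw k)"

lemma pw_0 [simp]: "pw 0 = \<one>" and pw_Suc: "pw (Suc k) = S \<otimes> pw k"
  by (simp_all add: pw_def)

lemma pw_closed [simp]: "pw k \<in> carr A"
  by (induction k) (simp_all add: pw_Suc)

lemma pw_add: "pw (j + k) = pw j \<otimes> pw k"
  by (induction j) (simp_all add: pw_Suc mult_assoc)

lemma pw_Suc_right: "pw (Suc k) = pw k \<otimes> S"
  using pw_add[of k 1] by (simp add: pw_Suc)

lemma pw_isometry: "cstar A (pw k) \<otimes> pw k = \<one>"
proof (induction k)
  case (Suc k)
  have "cstar A (pw (Suc k)) \<otimes> pw (Suc k) = cstar A (pw k) \<otimes> ((cstar A S \<otimes> S) \<otimes> pw k)"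
    by (simp add: pw_Suc star_mult mult_assoc)
  then show ?case by (simp add: S_isometry Suc)
qed simp

lemma pw_isometry_cancel: "x \<in> carr A \<Longrightarrow> cstar A (pw k) \<otimes> (pw k \<otimes> x) = x"
  by (simp add: mult_assoc[symmetric] pw_isometry)

lemma norm_pw_le: "cnorm A (pw k) \<le> 1"
proof -
  have "(cnorm A (pw k))\<^sup>2 \<le> 1\<^sup>2"
    using cstar_identity[of "pw k"] norm_one_le by (simp add: pw_isometry)
  then show ?thesis by (rule power2_le_imp_le) simp
qed

lemma defect_closed [simp]: "defect k \<in> carr A"
  by (simp add: defect_def)

lemma star_defect: "cstar A (defect k) = defect k"
  by (simp add: defect_def star_sub star_mult star_star)

text \<open>The range of the higher power lies in that of the lower one, on which
  \<open>defect j\<close> vanishes. All exact cancellations below come from this.\<close>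

lemma defect_mult_pw:
  assumes "j \<le> k"
  shows "defect j \<otimes> pw k = \<zero>"
proof -
  have "pw k = pw j \<otimes> pw (k - j)" using pw_add[of j "k - j"] assms by simp
  then show ?thesis
    by (simp add: defect_def mult_sub_left mult_assoc pw_isometry_cancel sub_self)
qed

lemma defect_idem: "defect j \<otimes> defect j = defect j"
proof -
  have "defect j \<otimes> defect j = defect j \<otimes> \<one> \<ominus> (defect j \<otimes> pw j) \<otimes> cstar A (pw j)"
    by (subst (2) defect_def) (simp add: mult_sub_right mult_assoc)
  then show ?thesis by (simp add: defect_mult_pw) (simp add: csub_def add_zero)
qed

text \<open>The name comes from the Wold decomposition: in a representation \<open>defect 1\<close>
  projects onto the wandering subspace of the isometry, and \<open>wandering k\<close> shifts this
  subspace \<open>k\<close> times.\<close>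

definition wandering :: "nat \<Rightarrow> 'a" where
  "wandering k = pw k \<otimes> defect 1"

lemma wandering_closed [simp]: "wandering k \<in> carr A"
  by (simp add: wandering_def)

lemma wandering_orthogonal:
  "cstar A (wandering k) \<otimes> wandering l = (if k = l then defect 1 else \<zero>)"
proof -
  have less: "cstar A (wandering k) \<otimes> wandering l = \<zero>" if "k < l" for k l
  proof -
    have "wandering l = pw k \<otimes> (pw (l - k) \<otimes> defect 1)"
      using that pw_add[of k "l - k"] by (simp add: wandering_def mult_assoc)
    then have "cstar A (wandering k) \<otimes> wandering l = defect 1 \<otimes> (pw (l - k) \<otimes> defect 1)"
      by (simp add: wandering_def[of k] star_mult star_defect mult_assoc pw_isometry_cancel)
    also have "\<dots> = (defect 1 \<otimes> pw (l - k)) \<otimes> defect 1" by (simp add: mult_assoc)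
    also have "\<dots> = \<zero>" using that by (simp add: defect_mult_pw)
    finally show ?thesis .
  qed
  consider "k < l" | "k = l" | "l < k" by linarith
  then show ?thesis
  proof cases
    case 2
    then show ?thesis
      by (simp add: wandering_def star_mult star_defect mult_assoc pw_isometry_cancel defect_idem)
  next
    case 3
    have "cstar A (wandering k) \<otimes> wandering l = cstar A (cstar A (wandering l) \<otimes> wandering k)"
      by (simp add: star_mult star_star)
    then show ?thesis using less[OF 3] 3 by simp
  qed (use less in simp)
qed

lemma wandering_mult_defect: "wandering k \<otimes> defect 1 = wandering k"
  by (simp add: wandering_def mult_assoc defect_idem)

lemma defect_0: "defect 0 = \<zero>"
  by (simp add: defect_def sub_self)

lemma defect_Suc: "defect (Suc k) = wandering k \<otimes> cstar A (wandering k) \<oplus> defect k"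
proof -
  have "wandering k \<otimes> cstar A (wandering k) = pw k \<otimes> ((defect 1 \<otimes> defect 1) \<otimes> cstar A (pw k))"
    by (simp add: wandering_def star_mult star_defect mult_assoc)
  also have "\<dots> = pw k \<otimes> cstar A (pw k) \<ominus> pw (Suc k) \<otimes> cstar A (pw (Suc k))"
    unfolding defect_idem pw_Suc_right
    by (simp add: defect_def pw_Suc mult_sub_left mult_sub_right mult_assoc star_mult)
  finally show ?thesis
    using sub_add_sub[of "\<one>" "pw k \<otimes> cstar A (pw k)" "pw (Suc k) \<otimes> cstar A (pw (Suc k))"]
    by (simp add: defect_def add_commute)
qed

section \<open>Elements killed asymptotically by powers of the isometry\<close>

definition null_ideal :: "'a set" where
  "null_ideal = {x \<in> carr A. (\<lambda>k. cnorm A (x \<otimes> pw k)) \<longlonglongrightarrow> 0}"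

lemma null_closed: "x \<in> null_ideal \<Longrightarrow> x \<in> carr A"
  by (simp add: null_ideal_def)

lemma null_idealI:
  assumes "x \<in> carr A" and "f \<longlonglongrightarrow> 0" and "\<And>k. cnorm A (x \<otimes> pw k) \<le> f k"
  shows "x \<in> null_ideal"
proof -
  have "(\<lambda>k. cnorm A (x \<otimes> pw k)) \<longlonglongrightarrow> 0"
    using assms by (intro tendsto_sandwich[OF always_eventually always_eventually tendsto_const assms(2)])
      (auto simp: norm_nonneg)
  then show ?thesis using assms by (simp add: null_ideal_def)
qed

lemma null_ideal_eventually_zero:
  assumes "x \<in> carr A" and "\<And>k. k \<ge> K \<Longrightarrow> x \<otimes> pw k = \<zero>"
  shows "x \<in> null_ideal"
proof -
  have "(\<lambda>k. cnorm A (x \<otimes> pw k)) \<longlonglongrightarrow> 0"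
    using assms by (intro tendsto_eventually eventually_sequentiallyI[of K]) simp
  then show ?thesis using assms by (simp add: null_ideal_def)
qed

lemma null_ideal_add:
  assumes "x \<in> null_ideal" "y \<in> null_ideal"
  shows "x \<oplus> y \<in> null_ideal"
proof (rule null_idealI)
  have "(\<lambda>k. cnorm A (x \<otimes> pw k) + cnorm A (y \<otimes> pw k)) \<longlonglongrightarrow> 0 + 0"
    using assms unfolding null_ideal_def by (intro tendsto_intros) auto
  then show "(\<lambda>k. cnorm A (x \<otimes> pw k) + cnorm A (y \<otimes> pw k)) \<longlonglongrightarrow> 0" by simp
qed (use assms in \<open>simp_all add: null_closed mult_add_left norm_triangle\<close>)

lemma null_ideal_scale:
  assumes "x \<in> null_ideal"
  shows "c \<odot> x \<in> null_ideal"
proof (rule null_idealI)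
  show "(\<lambda>k. cmod c * cnorm A (x \<otimes> pw k)) \<longlonglongrightarrow> 0"
    using assms unfolding null_ideal_def by (intro tendsto_mult_right_zero) auto
qed (use assms in \<open>simp_all add: null_closed mult_scale_left norm_scale\<close>)

text \<open>Multiplication from the left only. A factor on the right would stand between
  \<open>x\<close> and \<open>pw k\<close>; controlling it is the task of
  \<open>right_absorbed\<close>.\<close>

lemma null_ideal_mult:
  assumes "a \<in> carr A" "x \<in> null_ideal"
  shows "a \<otimes> x \<in> null_ideal"
proof (rule null_idealI)
  show "(\<lambda>k. cnorm A a * cnorm A (x \<otimes> pw k)) \<longlonglongrightarrow> 0"
    using assms unfolding null_ideal_def by (intro tendsto_mult_right_zero) auto
qed (use assms in \<open>simp_all add: null_closed mult_assoc norm_mult_le\<close>)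

lemma null_ideal_zero: "\<zero> \<in> null_ideal"
  by (simp add: null_ideal_def)

lemma null_ideal_limit:
  assumes X: "\<And>n. X n \<in> null_ideal" and l: "l \<in> carr A" and lim: "cconverges A X l"
  shows "l \<in> null_ideal"
proof -
  have "(\<lambda>k. cnorm A (l \<otimes> pw k)) \<longlonglongrightarrow> 0"
  proof (rule LIMSEQ_I)
    fix e :: real assume e: "e > 0"
    then have "\<forall>\<^sub>F n in sequentially. cnorm A (X n \<ominus> l) < e / 2"
      using lim unfolding cconverges_def by (intro order_tendstoD) auto
    then obtain n where n: "cnorm A (X n \<ominus> l) < e / 2" by (auto simp: eventually_sequentially)
    have "\<forall>\<^sub>F k in sequentially. cnorm A (X n \<otimes> pw k) < e / 2"
      using X[of n] e unfolding null_ideal_def by (intro order_tendstoD) auto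
    then obtain K where K: "\<And>k. k \<ge> K \<Longrightarrow> cnorm A (X n \<otimes> pw k) < e / 2"
      by (auto simp: eventually_sequentially)
    have "norm (cnorm A (l \<otimes> pw k) - 0) < e" if "k \<ge> K" for k
    proof -
      have "cnorm A ((l \<ominus> X n) \<otimes> pw k) \<le> cnorm A (l \<ominus> X n) * cnorm A (pw k)"
        by (rule norm_mult_le) (simp_all add: l null_closed[OF X])
      also have "\<dots> \<le> cnorm A (l \<ominus> X n) * 1"
        by (intro mult_left_mono norm_pw_le norm_nonneg) (simp add: l null_closed[OF X])
      finally have "cnorm A ((l \<ominus> X n) \<otimes> pw k) < e / 2"
        using n norm_sub_commute[OF l null_closed[OF X]] by simp
      moreover have "l \<otimes> pw k = (l \<ominus> X n) \<otimes> pw k \<oplus> X n \<otimes> pw k"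
        using l null_closed[OF X] by (simp add: mult_sub_left sub_add_cancel)
      ultimately have "cnorm A (l \<otimes> pw k) < e / 2 + e / 2"
        using norm_triangle[of "(l \<ominus> X n) \<otimes> pw k" "X n \<otimes> pw k"] l null_closed[OF X] K[OF that]
        by fastforce
      then show ?thesis using norm_nonneg[of "l \<otimes> pw k"] l by simp
    qed
    then show "\<exists>K. \<forall>k\<ge>K. norm (cnorm A (l \<otimes> pw k) - 0) < e" by blast
  qed
  then show ?thesis using l by (simp add: null_ideal_def)
qed

text \<open>The condition is imposed for every \<open>j\<close>, although only
  \<open>defect 1\<close> generates the ideal: closure under products needs it for
  \<open>defect r\<close> with \<open>r\<close> tending to infinity.\<close>

definition right_absorbed :: "'a set" where
  "right_absorbed = {b \<in> carr A. \<forall>j. defect j \<otimes> b \<in> null_ideal}"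

text \<open>Insert \<open>\<one> = defect r \<oplus> pw r \<otimes> cstar A (pw r)\<close> between \<open>b\<close> and \<open>c\<close>.\<close>

lemma right_absorbed_mult:
  assumes b: "b \<in> right_absorbed" and c: "c \<in> right_absorbed"
  shows "b \<otimes> c \<in> right_absorbed"
proof -
  have bA: "b \<in> carr A" and cA: "c \<in> carr A" using b c by (auto simp: right_absorbed_def)
  have "defect j \<otimes> (b \<otimes> c) \<in> null_ideal" for j
  proof (rule null_ideal_limit)
    fix r
    show "(defect j \<otimes> b) \<otimes> (defect r \<otimes> c) \<in> null_ideal"
      by (rule null_ideal_mult) (use c bA in \<open>auto simp: right_absorbed_def\<close>)
  next
    \<comment> \<open>The two factors play different roles. Absorption of \<open>c\<close> puts the
      part with \<open>defect r\<close> into the null ideal, and absorption of \<open>b\<close>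
      makes the part with \<open>pw r\<close> tend to 0.\<close>
    have null: "(\<lambda>r. cnorm A ((defect j \<otimes> b) \<otimes> pw r)) \<longlonglongrightarrow> 0"
      using b by (auto simp: right_absorbed_def null_ideal_def)
    have "cnorm A ((defect j \<otimes> b) \<otimes> (defect r \<otimes> c) \<ominus> defect j \<otimes> (b \<otimes> c))
        \<le> cnorm A ((defect j \<otimes> b) \<otimes> pw r) * cnorm A c" for r
    proof -
      have "defect j \<otimes> (b \<otimes> c) \<ominus> (defect j \<otimes> b) \<otimes> (defect r \<otimes> c)
          = ((defect j \<otimes> b) \<otimes> pw r) \<otimes> (cstar A (pw r) \<otimes> c)"
      proof -
        have "c \<ominus> defect r \<otimes> c = pw r \<otimes> (cstar A (pw r) \<otimes> c)"
        proof -
          have "pw r \<otimes> (cstar A (pw r) \<otimes> c) \<oplus> defect r \<otimes> c = c"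
            using cA by (simp add: defect_def mult_sub_left mult_assoc add_commute[of "pw r \<otimes> _"] sub_add_cancel)
          then show ?thesis
            using cA add_sub_cancel_right[of "pw r \<otimes> (cstar A (pw r) \<otimes> c)" "defect r \<otimes> c"] by simp
        qed
        then have "(defect j \<otimes> b) \<otimes> (c \<ominus> defect r \<otimes> c) = (defect j \<otimes> b) \<otimes> (pw r \<otimes> (cstar A (pw r) \<otimes> c))"
          by simp
        then show ?thesis using bA cA by (simp add: mult_sub_right mult_assoc)
      qed
      then have "cnorm A ((defect j \<otimes> b) \<otimes> (defect r \<otimes> c) \<ominus> defect j \<otimes> (b \<otimes> c))
          = cnorm A (((defect j \<otimes> b) \<otimes> pw r) \<otimes> (cstar A (pw r) \<otimes> c))"
        using norm_sub_commute[of "defect j \<otimes> (b \<otimes> c)" "(defect j \<otimes> b) \<otimes> (defect r \<otimes> c)"] bA cA by simp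
      also have "\<dots> \<le> cnorm A ((defect j \<otimes> b) \<otimes> pw r) * cnorm A (cstar A (pw r) \<otimes> c)"
        using bA cA by (intro norm_mult_le) simp_all
      also have "\<dots> \<le> cnorm A ((defect j \<otimes> b) \<otimes> pw r) * (1 * cnorm A c)"
      proof (intro mult_left_mono norm_nonneg)
        have "cnorm A (cstar A (pw r) \<otimes> c) \<le> cnorm A (cstar A (pw r)) * cnorm A c"
          using cA by (intro norm_mult_le) simp_all
        also have "\<dots> \<le> 1 * cnorm A c"
          using norm_pw_le[of r] cA by (intro mult_right_mono) (simp_all add: norm_star norm_nonneg)
        finally show "cnorm A (cstar A (pw r) \<otimes> c) \<le> 1 * cnorm A c" .
      qed (use bA in simp)
      finally show ?thesis by simp
    qed
    then show "cconverges A (\<lambda>r. (defect j \<otimes> b) \<otimes> (defect r \<otimes> c)) (defect j \<otimes> (b \<otimes> c))"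
      unfolding cconverges_def
      by (intro tendsto_sandwich[OF always_eventually always_eventually tendsto_const
            tendsto_mult_left_zero[OF null, of "cnorm A c"]])
         (auto simp: norm_nonneg bA cA)
  qed (simp add: bA cA)
  then show ?thesis using bA cA by (simp add: right_absorbed_def)
qed

text \<open>The definition of \<open>right_absorbed\<close> is not symmetric under adjoints, so the
  adjoint is required as well; only then is the set a star subalgebra to which generation by the
  \<open>s i\<close> can be applied.\<close>

lemma right_absorbed_subalgebra:
  "unital_cstar_subalgebra A {b. b \<in> right_absorbed \<and> cstar A b \<in> right_absorbed}"
  unfolding unital_cstar_subalgebra_def
proof (intro conjI ballI allI)
  let ?N = "{b. b \<in> right_absorbed \<and> cstar A b \<in> right_absorbed}"
  have add: "x \<oplus> y \<in> right_absorbed" if "x \<in> right_absorbed" "y \<in> right_absorbed" for x y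
    using that by (auto simp: right_absorbed_def mult_add_right null_ideal_add)
  have scale: "c \<odot> x \<in> right_absorbed" if "x \<in> right_absorbed" for x c
    using that by (auto simp: right_absorbed_def mult_scale_right null_ideal_scale)
  have one: "\<one> \<in> right_absorbed"
    by (auto simp: right_absorbed_def intro!: null_ideal_eventually_zero defect_mult_pw)
  have zero: "\<zero> \<in> right_absorbed" by (simp add: right_absorbed_def null_ideal_zero)
  have closed: "x \<in> right_absorbed \<Longrightarrow> x \<in> carr A" for x by (simp add: right_absorbed_def)
  have limit: "l \<in> right_absorbed"
    if X: "\<And>k. X k \<in> right_absorbed" and l: "l \<in> carr A" and lim: "cconverges A X l" for X l
  proof -
    have "defect j \<otimes> l \<in> null_ideal" for j
    proof (rule null_ideal_limit)
      show "cconverges A (\<lambda>k. defect j \<otimes> X k) (defect j \<otimes> l)"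
        by (rule cconverges_mult_left[OF lim]) (use X l closed in auto)
      show "defect j \<otimes> X k \<in> null_ideal" for k using X by (simp add: right_absorbed_def)
    qed (simp add: l)
    then show ?thesis using l by (simp add: right_absorbed_def)
  qed
  show "?N \<subseteq> carr A" using closed by blast
  show "\<zero> \<in> ?N" "\<one> \<in> ?N" by (simp_all add: zero one)
  show "x \<oplus> y \<in> ?N" "x \<otimes> y \<in> ?N" if "x \<in> ?N" "y \<in> ?N" for x y
    using that by (auto simp: star_add star_mult closed add right_absorbed_mult)
  show "c \<odot> x \<in> ?N" if "x \<in> ?N" for c x using that by (auto simp: star_scale closed scale)
  show "cstar A x \<in> ?N" if "x \<in> ?N" for x using that by (auto simp: star_star closed)
  show "cclosed A ?N"
    unfolding cclosed_def
  proof (intro allI impI)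
    fix X l assume a: "(\<forall>k. X k \<in> ?N) \<and> l \<in> carr A \<and> cconverges A X l"
    have "l \<in> right_absorbed" by (rule limit[of X]) (use a in auto)
    moreover have "cstar A l \<in> right_absorbed"
    proof (rule limit)
      show "cconverges A (\<lambda>k. cstar A (X k)) (cstar A l)"
        by (rule cconverges_star) (use a closed in auto)
    qed (use a in auto)
    ultimately show "l \<in> ?N" by simp
  qed
qed

text \<open>As \<open>null_ideal\<close> is a left ideal, minimality is applied to the two-sided
  ideal of all \<open>x\<close> that stay null after multiplication by any \<open>b\<close> from the
  right. Absorption of every \<open>b\<close> says exactly that it contains
  \<open>defect 1\<close>.\<close>

lemma ideal_subset_null:
  assumes absorbed: "right_absorbed = carr A"
  shows "closed_ideal_generated A {defect 1} \<subseteq> null_ideal"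
proof -
  let ?I = "{x \<in> carr A. \<forall>b\<in>carr A. x \<otimes> b \<in> null_ideal}"
  have "closed_ideal A ?I"
    unfolding closed_ideal_def
  proof (intro conjI ballI allI)
    show "cclosed A ?I"
      unfolding cclosed_def
    proof (intro allI impI)
      fix X l assume a: "(\<forall>k. X k \<in> ?I) \<and> l \<in> carr A \<and> cconverges A X l"
      have "l \<otimes> b \<in> null_ideal" if b: "b \<in> carr A" for b
      proof (rule null_ideal_limit)
        show "cconverges A (\<lambda>k. X k \<otimes> b) (l \<otimes> b)"
          by (rule cconverges_mult_right) (use a b in auto)
      qed (use a b in auto)
      then show "l \<in> ?I" using a by simp
    qed
  qed (auto simp: null_ideal_zero mult_add_left null_ideal_add mult_scale_left null_ideal_scale
        mult_assoc null_ideal_mult)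
  moreover have "{defect 1} \<subseteq> ?I" using absorbed by (auto simp: right_absorbed_def)
  ultimately have "closed_ideal_generated A {defect 1} \<subseteq> ?I"
    by (rule closed_ideal_generated_minimal)
  also have "?I \<subseteq> null_ideal"
  proof
    fix x assume "x \<in> ?I"
    then have "x \<otimes> \<one> \<in> null_ideal" "x \<in> carr A" using one_closed by blast+
    then show "x \<in> null_ideal" by simp
  qed
  finally show ?thesis .
qed

end

section \<open>Products of elements that commute up to scalars\<close>

context unital_cstar
begin

text \<open>The scalar may be 0, so the relation need not be symmetric; hence the separate product
  rules for the two sides.\<close>

definition quasi_commute :: "'a \<Rightarrow> 'a \<Rightarrow> bool" where
  "quasi_commute x y \<longleftrightarrow> (\<exists>c. x \<otimes> y = c \<odot> (y \<otimes> x))"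

lemma quasi_commute_one: "x \<in> carr A \<Longrightarrow> quasi_commute x \<one>" "x \<in> carr A \<Longrightarrow> quasi_commute \<one> x"
  unfolding quasi_commute_def by (auto intro!: exI[of _ 1] simp: scale_one)

lemma quasi_commute_mult_right:
  assumes "quasi_commute x y" "quasi_commute x z" "x \<in> carr A" "y \<in> carr A" "z \<in> carr A"
  shows "quasi_commute x (y \<otimes> z)"
proof -
  obtain c d where c: "x \<otimes> y = c \<odot> (y \<otimes> x)" and d: "x \<otimes> z = d \<odot> (z \<otimes> x)"
    using assms by (auto simp: quasi_commute_def)
  have "x \<otimes> (y \<otimes> z) = (x \<otimes> y) \<otimes> z" using assms by (simp add: mult_assoc)
  also have "\<dots> = c \<odot> (y \<otimes> (x \<otimes> z))" unfolding c using assms by (simp add: mult_scale_left mult_assoc)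
  also have "\<dots> = (c * d) \<odot> ((y \<otimes> z) \<otimes> x)"
    unfolding d using assms by (simp add: mult_scale_right scale_scale mult_assoc)
  finally show ?thesis unfolding quasi_commute_def by blast
qed

lemma quasi_commute_mult_left:
  assumes "quasi_commute y x" "quasi_commute z x" "x \<in> carr A" "y \<in> carr A" "z \<in> carr A"
  shows "quasi_commute (y \<otimes> z) x"
proof -
  obtain c d where c: "y \<otimes> x = c \<odot> (x \<otimes> y)" and d: "z \<otimes> x = d \<odot> (x \<otimes> z)"
    using assms by (auto simp: quasi_commute_def)
  have "(y \<otimes> z) \<otimes> x = y \<otimes> (z \<otimes> x)" using assms by (simp add: mult_assoc)
  also have "\<dots> = d \<odot> ((y \<otimes> x) \<otimes> z)" unfolding d using assms by (simp add: mult_scale_right mult_assoc)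
  also have "\<dots> = (d * c) \<odot> (x \<otimes> (y \<otimes> z))"
    unfolding c using assms by (simp add: mult_scale_left scale_scale mult_assoc)
  finally show ?thesis unfolding quasi_commute_def by blast
qed

definition list_product :: "'a list \<Rightarrow> 'a" where
  "list_product xs = foldr (cmult A) xs \<one>"

lemma list_product_simps [simp]:
  "list_product [] = \<one>" "list_product (x # xs) = x \<otimes> list_product xs"
  by (simp_all add: list_product_def)

lemma list_product_closed: "set xs \<subseteq> carr A \<Longrightarrow> list_product xs \<in> carr A"
  by (induction xs) auto

lemma list_product_isometry:
  "set xs \<subseteq> carr A \<Longrightarrow> (\<And>x. x \<in> set xs \<Longrightarrow> cstar A x \<otimes> x = \<one>)
    \<Longrightarrow> cstar A (list_product xs) \<otimes> list_product xs = \<one>"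
proof (induction xs)
  case (Cons x xs)
  have c: "x \<in> carr A" "list_product xs \<in> carr A" using Cons.prems by (auto intro: list_product_closed)
  have "cstar A (x \<otimes> list_product xs) \<otimes> (x \<otimes> list_product xs)
      = cstar A (list_product xs) \<otimes> ((cstar A x \<otimes> x) \<otimes> list_product xs)"
    using c by (simp add: star_mult mult_assoc)
  then show ?case using Cons c by simp
qed simp

lemma quasi_commute_list_product_right:
  "x \<in> carr A \<Longrightarrow> set ys \<subseteq> carr A \<Longrightarrow> (\<And>y. y \<in> set ys \<Longrightarrow> quasi_commute x y)
    \<Longrightarrow> quasi_commute x (list_product ys)"
  by (induction ys) (auto intro!: quasi_commute_one quasi_commute_mult_right list_product_closed)

lemma quasi_commute_list_product_left:
  "x \<in> carr A \<Longrightarrow> set ys \<subseteq> carr A \<Longrightarrow> (\<And>y. y \<in> set ys \<Longrightarrow> quasi_commute y x)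
    \<Longrightarrow> quasi_commute (list_product ys) x"
  by (induction ys) (auto intro!: quasi_commute_one quasi_commute_mult_left list_product_closed)

text \<open>The first occurrence of \<open>x\<close> moves to the front past the factors before it,
  each contributing a scalar. Of the leftover word \<open>ys\<close> one only needs that its letters
  come from \<open>xs\<close>, so that it still commutes with the whole product up to a
  scalar.\<close>

lemma list_product_extract:
  assumes "set xs \<subseteq> carr A" and "\<And>y z. y \<in> set xs \<Longrightarrow> z \<in> set xs \<Longrightarrow> quasi_commute y z"
    and "x \<in> set xs"
  shows "\<exists>c ys. set ys \<subseteq> set xs \<and> list_product xs = c \<odot> (x \<otimes> list_product ys)"
  using assms
proof (induction xs)
  case (Cons a xs)
  show ?case
  proof (cases "a = x")
    case True
    then have "list_product (a # xs) = 1 \<odot> (x \<otimes> list_product xs)"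
      using Cons.prems by (simp add: scale_one list_product_closed)
    then show ?thesis by (metis set_subset_Cons)
  next
    case False
    then have "x \<in> set xs" "set xs \<subseteq> carr A" using Cons.prems by auto
    moreover have "quasi_commute y z" if "y \<in> set xs" "z \<in> set xs" for y z
      using Cons.prems(2) that by simp
    ultimately obtain c ys where ys: "set ys \<subseteq> set xs" "list_product xs = c \<odot> (x \<otimes> list_product ys)"
      using Cons.IH by blast
    have cl: "a \<in> carr A" "x \<in> carr A" "list_product ys \<in> carr A"
      using Cons.prems ys(1) list_product_closed[of ys] by auto
    obtain d where d: "a \<otimes> x = d \<odot> (x \<otimes> a)"
      using Cons.prems(2)[of a x] Cons.prems(3) by (auto simp: quasi_commute_def)
    have "list_product (a # xs) = c \<odot> ((a \<otimes> x) \<otimes> list_product ys)"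
      using cl by (simp add: ys(2) mult_scale_right mult_assoc)
    also have "\<dots> = (c * d) \<odot> (x \<otimes> list_product (a # ys))"
      unfolding d using cl by (simp add: mult_scale_left scale_scale mult_assoc)
    finally show ?thesis using ys(1) by (intro exI[of _ "c * d"] exI[of _ "a # ys"]) auto
  qed
qed simp

end

section \<open>Stability of the ideal\<close>

text \<open>This is the case of a generator: \<open>b\<close> moves past \<open>pw k\<close> up to a
  scalar, and \<open>defect j\<close> then meets \<open>pw k\<close> and annihilates it as soon as
  \<open>j \<le> k\<close>, without any limit.\<close>

lemma (in isometry) right_absorbed_quasi_commute:
  assumes b: "b \<in> carr A" "quasi_commute b S"
  shows "b \<in> right_absorbed"
proof -
  have "defect j \<otimes> b \<in> null_ideal" for j
  proof (rule null_ideal_eventually_zero[of _ j])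
    fix k assume k: "j \<le> k"
    have "quasi_commute b (pw k)"
      by (induction k) (simp_all add: pw_Suc quasi_commute_one quasi_commute_mult_right b)
    then obtain c where c: "b \<otimes> pw k = c \<odot> (pw k \<otimes> b)" by (auto simp: quasi_commute_def)
    have "(defect j \<otimes> b) \<otimes> pw k = c \<odot> ((defect j \<otimes> pw k) \<otimes> b)"
      using b c by (simp add: mult_assoc mult_scale_right)
    then show "(defect j \<otimes> b) \<otimes> pw k = \<zero>" using b k by (simp add: defect_mult_pw)
  qed (simp add: b)
  then show ?thesis using b by (simp add: right_absorbed_def)
qed

text \<open>This is the case of the adjoint of a generator. One factor \<open>S\<close> is spent on
  turning \<open>b\<close> into \<open>r\<close>, which commutes with \<open>S\<close> up to a
  scalar, so the product vanishes from \<open>Suc j\<close> on instead of \<open>j\<close>.\<close>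

lemma (in isometry) right_absorbed_factor:
  assumes b: "b \<in> carr A" and r: "r \<in> carr A" "quasi_commute r S" and eq: "b \<otimes> S = c \<odot> r"
  shows "b \<in> right_absorbed"
proof -
  have "defect j \<otimes> b \<in> null_ideal" for j
  proof (rule null_ideal_eventually_zero[of _ "Suc j"])
    fix k assume "Suc j \<le> k"
    then obtain l where k: "k = Suc l" and l: "j \<le> l" by (cases k) auto
    have "quasi_commute r (pw l)"
      by (induction l) (simp_all add: pw_Suc quasi_commute_one quasi_commute_mult_right r)
    then obtain d where d: "r \<otimes> pw l = d \<odot> (pw l \<otimes> r)" by (auto simp: quasi_commute_def)
    have "(defect j \<otimes> b) \<otimes> pw k = defect j \<otimes> ((b \<otimes> S) \<otimes> pw l)"
      using b by (simp add: k pw_Suc mult_assoc)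
    also have "\<dots> = (c * d) \<odot> ((defect j \<otimes> pw l) \<otimes> r)"
      using r by (simp add: eq mult_scale_left mult_scale_right d scale_scale mult_assoc)
    also have "\<dots> = \<zero>" using r l by (simp add: defect_mult_pw)
    finally show "(defect j \<otimes> b) \<otimes> pw k = \<zero>" .
  qed (simp add: b)
  then show ?thesis using b by (simp add: right_absorbed_def)
qed

lemma (in representation) image_ideal_concrete:
  assumes J: "closed_ideal A J" and star: "\<And>x. x \<in> J \<Longrightarrow> cstar A x \<in> J"
  shows "concrete_cstar_algebra (\<pi> ` J)"
proof
  have sub: "x \<in> J \<Longrightarrow> x \<in> carr A" for x using J by (auto simp: closed_ideal_def)
  show "complex_linear a" if "a \<in> \<pi> ` J" for a using that sub by auto
  show "0 \<in> \<pi> ` J" using J rep_zero unfolding closed_ideal_def by force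
  show "a + b \<in> \<pi> ` J" if "a \<in> \<pi> ` J" "b \<in> \<pi> ` J" for a b
  proof -
    from that obtain x y where "x \<in> J" "y \<in> J" "a = \<pi> x" "b = \<pi> y" by blast
    then show ?thesis using J sub by (intro image_eqI[of _ _ "x \<oplus> y"]) (auto simp: rep_add closed_ideal_def)
  qed
  show "op_scale c a \<in> \<pi> ` J" if "a \<in> \<pi> ` J" for c a
  proof -
    from that obtain x where "x \<in> J" "a = \<pi> x" by blast
    then show ?thesis using J sub by (intro image_eqI[of _ _ "c \<odot> x"]) (auto simp: rep_scale closed_ideal_def)
  qed
  show "a o\<^sub>L b \<in> \<pi> ` J" if "a \<in> \<pi> ` J" "b \<in> \<pi> ` J" for a b
  proof -
    from that obtain x y where "x \<in> J" "y \<in> J" "a = \<pi> x" "b = \<pi> y" by blast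
    then show ?thesis using J sub by (intro image_eqI[of _ _ "x \<otimes> y"]) (auto simp: rep_mult closed_ideal_def)
  qed
  show "adj a \<in> \<pi> ` J" if "a \<in> \<pi> ` J" for a
  proof -
    from that obtain x where "x \<in> J" "a = \<pi> x" by blast
    then show ?thesis using star sub by (intro image_eqI[of _ _ "cstar A x"]) (auto simp: rep_star)
  qed
  show "closed (\<pi> ` J)" by (rule closed_image_ideal[OF J star])
qed

lemma stable_representation_of_ideal:
  assumes "isometry A S" and "representation A \<pi>"
    and absorbed: "isometry.right_absorbed A S = carr A"
  shows "stable_operator_algebra (\<pi> ` closed_ideal_generated A {isometry.defect A S 1})"
proof -
  interpret isometry A S by (rule assms(1))
  interpret representation A \<pi> by (rule assms(2))
  define J where "J = closed_ideal_generated A {defect 1}"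
  have J: "closed_ideal A J" unfolding J_def by (rule closed_ideal_generated_is_ideal) simp
  have star: "cstar A x \<in> J" if "x \<in> J" for x
    using that unfolding J_def by (rule closed_ideal_generated_star[rotated 2]) (simp_all add: star_defect)
  have sub: "x \<in> J \<Longrightarrow> x \<in> carr A" for x using J by (auto simp: closed_ideal_def)
  interpret C: concrete_cstar_algebra "\<pi> ` J" by (rule image_ideal_concrete[OF J star])
  let ?F = "\<lambda>k. \<pi> (wandering k)"
  have "stable_operator_algebra (\<pi> ` J)"
  proof (rule C.stable)
    show "complex_linear (?F k)" for k by simp
    show "adj (?F k) o\<^sub>L ?F l = (if k = l then \<pi> (defect 1) else 0)" for k l
      using arg_cong[OF wandering_orthogonal[of k l], of \<pi>]
      by (simp add: rep_mult rep_star rep_zero split: if_splits)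
    show "?F k o\<^sub>L \<pi> (defect 1) = ?F k" for k
      using arg_cong[OF wandering_mult_defect[of k], of \<pi>] by (simp add: rep_mult)
  next
    fix k a assume "a \<in> \<pi> ` J"
    then obtain x where x: "x \<in> J" "a = \<pi> x" by blast
    have "wandering k \<otimes> x \<in> J" "cstar A (wandering k) \<otimes> x \<in> J" using J x(1) by (auto simp: closed_ideal_def)
    then show "?F k o\<^sub>L a \<in> \<pi> ` J" "adj (?F k) o\<^sub>L a \<in> \<pi> ` J"
      using x sub[OF x(1)] by (auto simp: rep_mult[symmetric] rep_star[symmetric])
  next
    fix a assume "a \<in> \<pi> ` J"
    then obtain x where x: "x \<in> J" "a = \<pi> x" by blast
    have xA: "x \<in> carr A" by (rule sub[OF x(1)])
    have sum: "(\<Sum>k<m. ?F k o\<^sub>L (adj (?F k) o\<^sub>L a)) = \<pi> (defect m \<otimes> x)" for m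
    proof (induction m)
      case (Suc m)
      then show ?case
        using xA by (simp add: x(2) defect_Suc mult_add_left rep_add rep_mult rep_star mult_assoc add.commute)
    qed (simp add: defect_0 xA rep_zero)
    \<comment> \<open>Membership in the null ideal concerns powers on the right, whereas
      \<open>x \<ominus> defect m \<otimes> x\<close> has \<open>cstar A (pw m)\<close> on the left
      of \<open>x\<close>; applying the former to \<open>cstar A x\<close> and taking adjoints
      bridges this.\<close>
    have "cstar A x \<in> null_ideal" using ideal_subset_null[OF absorbed] star[OF x(1)] by (auto simp: J_def)
    then have lim: "(\<lambda>m. cnorm A (cstar A x \<otimes> pw m)) \<longlonglongrightarrow> 0" by (simp add: null_ideal_def)
    have "cconverges A (\<lambda>m. defect m \<otimes> x) x"
      unfolding cconverges_def
    proof (rule tendsto_sandwich[OF always_eventually always_eventually tendsto_const lim])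
      show "\<forall>m. 0 \<le> cnorm A (defect m \<otimes> x \<ominus> x)" by (simp add: norm_nonneg xA)
      show "\<forall>m. cnorm A (defect m \<otimes> x \<ominus> x) \<le> cnorm A (cstar A x \<otimes> pw m)"
      proof
        fix m
        let ?y = "cstar A (pw m) \<otimes> x"
        have "defect m \<otimes> x \<oplus> pw m \<otimes> ?y = x"
          using xA by (simp add: defect_def mult_sub_left mult_assoc sub_add_cancel)
        then have "x \<ominus> defect m \<otimes> x = pw m \<otimes> ?y"
          using add_sub_cancel[of "defect m \<otimes> x" "pw m \<otimes> ?y"] xA by simp
        then have "cnorm A (defect m \<otimes> x \<ominus> x) = cnorm A (pw m \<otimes> ?y)"
          using norm_sub_commute[of x "defect m \<otimes> x"] xA by simp
        also have "\<dots> \<le> cnorm A (pw m) * cnorm A ?y" using xA by (intro norm_mult_le) simp_all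
        also have "\<dots> \<le> 1 * cnorm A ?y"
          using xA by (intro mult_right_mono norm_pw_le norm_nonneg) simp
        also have "\<dots> = cnorm A (cstar A x \<otimes> pw m)"
          using norm_star[of ?y] xA by (simp add: star_mult star_star)
        finally show "cnorm A (defect m \<otimes> x \<ominus> x) \<le> cnorm A (cstar A x \<otimes> pw m)" .
      qed
    qed
    then have "(\<lambda>m. \<pi> (defect m \<otimes> x)) \<longlonglongrightarrow> \<pi> x"
      by (intro rep_tendsto) (simp_all add: xA)
    then show "(\<lambda>m. \<Sum>k<m. ?F k o\<^sub>L (adj (?F k) o\<^sub>L a)) \<longlonglongrightarrow> a"
      unfolding sum by (simp add: x(2))
  qed
  then show ?thesis by (simp add: J_def)
qed

lemma (in representation) stable_J_ideal:
  assumes rel: "twisted_relations m n \<Theta> A s"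
    and gen: "\<And>S. unital_cstar_subalgebra A S \<Longrightarrow> s ` {1..m+n} \<subseteq> S \<Longrightarrow> S = carr A"
  shows "stable_operator_algebra (\<pi> ` J_ideal A s (m + n))"
proof -
  let ?N = "m + n"
  have s_closed: "s i \<in> carr A" and s_isometry: "cstar A (s i) \<otimes> s i = \<one>" if "i \<in> {1..?N}" for i
    using rel that by (auto simp: twisted_relations_def)
  \<comment> \<open>That \<open>c\<close> is nonzero is recorded so that the relation can be
    reversed for pairs in the opposite order.\<close>
  have less: "\<exists>c. c \<noteq> 0 \<and> s i \<otimes> s j = c \<odot> (s j \<otimes> s i)" if "1 \<le> i" "i < j" "j \<le> ?N" for i j
    using rel that unfolding twisted_relations_def by (meson exp_not_eq_zero)
  have qc: "quasi_commute (s i) (s j)" if ij: "i \<in> {1..?N}" "j \<in> {1..?N}" for i j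
  proof -
    consider "i < j" | "i = j" | "j < i" by linarith
    then show ?thesis
    proof cases
      case 1
      then show ?thesis using less[of i j] ij by (auto simp: quasi_commute_def)
    next
      case 2
      then show ?thesis
        using s_closed[OF ij(2)] by (auto simp: quasi_commute_def scale_one intro!: exI[of _ 1])
    next
      case 3
      then obtain c where c: "c \<noteq> 0" "s j \<otimes> s i = c \<odot> (s i \<otimes> s j)"
        using less[of j i] ij by auto
      then have "s i \<otimes> s j = inverse c \<odot> (s j \<otimes> s i)"
        using ij by (simp add: scale_scale scale_one s_closed)
      then show ?thesis by (auto simp: quasi_commute_def)
    qed
  qed
  define xs where "xs = map s [1..<Suc ?N]"
  have set_xs: "set xs = s ` {1..?N}" by (auto simp: xs_def)
  have xs_closed: "set xs \<subseteq> carr A" using s_closed by (auto simp: set_xs)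
  have qc_xs: "quasi_commute y z" if "y \<in> set xs" "z \<in> set xs" for y z
    using that qc unfolding set_xs by blast
  define S where "S = generator_product A s ?N"
  have S: "S = list_product xs" by (simp add: S_def generator_product_def list_product_def xs_def)
  have iso: "isometry A S"
  proof unfold_locales
    show "S \<in> carr A" unfolding S by (rule list_product_closed[OF xs_closed])
    show "cstar A S \<otimes> S = \<one>"
      unfolding S by (rule list_product_isometry[OF xs_closed]) (use s_isometry set_xs in auto)
  qed
  interpret isometry A S by (rule iso)
  have "s i \<in> right_absorbed \<and> cstar A (s i) \<in> right_absorbed" if i: "i \<in> {1..?N}" for i
  proof
    have si: "s i \<in> set xs" using i by (auto simp: set_xs)
    have siA: "s i \<in> carr A" by (rule s_closed[OF i])
    show "s i \<in> right_absorbed"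
      using siA unfolding S
      by (intro right_absorbed_quasi_commute[unfolded S] quasi_commute_list_product_right qc_xs si xs_closed)
    \<comment> \<open>With \<open>s i\<close> in front, its adjoint cancels it exactly, and a word
      in generators remains; no relation between \<open>cstar A (s i)\<close> and another generator
      is called upon.\<close>
    obtain c ys where ys: "set ys \<subseteq> set xs" "S = c \<odot> (s i \<otimes> list_product ys)"
      using list_product_extract[OF xs_closed qc_xs si] unfolding S by blast
    have R: "list_product ys \<in> carr A" using ys(1) xs_closed by (intro list_product_closed) blast
    have "quasi_commute (list_product ys) S"
      unfolding S
    proof (rule quasi_commute_list_product_left)
      show "list_product xs \<in> carr A" by (rule list_product_closed[OF xs_closed])
      show "quasi_commute y (list_product xs)" if "y \<in> set ys" for y
        using that ys(1) xs_closed by (intro quasi_commute_list_product_right qc_xs) auto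
    qed (use ys(1) xs_closed in blast)
    moreover have "cstar A (s i) \<otimes> S = c \<odot> list_product ys"
    proof -
      have "cstar A (s i) \<otimes> S = c \<odot> ((cstar A (s i) \<otimes> s i) \<otimes> list_product ys)"
        using siA R by (subst ys(2)) (simp add: mult_scale_right mult_assoc)
      then show ?thesis using R by (simp add: s_isometry[OF i])
    qed
    ultimately show "cstar A (s i) \<in> right_absorbed"
      using siA R by (intro right_absorbed_factor) auto
  qed
  then have "{b. b \<in> right_absorbed \<and> cstar A b \<in> right_absorbed} = carr A"
    by (intro gen right_absorbed_subalgebra) auto
  then have absorbed: "right_absorbed = carr A" by (auto simp: right_absorbed_def)
  have "J_ideal A s ?N = closed_ideal_generated A {defect 1}"
    by (simp add: J_ideal_def S_def[symmetric] defect_def pw_Suc)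
  then show ?thesis
    using stable_representation_of_ideal[OF iso representation_axioms absorbed] by simp
qed

theorem lemma4p9:
  fixes m n :: nat
    and \<Theta> :: "nat \<Rightarrow> nat \<Rightarrow> real"
    and B :: "'b star_algebra"
    and s :: "nat \<Rightarrow> 'b"
    and \<pi> :: "'b \<Rightarrow> ('h::complex_hilbert_space \<Rightarrow>\<^sub>L 'h)"
  assumes "m + n > 1"
    and "universal_twisted_algebra m n \<Theta> B s"
    and "separable_space (euclidean :: 'h topology)"
    and "unital_star_hom B bounded_operators \<pi>"
  shows "stable_operator_algebra (\<pi> ` J_ideal B s (m + n))"
proof -
  have unital: "unital_cstar_algebra B"
    using assms(2) by (simp add: universal_twisted_algebra_def)
  then have "representation B \<pi>"
    using assms(4)
    by (simp add: representation_def representation_axioms_def unital_cstar_def unital_cstar_axioms_def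
        unital_cstar_algebra_def)
  then show ?thesis
    by (rule representation.stable_J_ideal) (use assms(2) in \<open>auto simp: universal_twisted_algebra_def\<close>)
qed

end
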